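(* Let $E$ and $T$ be finite-dimensional complex vector spaces, $n=\dim T$, let $E^t$ be either $E^*=\mathrm{Hom}(E,\mathbb{C})$ or $E^\flat=\mathrm{Hom}(E,\Lambda^nT^* )$, let $k\ge1$, and let $N=\binom{n+k-1}{k}=\dim \mathsf{S}^kT^*$. Let $\mathrm{GL}(E)/\mathbb{Z}_2$ (with $\mathbb{Z}_2=\{\pm\mathbf{1}\}$) act on symbols $\sigma\in\mathrm{Hom}(E,E^t)\otimes\mathsf{S}^kT$, regarded as linear maps $\sigma\colon\mathsf{S}^kT^*\to\mathrm{Hom}(E,E^t)$, by $(A\circ\sigma)(q)=A^{-t}\sigma(q)A^{-1}$. Let $(q_1,\ldots,q_N)$ be an $N$-tuple of elements of $\mathsf{S}^kT^*$ in general position (linearly independent). Then the field $\mathcal{F}$ of rational $\mathrm{GL}(E)/\mathbb{Z}_2$-invariants of symbols $\sigma$ is generated by the Procesi invariants $J^\sigma_I=J^\sigma_I(q_1,\ldots,q_N)$ of the $N$-tuples $(\sigma_{q_1},\ldots,\sigma_{q_N})$, where $I$ ranges over all multi-indices of length $s\le2^{\dim E}-1$.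
   Context: Pairing and duals: $\langle x,u\rangle$ denotes the pairing of $x\in E$, $u\in E^t$ (with values in $\mathbb{C}$ or in $\Lambda^nT^*$). Elements $b\in\mathrm{Hom}(E,E^t)$ are identified with bilinear forms $b(x,y)=\langle bx,y\rangle$, and $b^t\in\mathrm{Hom}(E,E^t)$ is defined by $\langle bx,y\rangle=\langle x,b^ty\rangle$. For $A\in\mathrm{GL}(E)$, $A^t$ is the dual operator on $E^t$ and $A^{-t}=(A^{-1})^t$. Put $b_s=\frac{b+b^t}2$, $b_a=\frac{b-b^t}2$, and, if $b_s$ is invertible, $\mathcal{S}^b=b_s^{-1}b_a\in\mathrm{End}(E)$. For an invertible form $g$ and $\mathcal{A}\in\mathrm{End}(E)$, the $g$-dual operator $\mathcal{A}_g$ is defined by $g(\mathcal{A}x,y)=g(x,\mathcal{A}_gy)$ for all $x,y\in E$. Procesi invariants: for $q_1,\ldots,q_N\in\mathsf{S}^kT^*$ write $\sigma_{q_i}=\sigma(q_i)$, let $g=(\sigma_{q_1})_s$ (assumed invertible), and define operators $\mathcal{A}_1=\mathcal{S}^{\sigma_{q_1}}=g^{-1}(\sigma_{q_1})_a$ and $\mathcal{A}_i=g^{-1}\sigma_{q_i}$ for $2\le i\le N$. The Procesi invariants are the rational functions $$J^\sigma_I(q_1,\ldots,q_N)=\mathrm{tr}(\mathcal{X}_{i_1}\cdots\mathcal{X}_{i_s}),$$ where $I=(i_1,\ldots,i_s)$ is a multi-index with entries in $\{1,\ldots,N\}$ of length $s\le 2^{\dim E}-1$ and each $\mathcal{X}_{i_j}$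 is either $\mathcal{A}_{i_j}$ or $(\mathcal{A}_{i_j})_g$ (all such choices are included). *)

theory Defs
  imports
    Complex_Main
    "HOL-Library.Function_Algebras"
    "HOL-Computational_Algebra.Polynomial"
    "HOL-Algebra.Generated_Fields"
    "HOL-Algebra.Coset"
begin

section \<open>Spaces of linear maps\<close>

text \<open>
  Abstract complex vector spaces are given by a scalar multiplication on a type; function spaces
  carry the pointwise operations (the addition comes from the theory of function algebras).
\<close>

definition fun_scale :: "('c \<Rightarrow> 'b \<Rightarrow> 'b) \<Rightarrow> 'c \<Rightarrow> ('a \<Rightarrow> 'b) \<Rightarrow> 'a \<Rightarrow> 'b"
  where "fun_scale s c f = (\<lambda>x. s c (f x))"

text \<open>
  Linear maps from a subspace \<open>U\<close> to a subspace \<open>W\<close>. They are represented by total functions that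
  vanish outside \<open>U\<close>, so that equality of functions is equality of linear maps.
\<close>

definition lin_maps ::
  "('c \<Rightarrow> 'a \<Rightarrow> 'a) \<Rightarrow> 'a set \<Rightarrow> ('c \<Rightarrow> 'b \<Rightarrow> 'b) \<Rightarrow> 'b set \<Rightarrow> ('a::ab_group_add \<Rightarrow> 'b::ab_group_add) set"
  where
  "lin_maps s1 U s2 W =
    {f. (\<forall>x\<in>U. f x \<in> W) \<and>
        (\<forall>x\<in>U. \<forall>y\<in>U. f (x + y) = f x + f y) \<and>
        (\<forall>c. \<forall>x\<in>U. f (s1 c x) = s2 c (f x)) \<and>
        (\<forall>x. x \<notin> U \<longrightarrow> f x = 0)}"

lemma vector_space_fun_scale:
  assumes "vector_space s"
  shows "vector_space (fun_scale s)"
proof -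
  interpret vector_space s by fact
  show ?thesis
    by unfold_locales
      (auto simp: fun_scale_def fun_eq_iff scale_right_distrib scale_left_distrib)
qed

lemma subspace_lin_maps:
  assumes "vector_space s1" "module.subspace s1 U" "vector_space s2" "module.subspace s2 W"
  shows "module.subspace (fun_scale s2) (lin_maps s1 U s2 W)"
proof -
  interpret v1: vector_space s1 by fact
  interpret v2: vector_space s2 by fact
  interpret vf: vector_space "fun_scale s2 :: _ \<Rightarrow> ('b \<Rightarrow> 'c) \<Rightarrow> _"
    by (rule vector_space_fun_scale) fact
  show ?thesis
    using assms(2,4)
    by (auto simp: vf.subspace_def v1.subspace_def v2.subspace_def lin_maps_def fun_scale_def
        v2.scale_right_distrib v2.scale_left_commute)
qed


section \<open>Symmetric and exterior powers of the dual space\<close>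

text \<open>
  A multilinear form in \<open>m\<close> arguments is a function on argument lists, with value \<open>0\<close> on
  lists of a length other than \<open>m\<close>.
\<close>

definition multilinear_forms :: "(complex \<Rightarrow> 't \<Rightarrow> 't) \<Rightarrow> nat \<Rightarrow> ('t::ab_group_add list \<Rightarrow> complex) set"
  where
  "multilinear_forms sT m =
    {w. (\<forall>xs. length xs \<noteq> m \<longrightarrow> w xs = 0) \<and>
        (\<forall>xs i. length xs = m \<and> i < m \<longrightarrow> Vector_Spaces.linear sT (*) (\<lambda>x. w (xs[i := x])))}"

text \<open>\<open>S\<^sup>k T\<^sup>*\<close>, realized (in characteristic 0) as the space of symmetric \<open>k\<close>-linear forms on \<open>T\<close>\<close>

definition sym_forms :: "(complex \<Rightarrow> 't \<Rightarrow> 't) \<Rightarrow> nat \<Rightarrow> ('t::ab_group_add list \<Rightarrow> complex) set"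
  where
  "sym_forms sT k =
    {w \<in> multilinear_forms sT k.
      \<forall>xs i j. length xs = k \<and> i < k \<and> j < k \<longrightarrow> w (xs[i := xs ! j, j := xs ! i]) = w xs}"

text \<open>\<open>\<Lambda>\<^sup>m T\<^sup>*\<close>, as the space of alternating \<open>m\<close>-linear forms on \<open>T\<close>\<close>

definition alt_forms :: "(complex \<Rightarrow> 't \<Rightarrow> 't) \<Rightarrow> nat \<Rightarrow> ('t::ab_group_add list \<Rightarrow> complex) set"
  where
  "alt_forms sT m =
    {w \<in> multilinear_forms sT m.
      \<forall>xs i j. length xs = m \<and> i < j \<and> j < m \<and> xs ! i = xs ! j \<longrightarrow> w xs = 0}"

lemma subspace_multilinear_forms:
  assumes "vector_space sT"
  shows "module.subspace (fun_scale (*)) (multilinear_forms sT m)"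
proof -
  interpret pair: vector_space_pair sT "(*) :: complex \<Rightarrow> complex \<Rightarrow> complex"
    using assms by (auto simp: vector_space_pair_def vector_space_def algebra_simps)
  interpret vf: vector_space "fun_scale ((*) :: complex \<Rightarrow> complex \<Rightarrow> complex)
      :: complex \<Rightarrow> ('a list \<Rightarrow> complex) \<Rightarrow> _"
    by (rule vector_space_fun_scale) (rule pair.vs2.vector_space_axioms)
  show ?thesis
    using pair.linear_zero pair.linear_compose_add pair.linear_compose_scale_right
    by (auto simp: vf.subspace_def multilinear_forms_def fun_scale_def)
qed

lemma subspace_sym_forms:
  assumes "vector_space sT"
  shows "module.subspace (fun_scale (*)) (sym_forms sT k)"
proof -
  interpret vf: vector_space "fun_scale ((*) :: complex \<Rightarrow> complex \<Rightarrow> complex)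
      :: complex \<Rightarrow> ('a list \<Rightarrow> complex) \<Rightarrow> _"
    by (rule vector_space_fun_scale) (auto simp: vector_space_def algebra_simps)
  show ?thesis
    using subspace_multilinear_forms[OF assms, of k]
    by (auto simp: vf.subspace_def sym_forms_def fun_scale_def)
qed

lemma subspace_alt_forms:
  assumes "vector_space sT"
  shows "module.subspace (fun_scale (*)) (alt_forms sT m)"
proof -
  interpret vf: vector_space "fun_scale ((*) :: complex \<Rightarrow> complex \<Rightarrow> complex)
      :: complex \<Rightarrow> ('a list \<Rightarrow> complex) \<Rightarrow> _"
    by (rule vector_space_fun_scale) (auto simp: vector_space_def algebra_simps)
  show ?thesis
    using subspace_multilinear_forms[OF assms, of m]
    by (auto simp: vf.subspace_def alt_forms_def fun_scale_def)
qed


section \<open>Bilinear forms with values in a line\<close>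

text \<open>
  \<open>E\<^sup>t = Hom(E, L)\<close>, where \<open>L\<close> (with scalar multiplication \<open>sL\<close>) is the space of values of the
  pairing \<open>\<langle>x, u\<rangle> = u x\<close>: the choice \<open>L = \<complex>\<close> gives \<open>E\<^sup>*\<close> and \<open>L = \<Lambda>\<^sup>n T\<^sup>*\<close> gives \<open>E\<^sup>\<flat>\<close>.
  An element \<open>b\<close> of \<open>Hom(E, E\<^sup>t)\<close> is a curried function, hence \<open>b(x, y) = \<langle>b x, y\<rangle>\<close> is
  \<open>b x y\<close>.
\<close>

definition Et :: "(complex \<Rightarrow> 'e \<Rightarrow> 'e) \<Rightarrow> (complex \<Rightarrow> 'l \<Rightarrow> 'l) \<Rightarrow> 'l set
    \<Rightarrow> ('e::ab_group_add \<Rightarrow> 'l::ab_group_add) set"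
  where "Et sE sL L = lin_maps sE UNIV sL L"

definition Hom_E_Et :: "(complex \<Rightarrow> 'e \<Rightarrow> 'e) \<Rightarrow> (complex \<Rightarrow> 'l \<Rightarrow> 'l) \<Rightarrow> 'l set
    \<Rightarrow> ('e::ab_group_add \<Rightarrow> 'e \<Rightarrow> 'l::ab_group_add) set"
  where "Hom_E_Et sE sL L = lin_maps sE UNIV (fun_scale sL) (Et sE sL L)"

definition form_transpose :: "('e \<Rightarrow> 'e \<Rightarrow> 'l) \<Rightarrow> 'e \<Rightarrow> 'e \<Rightarrow> 'l"
  where "form_transpose b = (\<lambda>x y. b y x)"

definition form_sym :: "(complex \<Rightarrow> 'l \<Rightarrow> 'l) \<Rightarrow> ('e \<Rightarrow> 'e \<Rightarrow> 'l::ab_group_add) \<Rightarrow> 'e \<Rightarrow> 'e \<Rightarrow> 'l"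
  where "form_sym sL b = fun_scale (fun_scale sL) (1/2) (b + form_transpose b)"

definition form_skew :: "(complex \<Rightarrow> 'l \<Rightarrow> 'l) \<Rightarrow> ('e \<Rightarrow> 'e \<Rightarrow> 'l::ab_group_add) \<Rightarrow> 'e \<Rightarrow> 'e \<Rightarrow> 'l"
  where "form_skew sL b = fun_scale (fun_scale sL) (1/2) (b - form_transpose b)"

text \<open>
  \<open>g\<^sup>-\<^sup>1 b \<in> End(E)\<close> and the \<open>g\<close>-dual operator. Both are meaningful only for invertible \<open>g\<close> and
  are unspecified otherwise.
\<close>

definition form_quotient :: "('e \<Rightarrow> 'e \<Rightarrow> 'l) \<Rightarrow> ('e \<Rightarrow> 'e \<Rightarrow> 'l) \<Rightarrow> 'e \<Rightarrow> 'e"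
  where "form_quotient g b = inv_into UNIV g \<circ> b"

definition form_dual :: "('e \<Rightarrow> 'e \<Rightarrow> 'l) \<Rightarrow> ('e \<Rightarrow> 'e) \<Rightarrow> 'e \<Rightarrow> 'e"
  where "form_dual g A = (THE B. \<forall>x y. g (A x) y = g x (B y))"

text \<open>The trace of an operator does not depend on the basis \<open>BE\<close> used to compute it.\<close>

definition op_trace :: "(complex \<Rightarrow> 'e \<Rightarrow> 'e) \<Rightarrow> 'e set \<Rightarrow> ('e::ab_group_add \<Rightarrow> 'e) \<Rightarrow> complex"
  where "op_trace sE BE A = (\<Sum>b\<in>BE. module.representation sE BE (A b) b)"


section \<open>Symbols and the group action\<close>

text \<open>\<open>Hom(E, E\<^sup>t) \<otimes> S\<^sup>k T\<close>, regarded as \<open>Hom(S\<^sup>k T\<^sup>*, Hom(E, E\<^sup>t))\<close>\<close>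

definition symbols ::
  "(complex \<Rightarrow> 'e \<Rightarrow> 'e) \<Rightarrow> (complex \<Rightarrow> 't \<Rightarrow> 't) \<Rightarrow> (complex \<Rightarrow> 'l \<Rightarrow> 'l) \<Rightarrow> 'l set \<Rightarrow> nat
    \<Rightarrow> (('t::ab_group_add list \<Rightarrow> complex) \<Rightarrow> 'e::ab_group_add \<Rightarrow> 'e \<Rightarrow> 'l::ab_group_add) set"
  where
  "symbols sE sT sL L k =
    lin_maps (fun_scale (*)) (sym_forms sT k) (fun_scale (fun_scale sL)) (Hom_E_Et sE sL L)"

abbreviation symbol_scale ::
  "(complex \<Rightarrow> 'l \<Rightarrow> 'l) \<Rightarrow> complex \<Rightarrow> (('t list \<Rightarrow> complex) \<Rightarrow> 'e \<Rightarrow> 'e \<Rightarrow> 'l)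
    \<Rightarrow> ('t list \<Rightarrow> complex) \<Rightarrow> 'e \<Rightarrow> 'e \<Rightarrow> 'l"
  where "symbol_scale sL \<equiv> fun_scale (fun_scale (fun_scale sL))"

lemma subspace_symbols:
  assumes "vector_space sE" "vector_space sT" "vector_space sL" "module.subspace sL L"
  shows "module.subspace (symbol_scale sL) (symbols sE sT sL L k)"
proof -
  interpret E: vector_space sE by fact
  have "vector_space ((*) :: complex \<Rightarrow> complex \<Rightarrow> complex)"
    by (auto simp: vector_space_def algebra_simps)
  then show ?thesis
    unfolding symbols_def Hom_E_Et_def Et_def
    by (intro subspace_lin_maps vector_space_fun_scale subspace_sym_forms E.subspace_UNIV assms)
qed

definition GL :: "(complex \<Rightarrow> 'e \<Rightarrow> 'e) \<Rightarrow> ('e::ab_group_add \<Rightarrow> 'e) monoid"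
  where "GL sE = \<lparr>carrier = {A. Vector_Spaces.linear sE sE A \<and> bij A}, monoid.mult = (\<circ>), one = id\<rparr>"

definition Z2 :: "('e::ab_group_add \<Rightarrow> 'e) set"
  where "Z2 = {id, uminus}"

text \<open>\<open>A\<^sup>t\<close>, acting on \<open>E\<^sup>t\<close>; hence \<open>(A \<circ> \<sigma>)(q) = A\<^sup>-\<^sup>t \<sigma>(q) A\<^sup>-\<^sup>1\<close> below\<close>

definition dual_op :: "('e \<Rightarrow> 'e) \<Rightarrow> ('e \<Rightarrow> 'l) \<Rightarrow> 'e \<Rightarrow> 'l"
  where "dual_op A u = u \<circ> A"

definition symbol_act :: "('e \<Rightarrow> 'e) \<Rightarrow> ('q \<Rightarrow> 'e \<Rightarrow> 'e \<Rightarrow> 'l) \<Rightarrow> 'q \<Rightarrow> 'e \<Rightarrow> 'e \<Rightarrow> 'l"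
  where "symbol_act A \<sigma> q = dual_op (inv_into UNIV A) \<circ> \<sigma> q \<circ> inv_into UNIV A"


section \<open>Rational functions on a vector space\<close>

text \<open>
  Polynomial functions on a subspace \<open>V\<close>: the algebra generated by the linear functionals.
  Only their values on \<open>V\<close> matter below.
\<close>

inductive_set poly_fun :: "(complex \<Rightarrow> 'v \<Rightarrow> 'v) \<Rightarrow> 'v set \<Rightarrow> ('v::ab_group_add \<Rightarrow> complex) set"
  for s V where
  const: "(\<lambda>_. c) \<in> poly_fun s V"
| functional: "f \<in> lin_maps s V (*) UNIV \<Longrightarrow> f \<in> poly_fun s V"
| add: "f \<in> poly_fun s V \<Longrightarrow> g \<in> poly_fun s V \<Longrightarrow> (\<lambda>v. f v + g v) \<in> poly_fun s V"
| mult: "f \<in> poly_fun s V \<Longrightarrow> g \<in> poly_fun s V \<Longrightarrow> (\<lambda>v. f v * g v) \<in> poly_fun s V"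

text \<open>On a nonempty Zariski-open subset of \<open>V\<close>\<close>

definition generically :: "(complex \<Rightarrow> 'v \<Rightarrow> 'v) \<Rightarrow> 'v set \<Rightarrow> ('v::ab_group_add \<Rightarrow> bool) \<Rightarrow> bool"
  where
  "generically s V P \<longleftrightarrow>
    (\<exists>h\<in>poly_fun s V. (\<exists>v\<in>V. h v \<noteq> 0) \<and> (\<forall>v\<in>V. h v \<noteq> 0 \<longrightarrow> P v))"

definition germ :: "(complex \<Rightarrow> 'v \<Rightarrow> 'v) \<Rightarrow> 'v set \<Rightarrow> ('v::ab_group_add \<Rightarrow> complex) \<Rightarrow> ('v \<Rightarrow> complex) set"
  where "germ s V f = {f'. generically s V (\<lambda>v. f v = f' v)}"

text \<open>
  The field \<open>\<complex>(V)\<close>: quotients \<open>p/q\<close> of polynomial functions with \<open>q \<noteq> 0\<close>, identified if they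
  agree generically. By this identification the value of a representative at the zeros of its
  denominator is irrelevant. Lemma \<open>field_rat_field\<close> shows that this is a field.
\<close>

definition rat_field :: "(complex \<Rightarrow> 'v \<Rightarrow> 'v) \<Rightarrow> 'v set \<Rightarrow> ('v::ab_group_add \<Rightarrow> complex) set ring"
  where
  "rat_field s V =
    \<lparr>carrier = {germ s V (\<lambda>v. p v / q v) | p q.
                  p \<in> poly_fun s V \<and> q \<in> poly_fun s V \<and> (\<exists>v\<in>V. q v \<noteq> 0)},
     monoid.mult = (\<lambda>X Y. \<Union>f\<in>X. \<Union>g\<in>Y. germ s V (\<lambda>v. f v * g v)),
     one = germ s V (\<lambda>_. 1),
     ring.zero = germ s V (\<lambda>_. 0),
     ring.add = (\<lambda>X Y. \<Union>f\<in>X. \<Union>g\<in>Y. germ s V (\<lambda>v. f v + g v))\<rparr>"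

lemma poly_fun_line:
  assumes "vector_space s" "module.subspace s V" "p \<in> poly_fun s V" "v \<in> V" "w \<in> V"
  shows "\<exists>P. \<forall>t. p (v + s t w) = poly P t"
proof -
  interpret vector_space s by fact
  have sc: "s t w \<in> V" for t
    using assms(2,5) by (auto simp: subspace_def)
  show ?thesis
    using assms(3)
  proof induction
    case (const c)
    show ?case by (rule exI[of _ "[:c:]"]) simp
  next
    case (functional f)
    have "f (v + s t w) = poly [:f v, f w:] t" for t
      using functional assms(4,5) sc by (simp add: lin_maps_def)
    then show ?case by blast
  next
    case (add f g)
    then show ?case by (metis poly_add)
  next
    case (mult f g)
    then show ?case by (metis poly_mult)
  qed
qed

lemma poly_fun_no_zero_divisors:
  assumes "vector_space s" "module.subspace s V"
    and "p \<in> poly_fun s V" "v \<in> V" "p v \<noteq> 0" "q \<in> poly_fun s V" "w \<in> V" "q w \<noteq> 0"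
  shows "\<exists>u\<in>V. p u * q u \<noteq> 0"
proof -
  interpret vector_space s by fact
  have wv: "w - v \<in> V"
    using assms(2,4,7) by (rule_tac subspace_diff)
  obtain P Q where P: "\<And>t. p (v + s t (w - v)) = poly P t"
    and Q: "\<And>t. q (v + s t (w - v)) = poly Q t"
    using poly_fun_line[OF assms(1,2) _ \<open>v \<in> V\<close> wv] assms(3,6) by metis
  have "poly P 0 \<noteq> 0" "poly Q 1 \<noteq> 0"
    using P[of 0] Q[of 1] assms(5,8) by auto
  then have "P * Q \<noteq> 0" by auto
  then obtain t where "poly (P * Q) t \<noteq> 0"
    using poly_all_0_iff_0 by blast
  then have "p (v + s t (w - v)) * q (v + s t (w - v)) \<noteq> 0"
    by (simp add: P Q)
  moreover have "v + s t (w - v) \<in> V"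
    using assms(2,4) wv by (auto simp: subspace_def)
  ultimately show ?thesis by blast
qed

lemma generically_mono:
  "generically s V P \<Longrightarrow> (\<And>v. v \<in> V \<Longrightarrow> P v \<Longrightarrow> Q v) \<Longrightarrow> generically s V Q"
  unfolding generically_def by meson

lemma generically_all:
  assumes "module.subspace s V" "vector_space s" "\<And>v. v \<in> V \<Longrightarrow> P v"
  shows "generically s V P"
proof -
  interpret vector_space s by fact
  have "0 \<in> V" using assms(1) by (simp add: subspace_def)
  then show ?thesis
    unfolding generically_def using assms(3) poly_fun.const[of 1 s V]
    by (intro bexI[of _ "\<lambda>_. 1"]) auto
qed

lemma generically_conj:
  assumes "vector_space s" "module.subspace s V" "generically s V P" "generically s V Q"
  shows "generically s V (\<lambda>v. P v \<and> Q v)"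
proof -
  obtain h v k w where h: "h \<in> poly_fun s V" "v \<in> V" "h v \<noteq> 0" "\<forall>v\<in>V. h v \<noteq> 0 \<longrightarrow> P v"
    and k: "k \<in> poly_fun s V" "w \<in> V" "k w \<noteq> 0" "\<forall>v\<in>V. k v \<noteq> 0 \<longrightarrow> Q v"
    using assms(3,4) unfolding generically_def by blast
  show ?thesis
    unfolding generically_def
    using poly_fun_no_zero_divisors[OF assms(1,2) h(1-3) k(1-3)] poly_fun.mult[OF h(1) k(1)] h(4) k(4)
    by (intro bexI[of _ "\<lambda>v. h v * k v"]) auto
qed

lemma germ_eq_iff:
  assumes "vector_space s" "module.subspace s V"
  shows "germ s V f = germ s V g \<longleftrightarrow> generically s V (\<lambda>v. f v = g v)"
proof
  assume "germ s V f = germ s V g"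
  moreover have "g \<in> germ s V g"
    unfolding germ_def using generically_all[OF assms(2,1)] by simp
  ultimately show "generically s V (\<lambda>v. f v = g v)"
    by (auto simp: germ_def)
next
  assume *: "generically s V (\<lambda>v. f v = g v)"
  have "generically s V (\<lambda>v. f v = h v) \<longleftrightarrow> generically s V (\<lambda>v. g v = h v)" for h
    by (rule iffI; drule generically_conj[OF assms *]; erule generically_mono) auto
  then show "germ s V f = germ s V g"
    by (simp add: germ_def)
qed

lemma germ_self:
  assumes "vector_space s" "module.subspace s V"
  shows "f \<in> germ s V f"
  unfolding germ_def using generically_all[OF assms(2,1)] by simp

lemma rat_field_mult_germ:
  assumes "vector_space s" "module.subspace s V"
  shows "germ s V f \<otimes>\<^bsub>rat_field s V\<^esub> germ s V g = germ s V (\<lambda>v. f v * g v)"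
proof -
  have *: "germ s V (\<lambda>v. f' v * g' v) = germ s V (\<lambda>v. f v * g v)"
    if "f' \<in> germ s V f" "g' \<in> germ s V g" for f' g'
    unfolding germ_eq_iff[OF assms]
    by (rule generically_mono[OF generically_conj[OF assms, of "\<lambda>v. f v = f' v" "\<lambda>v. g v = g' v"]])
      (use that in \<open>auto simp: germ_def\<close>)
  have "germ s V f \<noteq> {}" "germ s V g \<noteq> {}"
    using germ_self[OF assms, of f] germ_self[OF assms, of g] by blast+
  then show ?thesis
    by (simp add: rat_field_def * cong: SUP_cong)
qed

lemma rat_field_add_germ:
  assumes "vector_space s" "module.subspace s V"
  shows "germ s V f \<oplus>\<^bsub>rat_field s V\<^esub> germ s V g = germ s V (\<lambda>v. f v + g v)"
proof -
  have *: "germ s V (\<lambda>v. f' v + g' v) = germ s V (\<lambda>v. f v + g v)"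
    if "f' \<in> germ s V f" "g' \<in> germ s V g" for f' g'
    unfolding germ_eq_iff[OF assms]
    by (rule generically_mono[OF generically_conj[OF assms, of "\<lambda>v. f v = f' v" "\<lambda>v. g v = g' v"]])
      (use that in \<open>auto simp: germ_def\<close>)
  have "germ s V f \<noteq> {}" "germ s V g \<noteq> {}"
    using germ_self[OF assms, of f] germ_self[OF assms, of g] by blast+
  then show ?thesis
    by (simp add: rat_field_def * cong: SUP_cong)
qed

lemma carrier_rat_fieldI:
  assumes "vector_space s" "module.subspace s V"
    and "p \<in> poly_fun s V" "q \<in> poly_fun s V" "v \<in> V" "q v \<noteq> 0"
    and "generically s V (\<lambda>v. f v = p v / q v)"
  shows "germ s V f \<in> carrier (rat_field s V)"
  using assms germ_eq_iff[OF assms(1,2), of f "\<lambda>v. p v / q v"]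
  by (auto simp: rat_field_def)

lemma field_rat_field:
  assumes "vector_space s" "module.subspace s V"
  shows "field (rat_field s V)"
proof -
  let ?R = "rat_field s V"
  note mult = rat_field_mult_germ[OF assms] and add = rat_field_add_germ[OF assms]
    and eq = germ_eq_iff[OF assms] and all = generically_all[OF assms(2,1)]
  have one: "\<one>\<^bsub>?R\<^esub> = germ s V (\<lambda>_. 1)" and zero: "\<zero>\<^bsub>?R\<^esub> = germ s V (\<lambda>_. 0)"
    by (simp_all add: rat_field_def)
  have rep: "\<exists>p q v. X = germ s V (\<lambda>v. p v / q v) \<and> p \<in> poly_fun s V \<and> q \<in> poly_fun s V
      \<and> v \<in> V \<and> q v \<noteq> 0" if "X \<in> carrier ?R" for X
    using that unfolding rat_field_def by auto
  have V0: "0 \<in> V"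
  proof -
    interpret vector_space s by fact
    show ?thesis using assms(2) by (rule subspace_0)
  qed
  have nz: "generically s V (\<lambda>v. q v \<noteq> 0)" if "q \<in> poly_fun s V" "v \<in> V" "q v \<noteq> 0" for q v
    using that unfolding generically_def by blast
  have const: "germ s V (\<lambda>_. c) \<in> carrier ?R" for c
    by (rule carrier_rat_fieldI[OF assms poly_fun.const[of c] poly_fun.const[of 1] V0])
      (simp, rule all, simp)
  have mult_closed: "X \<otimes>\<^bsub>?R\<^esub> Y \<in> carrier ?R" if XY: "X \<in> carrier ?R" "Y \<in> carrier ?R" for X Y
  proof -
    obtain p q v where X: "X = germ s V (\<lambda>v. p v / q v)" "p \<in> poly_fun s V"
        "q \<in> poly_fun s V" "v \<in> V" "q v \<noteq> 0"
      using rep[OF XY(1)] by blast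
    obtain p' q' v' where Y: "Y = germ s V (\<lambda>v. p' v / q' v)" "p' \<in> poly_fun s V" "q' \<in> poly_fun s V"
        "v' \<in> V" "q' v' \<noteq> 0"
      using rep[OF XY(2)] by blast
    obtain u where u: "u \<in> V" "q u * q' u \<noteq> 0"
      using poly_fun_no_zero_divisors[OF assms X(3-5) Y(3-5)] by blast
    show ?thesis
      unfolding X(1) Y(1) mult
      by (rule carrier_rat_fieldI[OF assms poly_fun.mult[OF X(2) Y(2)] poly_fun.mult[OF X(3) Y(3)] u])
        (rule all, simp)
  qed
  have add_closed: "X \<oplus>\<^bsub>?R\<^esub> Y \<in> carrier ?R" if XY: "X \<in> carrier ?R" "Y \<in> carrier ?R" for X Y
  proof -
    obtain p q v where X: "X = germ s V (\<lambda>v. p v / q v)" "p \<in> poly_fun s V"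
        "q \<in> poly_fun s V" "v \<in> V" "q v \<noteq> 0"
      using rep[OF XY(1)] by blast
    obtain p' q' v' where Y: "Y = germ s V (\<lambda>v. p' v / q' v)" "p' \<in> poly_fun s V" "q' \<in> poly_fun s V"
        "v' \<in> V" "q' v' \<noteq> 0"
      using rep[OF XY(2)] by blast
    obtain u where u: "u \<in> V" "q u * q' u \<noteq> 0"
      using poly_fun_no_zero_divisors[OF assms X(3-5) Y(3-5)] by blast
    have num: "(\<lambda>v. p v * q' v + p' v * q v) \<in> poly_fun s V"
      using X Y by (intro poly_fun.add poly_fun.mult)
    have "generically s V (\<lambda>v. p v / q v + p' v / q' v = (p v * q' v + p' v * q v) / (q v * q' v))"
      by (rule generically_mono[OF generically_conj[OF assms nz[OF X(3-5)] nz[OF Y(3-5)]]])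
        (auto simp: field_simps)
    then show ?thesis
      unfolding X(1) Y(1) add
      by (rule carrier_rat_fieldI[OF assms num poly_fun.mult[OF X(3) Y(3)] u])
  qed
  have germE: "\<exists>f. X = germ s V f" if "X \<in> carrier ?R" for X
    using rep[OF that] by blast
  have neg: "\<exists>Y\<in>carrier ?R. Y \<oplus>\<^bsub>?R\<^esub> X = \<zero>\<^bsub>?R\<^esub>" if X: "X \<in> carrier ?R" for X
  proof -
    obtain f where f: "X = germ s V f" using germE[OF X] by blast
    have "germ s V (\<lambda>_. -1) \<otimes>\<^bsub>?R\<^esub> X \<in> carrier ?R"
      by (rule mult_closed[OF const X])
    then have "germ s V (\<lambda>v. - 1 * f v) \<in> carrier ?R"
      by (simp only: f mult)
    moreover have "germ s V (\<lambda>v. - 1 * f v) \<oplus>\<^bsub>?R\<^esub> X = \<zero>\<^bsub>?R\<^esub>"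
      unfolding f add zero by simp
    ultimately show ?thesis by blast
  qed
  interpret R: cring ?R
  proof (rule cringI)
    show "abelian_group ?R"
    proof (rule abelian_groupI)
      fix X Y Z assume XYZ: "X \<in> carrier ?R" "Y \<in> carrier ?R" "Z \<in> carrier ?R"
      obtain f g h where "X = germ s V f" "Y = germ s V g" "Z = germ s V h"
        using XYZ[THEN germE] by blast
      then show "X \<oplus>\<^bsub>?R\<^esub> Y \<oplus>\<^bsub>?R\<^esub> Z = X \<oplus>\<^bsub>?R\<^esub> (Y \<oplus>\<^bsub>?R\<^esub> Z)"
        by (simp add: add add.assoc)
    next
      fix X Y assume XY: "X \<in> carrier ?R" "Y \<in> carrier ?R"
      obtain f g where fg: "X = germ s V f" "Y = germ s V g"
        using XY[THEN germE] by blast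
      show "X \<oplus>\<^bsub>?R\<^esub> Y = Y \<oplus>\<^bsub>?R\<^esub> X"
        by (simp add: fg add add.commute)
      show "\<zero>\<^bsub>?R\<^esub> \<oplus>\<^bsub>?R\<^esub> X = X"
        by (simp add: fg add zero)
      show "X \<oplus>\<^bsub>?R\<^esub> Y \<in> carrier ?R"
        by (rule add_closed[OF XY])
      show "\<exists>Y\<in>carrier ?R. Y \<oplus>\<^bsub>?R\<^esub> X = \<zero>\<^bsub>?R\<^esub>"
        by (rule neg[OF XY(1)])
    qed (simp add: zero const)
    show "Group.comm_monoid ?R"
    proof (rule comm_monoidI)
      fix X Y Z assume XYZ: "X \<in> carrier ?R" "Y \<in> carrier ?R" "Z \<in> carrier ?R"
      obtain f g h where "X = germ s V f" "Y = germ s V g" "Z = germ s V h"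
        using XYZ[THEN germE] by blast
      then show "X \<otimes>\<^bsub>?R\<^esub> Y \<otimes>\<^bsub>?R\<^esub> Z = X \<otimes>\<^bsub>?R\<^esub> (Y \<otimes>\<^bsub>?R\<^esub> Z)"
        by (simp add: mult mult.assoc)
    next
      fix X Y assume XY: "X \<in> carrier ?R" "Y \<in> carrier ?R"
      obtain f g where fg: "X = germ s V f" "Y = germ s V g"
        using XY[THEN germE] by blast
      show "X \<otimes>\<^bsub>?R\<^esub> Y = Y \<otimes>\<^bsub>?R\<^esub> X"
        by (simp add: fg mult mult.commute)
      show "\<one>\<^bsub>?R\<^esub> \<otimes>\<^bsub>?R\<^esub> X = X"
        by (simp add: fg mult one)
      show "X \<otimes>\<^bsub>?R\<^esub> Y \<in> carrier ?R"
        by (rule mult_closed[OF XY])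
    qed (simp add: one const)
  next
    fix X Y Z assume XYZ: "X \<in> carrier ?R" "Y \<in> carrier ?R" "Z \<in> carrier ?R"
    obtain f g h where "X = germ s V f" "Y = germ s V g" "Z = germ s V h"
      using XYZ[THEN germE] by blast
    then show "(X \<oplus>\<^bsub>?R\<^esub> Y) \<otimes>\<^bsub>?R\<^esub> Z = X \<otimes>\<^bsub>?R\<^esub> Z \<oplus>\<^bsub>?R\<^esub> Y \<otimes>\<^bsub>?R\<^esub> Z"
      by (simp add: mult add distrib_right)
  qed
  show ?thesis
  proof (rule R.cring_fieldI2)
    show "\<zero>\<^bsub>?R\<^esub> \<noteq> \<one>\<^bsub>?R\<^esub>"
      unfolding zero one eq generically_def by auto
  next
    fix X assume X: "X \<in> carrier ?R" "X \<noteq> \<zero>\<^bsub>?R\<^esub>"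
    obtain p q v where pq: "X = germ s V (\<lambda>v. p v / q v)" "p \<in> poly_fun s V" "q \<in> poly_fun s V"
      "v \<in> V" "q v \<noteq> 0"
      using rep[OF X(1)] by blast
    obtain w where w: "w \<in> V" "p w \<noteq> 0"
      using X(2) all[of "\<lambda>v. p v / q v = 0"] unfolding pq(1) zero eq by auto
    show "\<exists>Y\<in>carrier ?R. X \<otimes>\<^bsub>?R\<^esub> Y = \<one>\<^bsub>?R\<^esub>"
    proof (rule bexI)
      show "germ s V (\<lambda>v. q v / p v) \<in> carrier ?R"
        by (rule carrier_rat_fieldI[OF assms pq(3,2) w]) (rule all, simp)
      show "X \<otimes>\<^bsub>?R\<^esub> germ s V (\<lambda>v. q v / p v) = \<one>\<^bsub>?R\<^esub>"
        unfolding pq(1) mult one eq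
        by (rule generically_mono[OF generically_conj[OF assms nz[OF pq(3-5)] nz[OF pq(2) w]]]) auto
    qed
  qed
qed


section \<open>Rational invariants of symbols\<close>

abbreviation symbol_germ where
  "symbol_germ sE sT sL L k \<equiv> germ (symbol_scale sL) (symbols sE sT sL L k)"

abbreviation symbol_rat_field where
  "symbol_rat_field sE sT sL L k \<equiv> rat_field (symbol_scale sL) (symbols sE sT sL L k)"

text \<open>
  The elements of \<open>GL(E)/\<int>\<^sub>2\<close> are the cosets \<open>{A, -A}\<close>, which act through their
  representatives.
\<close>

definition invariant_field ::
  "(complex \<Rightarrow> 'e \<Rightarrow> 'e) \<Rightarrow> (complex \<Rightarrow> 't \<Rightarrow> 't) \<Rightarrow> (complex \<Rightarrow> 'l \<Rightarrow> 'l) \<Rightarrow> 'l set \<Rightarrow> nat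
    \<Rightarrow> ((('t::ab_group_add list \<Rightarrow> complex) \<Rightarrow> 'e::ab_group_add \<Rightarrow> 'e \<Rightarrow> 'l::ab_group_add)
        \<Rightarrow> complex) set set"
  where
  "invariant_field sE sT sL L k =
    {X \<in> carrier (symbol_rat_field sE sT sL L k).
      \<forall>C \<in> carrier (GL sE Mod Z2). \<forall>A\<in>C. \<forall>f\<in>X. (\<lambda>\<sigma>. f (symbol_act A \<sigma>)) \<in> X}"

definition op_S :: "(complex \<Rightarrow> 'l \<Rightarrow> 'l) \<Rightarrow> ('e \<Rightarrow> 'e \<Rightarrow> 'l::ab_group_add) \<Rightarrow> 'e \<Rightarrow> 'e"
  where "op_S sL b = form_quotient (form_sym sL b) (form_skew sL b)"

definition procesi_op ::
  "(complex \<Rightarrow> 'l \<Rightarrow> 'l) \<Rightarrow> (nat \<Rightarrow> 'q) \<Rightarrow> ('q \<Rightarrow> 'e \<Rightarrow> 'e \<Rightarrow> 'l::ab_group_add) \<Rightarrow> nat \<Rightarrow> 'e \<Rightarrow> 'e"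
  where
  "procesi_op sL q \<sigma> i =
    (if i = 1 then op_S sL (\<sigma> (q 1))
     else form_quotient (form_sym sL (\<sigma> (q 1))) (\<sigma> (q i)))"

text \<open>
  A letter \<open>(i, d)\<close> stands for \<open>\<A>\<^sub>i\<close> if \<open>d\<close> is false and for its dual \<open>(\<A>\<^sub>i)\<^sub>g\<close> if \<open>d\<close> is true.
\<close>

definition procesi_letter ::
  "(complex \<Rightarrow> 'l \<Rightarrow> 'l) \<Rightarrow> (nat \<Rightarrow> 'q) \<Rightarrow> ('q \<Rightarrow> 'e \<Rightarrow> 'e \<Rightarrow> 'l::ab_group_add) \<Rightarrow> nat \<times> bool \<Rightarrow> 'e \<Rightarrow> 'e"
  where
  "procesi_letter sL q \<sigma> = (\<lambda>(i, d).
    if d then form_dual (form_sym sL (\<sigma> (q 1))) (procesi_op sL q \<sigma> i)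
    else procesi_op sL q \<sigma> i)"

definition procesi_invariant ::
  "(complex \<Rightarrow> 'e \<Rightarrow> 'e) \<Rightarrow> 'e set \<Rightarrow> (complex \<Rightarrow> 'l \<Rightarrow> 'l) \<Rightarrow> (nat \<Rightarrow> 'q) \<Rightarrow> (nat \<times> bool) list
    \<Rightarrow> ('q \<Rightarrow> 'e::ab_group_add \<Rightarrow> 'e \<Rightarrow> 'l::ab_group_add) \<Rightarrow> complex"
  where
  "procesi_invariant sE BE sL q I \<sigma> =
    op_trace sE BE (foldr (\<circ>) (map (procesi_letter sL q \<sigma>) I) id)"

definition procesi_words :: "nat \<Rightarrow> nat \<Rightarrow> (nat \<times> bool) list set"
  where "procesi_words N m = {I. length I \<le> 2 ^ m - 1 \<and> fst ` set I \<subseteq> {1..N}}"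

text \<open>
  The subfield of \<open>\<complex>(V)\<close>, \<open>V\<close> the space of symbols, generated over \<open>\<complex>\<close> by the Procesi invariants.
  The set where \<open>(\<sigma>\<^sub>q\<^sub>1)\<^sub>s\<close> fails to be invertible does not influence their germs.
\<close>

definition procesi_field ::
  "(complex \<Rightarrow> 'e \<Rightarrow> 'e) \<Rightarrow> 'e set \<Rightarrow> (complex \<Rightarrow> 't \<Rightarrow> 't) \<Rightarrow> (complex \<Rightarrow> 'l \<Rightarrow> 'l) \<Rightarrow> 'l set \<Rightarrow> nat
    \<Rightarrow> nat \<Rightarrow> (nat \<Rightarrow> 't list \<Rightarrow> complex)
    \<Rightarrow> ((('t::ab_group_add list \<Rightarrow> complex) \<Rightarrow> 'e::ab_group_add \<Rightarrow> 'e \<Rightarrow> 'l::ab_group_add)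
        \<Rightarrow> complex) set set"
  where
  "procesi_field sE BE sT sL L k N q =
    generate_field (symbol_rat_field sE sT sL L k)
      (range (\<lambda>c. symbol_germ sE sT sL L k (\<lambda>_. c)) \<union>
       (\<lambda>I. symbol_germ sE sT sL L k (procesi_invariant sE BE sL q I)) `
         procesi_words N (vector_space.dim sE UNIV))"

end

theory Submission
  imports Defs "Jordan_Normal_Form.Schur_Decomposition"
begin

text \<open>
  In a basis of \<open>E\<close> a symbol is a tuple of matrices \<open>B\<^sub>1, \<dots>, B\<^sub>N\<close>, on which the group acts by congruence,
  \<open>g\<close> is the symmetric part of \<open>B\<^sub>1\<close> and \<open>X = \<A>\<^sub>1\<close> up to sign. An invariant fraction takes the same value at
  a tuple and at its pullback along any frame, so it suffices to find a frame in which the entries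
  of all forms are expressed by traces of short words.

  For \<open>N \<ge> 2\<close> the operator \<open>S = (\<A>\<^sub>2 + (\<A>\<^sub>2)\<^sub>g) / 2\<close> is \<open>g\<close>-self-adjoint and generically has simple
  eigenvalues. For an eigenvector \<open>e\<close> with eigenvalue \<open>\<lambda>\<close> and \<open>g(e, e) = 1\<close>, use the frame \<open>e, X e, X\<^sup>2 e, \<dots>\<close>.
  The projector onto \<open>e\<close> is a polynomial in \<open>S\<close> whose coefficients are polynomials in \<open>\<lambda>\<close> over the field
  generated by the traces \<open>tr S\<^sup>i\<close>, so the entries of the forms are polynomials in \<open>\<lambda>\<close> over the Procesi
  field. Hence the invariant \<open>F\<close> satisfies \<open>F b(\<lambda>) = a(\<lambda>)\<close> for all eigenvalues \<open>\<lambda>\<close>; multiplying by \<open>\<lambda>\<^sup>l\<close> and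
  summing over the eigenvalues gives a linear equation for \<open>F\<close> over the Procesi field. The words that
  occur have length at most \<open>3 dim E - 2\<close>, which is bounded by \<open>2^dim E - 1\<close> unless \<open>dim E = 2\<close>, where a trace
  identity for \<open>2 \<times> 2\<close> matrices applies.

  For \<open>N = 1\<close> there is a vector \<open>e\<close> with \<open>g(e, X\<^sup>l e) = (-1)\<^sup>l tr X\<^sup>l\<close> for all \<open>l\<close>, and the same frame has entries
  in the Procesi field.
\<close>

section \<open>Traces and Gram matrices of powers\<close>

text \<open>An eigenvalue of \<open>S\<close> is algebraic, not rational, over the Procesi field, so
  a frame depending on it yields the invariant only over an extension; what descends is the sum over
  all eigenvalues. The factor lambda^l is there because the plain sum of the b(lambda) may vanish:
  if b is nonzero at one eigenvalue, the invertible Vandermonde matrix makes some weighted sum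
  nonzero. A second obstacle is that numerator and denominator of an invariant fraction need not be
  coprime, so the denominator may vanish on all normal forms. Therefore a base point
  \<open>u\<close> is fixed and frames are multiplied by the inverse of one frame at
  \<open>u\<close>; there the denominator keeps its nonzero value. A single form admits no such
  \<open>S\<close> once dim E >= 2: the self-adjoint operators at hand are polynomials in X^2, and
  the eigenvalues of the skew operator X come in opposite pairs, so X^2 has double eigenvalues.
  Instead of an eigenvector, a vector is used on which the powers of X take known values. The other
  inclusion, that the traces generate only invariants, holds because congruence of the forms
  conjugates all letters.\<close>

lemma mult_mat_entry:
  assumes "A \<in> carrier_mat n k" "B \<in> carrier_mat k m" "i < n" "j < m"
  shows "(A * B) $$ (i, j) = (\<Sum>l<k. A $$ (i, l) * B $$ (l, j))"
  using assms by (auto simp: scalar_prod_def atLeast0LessThan)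

lemmas square_mult = assoc_mult_mat[of _ n n _ n _ n] mult_carrier_mat[of _ n n _ n] for n

text \<open>The adjugate formula makes each entry a signed minor times \<open>1 / det A\<close>, so
  the inverse stays in any ring of functions that contains the entries and the inverse of the
  determinant.\<close>

definition mat_inv :: "'a::field mat \<Rightarrow> 'a mat"
  where "mat_inv A = (1 / det A) \<cdot>\<^sub>m adj_mat A"

lemma mat_inv:
  assumes "A \<in> carrier_mat n n"
  shows "mat_inv A \<in> carrier_mat n n"
    and "det A \<noteq> 0 \<Longrightarrow> A * mat_inv A = 1\<^sub>m n"
    and "det A \<noteq> 0 \<Longrightarrow> mat_inv A * A = 1\<^sub>m n"
proof -
  note adj = adj_mat[OF assms]
  show "mat_inv A \<in> carrier_mat n n"
    using adj(1) by (simp add: mat_inv_def)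
  assume "det A \<noteq> 0"
  then have "1 / det A \<cdot>\<^sub>m (det A \<cdot>\<^sub>m 1\<^sub>m n) = 1\<^sub>m n"
    by (intro eq_matI) auto
  then show "A * mat_inv A = 1\<^sub>m n" "mat_inv A * A = 1\<^sub>m n"
    using adj assms by (simp_all add: mat_inv_def mult_smult_distrib[OF assms adj(1)] mult_smult_assoc_mat[OF adj(1) assms])
qed

lemma det_nonzero_if_inverse:
  fixes A :: "'a::field mat"
  assumes "A \<in> carrier_mat n n" "B \<in> carrier_mat n n" "A * B = 1\<^sub>m n"
  shows "det A \<noteq> 0" "det B \<noteq> 0"
  using det_mult[OF assms(1,2)] assms(3) by auto

lemma mat_mult_right_cancel:
  fixes A :: "'a::field mat"
  assumes "A \<in> carrier_mat k n" "B \<in> carrier_mat k n" "C \<in> carrier_mat n n" "det C \<noteq> 0"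
    and "A * C = B * C"
  shows "A = B"
proof -
  note inv = mat_inv[OF assms(3)]
  have "D * C * mat_inv C = D" if "D \<in> carrier_mat k n" for D
    using that assms(3,4) inv by (simp add: assoc_mult_mat[of _ k n _ n _ n])
  then show ?thesis
    using assms(1,2,5) by metis
qed

lemma mat_inv_eqI:
  fixes A :: "'a::field mat"
  assumes "A \<in> carrier_mat n n" "B \<in> carrier_mat n n" "B * A = 1\<^sub>m n"
  shows "mat_inv A = B"
  using det_nonzero_if_inverse[OF assms(2,1,3)] mat_inv[OF assms(1)] assms
  by (intro mat_mult_right_cancel[of "mat_inv A" n n B A]) auto

definition mtr :: "'a::comm_ring_1 mat \<Rightarrow> 'a"
  where "mtr A = (\<Sum>i<dim_row A. A $$ (i, i))"

lemma mtr_mult: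
  assumes "A \<in> carrier_mat n k" "B \<in> carrier_mat k n"
  shows "mtr (A * B) = (\<Sum>i<n. \<Sum>j<k. A $$ (i, j) * B $$ (j, i))"
  using assms by (auto simp: mtr_def scalar_prod_def atLeast0LessThan intro!: sum.cong)

lemma mtr_comm:
  assumes "A \<in> carrier_mat n k" "B \<in> carrier_mat k n"
  shows "mtr (A * B) = mtr (B * A)"
  unfolding mtr_mult[OF assms] mtr_mult[OF assms(2,1)]
  by (subst sum.swap) (simp add: mult.commute)

lemma mtr_add:
  assumes "A \<in> carrier_mat n n" "B \<in> carrier_mat n n"
  shows "mtr (A + B) = mtr A + mtr B"
  using assms by (auto simp: mtr_def sum.distrib)

lemma mtr_smult: "A \<in> carrier_mat n n \<Longrightarrow> mtr (c \<cdot>\<^sub>m A) = c * mtr A"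
  by (auto simp: mtr_def sum_distrib_left)

lemma mtr_conj:
  fixes A :: "'a::comm_ring_1 mat"
  assumes "A \<in> carrier_mat n n" "P \<in> carrier_mat n n" "Q \<in> carrier_mat n n" "Q * P = 1\<^sub>m n"
  shows "mtr (P * A * Q) = mtr A"
proof -
  have "mtr (P * A * Q) = mtr (Q * (P * A))"
    using assms by (intro mtr_comm[of _ n n]) auto
  also have "Q * (P * A) = A"
    using assms by (simp flip: assoc_mult_mat[of Q n n P n A n])
  finally show ?thesis .
qed

definition dmat :: "nat \<Rightarrow> (nat \<Rightarrow> 'a::zero) \<Rightarrow> 'a mat"
  where "dmat n l = mat n n (\<lambda>(i, j). if i = j then l i else 0)"

lemma dmat_carrier [simp]: "dmat n l \<in> carrier_mat n n"
  by (simp add: dmat_def)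

lemma mult_dmat_entry:
  fixes A :: "'a::comm_ring_1 mat"
  assumes "A \<in> carrier_mat k n" "i < k" "j < n"
  shows "(A * dmat n l) $$ (i, j) = A $$ (i, j) * l j"
proof -
  have "(A * dmat n l) $$ (i, j) = (\<Sum>r<n. A $$ (i, r) * (if r = j then l r else 0))"
    using assms by (subst mult_mat_entry[of _ k n _ n]) (auto simp: dmat_def)
  also have "\<dots> = (\<Sum>r<n. if r = j then A $$ (i, r) * l r else 0)"
    by (intro sum.cong) auto
  also have "\<dots> = A $$ (i, j) * l j"
    using assms by simp
  finally show ?thesis .
qed

lemma dmat_mult: "dmat n l * dmat n k = dmat n (\<lambda>i. l i * k i :: 'a::comm_ring_1)"
proof (rule eq_matI)
  fix i j assume "i < dim_row (dmat n (\<lambda>i. l i * k i))" "j < dim_col (dmat n (\<lambda>i. l i * k i))"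
  then have ij: "i < n" "j < n" by (auto simp: dmat_def)
  show "(dmat n l * dmat n k) $$ (i, j) = dmat n (\<lambda>i. l i * k i) $$ (i, j)"
    unfolding mult_dmat_entry[OF dmat_carrier ij] using ij by (simp add: dmat_def)
qed (auto simp: dmat_def)

lemma dmat_power: "dmat n l ^\<^sub>m k = dmat n (\<lambda>i. l i ^ k :: 'a::comm_ring_1)"
proof (induction k)
  case 0
  show ?case by (intro eq_matI) (auto simp: dmat_def)
next
  case (Suc k)
  then show ?case by (simp add: dmat_mult mult.commute)
qed

lemma mtr_dmat: "mtr (dmat n l) = (\<Sum>i<n. l i)"
  by (simp add: mtr_def dmat_def)

lemma pow_mat_intertwine:
  fixes A :: "'a::comm_ring_1 mat"
  assumes "A \<in> carrier_mat n n" "D \<in> carrier_mat n n" "P \<in> carrier_mat n n" "A * P = P * D"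
  shows "A ^\<^sub>m k * P = P * D ^\<^sub>m k"
proof (induction k)
  case 0
  show ?case using assms by simp
next
  case (Suc k)
  have c: "A ^\<^sub>m k \<in> carrier_mat n n" "D ^\<^sub>m k \<in> carrier_mat n n"
    using assms by auto
  have "A ^\<^sub>m Suc k * P = A ^\<^sub>m k * (P * D)"
    using assms c by (simp add: assoc_mult_mat[of _ n n _ n _ n])
  also have "\<dots> = (P * D ^\<^sub>m k) * D"
    using assms c Suc by (simp flip: assoc_mult_mat[of _ n n _ n _ n])
  also have "\<dots> = P * D ^\<^sub>m Suc k"
    using assms c by (simp add: assoc_mult_mat[of _ n n _ n _ n])
  finally show ?case .
qed

lemma pow_mat_plus:
  fixes A :: "'a::comm_ring_1 mat"
  assumes "A \<in> carrier_mat n n"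
  shows "A ^\<^sub>m (j + k) = A ^\<^sub>m j * A ^\<^sub>m k"
proof (induction k)
  case 0
  show ?case using right_mult_one_mat[OF pow_carrier_mat[OF assms]] assms by simp
next
  case (Suc k)
  then show ?case
    using assms by (simp add: assoc_mult_mat[of _ n n _ n _ n] pow_carrier_mat[of _ n])
qed

text \<open>The Hankel matrix of the power sums of the eigenvalues. Its determinant is the
  discriminant of the characteristic polynomial, so a simple spectrum is expressed by the traces of
  S^k with k at most 2n - 2, without mentioning eigenvalues.\<close>

definition tgram :: "nat \<Rightarrow> 'a::comm_ring_1 mat \<Rightarrow> 'a mat"
  where "tgram n S = mat n n (\<lambda>(i, j). mtr (S ^\<^sub>m (i + j)))"

definition vmat :: "nat \<Rightarrow> (nat \<Rightarrow> 'a::comm_ring_1) \<Rightarrow> 'a mat"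
  where "vmat n l = mat n n (\<lambda>(i, k). l i ^ k)"

lemma tgram_carrier [simp]: "tgram n S \<in> carrier_mat n n"
  by (simp add: tgram_def)

lemma vmat_carrier [simp]: "vmat n l \<in> carrier_mat n n"
  by (simp add: vmat_def)

lemma tgram_vmat:
  assumes "\<And>k. mtr (S ^\<^sub>m k) = (\<Sum>i<n. l i ^ k)"
  shows "tgram n S = (vmat n l)\<^sup>T * vmat n l"
  by (intro eq_matI)
    (auto simp: tgram_def vmat_def assms scalar_prod_def atLeast0LessThan power_add)

text \<open>A kernel vector would hold the coefficients of a nonzero polynomial of degree below
  \<open>n\<close> with the \<open>n\<close> distinct roots \<open>x i\<close>.\<close>

lemma det_vmat_nonzero:
  fixes x :: "nat \<Rightarrow> 'a::field"
  assumes "inj_on x {..<n}"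
  shows "det (vmat n x) \<noteq> 0"
proof
  assume "det (vmat n x) = 0"
  then obtain c where c: "c \<in> carrier_vec n" "c \<noteq> 0\<^sub>v n" "vmat n x *\<^sub>v c = 0\<^sub>v n"
    using det_0_iff_vec_prod_zero_field[of "vmat n x" n] by auto
  obtain k where k: "k < n" "c $ k \<noteq> 0" using c(1,2) by (metis eq_vecI carrier_vecD index_zero_vec)
  define P where "P = (\<Sum>k<n. Polynomial.monom (c $ k) k)"
  have root: "poly P (x i) = 0" if "i < n" for i
  proof -
    have "poly P (x i) = (vmat n x *\<^sub>v c) $ i"
      using that c(1) by (auto simp: P_def poly_sum poly_monom vmat_def scalar_prod_def atLeast0LessThan mult.commute
          intro!: sum.cong)
    then show ?thesis using c(3) that by simp
  qed
  have co: "Polynomial.coeff P k = c $ k"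
    using k by (simp add: P_def coeff_sum if_distrib[of "\<lambda>f. f _"] cong: if_cong)
  then have P0: "P \<noteq> 0" using k by auto
  have "Polynomial.degree P \<le> n - 1"
    unfolding P_def by (intro degree_sum_le) (auto intro: order_trans[OF degree_monom_le])
  then have "Polynomial.degree P < n" using k by simp
  moreover have "n = card (x ` {..<n})" by (simp add: card_image[OF assms])
  moreover have "card (x ` {..<n}) \<le> card {z. poly P z = 0}"
    using root poly_roots_finite[OF P0] by (intro card_mono) auto
  ultimately show False using card_poly_roots_bound[OF P0] by linarith
qed

lemma det_tgram_dmat:
  fixes x :: "nat \<Rightarrow> 'a::field"
  assumes "inj_on x {..<n}"
  shows "det (tgram n (dmat n x)) \<noteq> 0"
proof -
  have "tgram n (dmat n x) = (vmat n x)\<^sup>T * vmat n x"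
    by (rule tgram_vmat) (simp add: dmat_power mtr_dmat)
  then show ?thesis
    using det_vmat_nonzero[OF assms] by (simp add: det_mult[of _ n] det_transpose[of _ n])
qed

lemma upper_triangular_mult_diag:
  fixes A :: "'a::comm_ring_1 mat"
  assumes "A \<in> carrier_mat n n" "B \<in> carrier_mat n n" "upper_triangular A" "upper_triangular B"
  shows "upper_triangular (A * B)" and "i < n \<Longrightarrow> (A * B) $$ (i, i) = A $$ (i, i) * B $$ (i, i)"
proof -
  have z: "A $$ (i, j) = 0" "B $$ (i, j) = 0" if "j < i" "i < n" for i j
    using that assms by (auto simp: upper_triangular_def)
  show "upper_triangular (A * B)"
  proof (rule upper_triangularI)
    fix i j assume ij: "j < i" "i < dim_row (A * B)"
    then have "i < n" "j < n" using assms by auto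
    moreover have "A $$ (i, l) * B $$ (l, j) = 0" if "l < n" for l
      using z(1)[of l i] z(2)[of j l] ij that \<open>i < n\<close> by (cases "l < i") auto
    ultimately show "(A * B) $$ (i, j) = 0"
      using assms by (subst mult_mat_entry[of _ n n _ n]) (auto intro: sum.neutral)
  qed
  assume i: "i < n"
  have "(A * B) $$ (i, i) = (\<Sum>l<n. A $$ (i, l) * B $$ (l, i))"
    using i assms by (intro mult_mat_entry[of _ n n _ n]) auto
  also have "\<dots> = (\<Sum>l<n. if l = i then A $$ (i, l) * B $$ (l, i) else 0)"
  proof (rule sum.cong[OF refl])
    fix l assume "l \<in> {..<n}"
    then show "A $$ (i, l) * B $$ (l, i) = (if l = i then A $$ (i, l) * B $$ (l, i) else 0)"
      using z(1)[of l i] z(2)[of i l] i by (cases l i rule: linorder_cases) auto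
  qed
  finally show "(A * B) $$ (i, i) = A $$ (i, i) * B $$ (i, i)" using i by simp
qed

lemma upper_triangular_power_diag:
  fixes A :: "'a::comm_ring_1 mat"
  assumes "A \<in> carrier_mat n n" "upper_triangular A"
  shows "upper_triangular (A ^\<^sub>m k) \<and> (\<forall>i<n. (A ^\<^sub>m k) $$ (i, i) = A $$ (i, i) ^ k)"
proof (induction k)
  case 0
  show ?case using assms by auto
next
  case (Suc k)
  then show ?case
    using upper_triangular_mult_diag[OF pow_carrier_mat[OF assms(1), of k] assms(1) _ assms(2)]
    by (simp add: mult.commute)
qed

text \<open>With \<open>V\<close> the Vandermonde matrix of the eigenvalues, the trace Gram matrix is \<open>V\<^sup>T V\<close>.\<close>

lemma diagonalizable_if_tgram:
  fixes S :: "complex mat"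
  assumes S: "S \<in> carrier_mat n n" and tg: "det (tgram n S) \<noteq> 0"
  obtains P l where "P \<in> carrier_mat n n" "det P \<noteq> 0" "S * P = P * dmat n l" "inj_on l {..<n}"
    "det (vmat n l) \<noteq> 0"
proof -
  obtain es where es: "char_poly S = (\<Prod>a\<leftarrow>es. [:- a, 1:])"
    using char_poly_factorized[OF S] by blast
  obtain B where B: "B \<in> carrier_mat n n" "upper_triangular B" "similar_mat S B"
    using schur_decomposition_exists[OF S es] by blast
  define l where "l = (\<lambda>i. B $$ (i, i))"
  obtain P Q where PQ: "similar_mat_wit S B P Q"
    using B(3) by (auto simp: similar_mat_def)
  note PQD = similar_mat_witD2[OF S PQ]
  \<comment> \<open>A triangular form suffices here: the power traces are power sums of its
    diagonal, so \<open>tgram\<close> can be factored before diagonalizability is known.\<close>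
  have tr: "mtr (S ^\<^sub>m k) = (\<Sum>i<n. l i ^ k)" for k
  proof -
    have "S ^\<^sub>m k = P * B ^\<^sub>m k * Q"
      using similar_mat_wit_pow[OF PQ, of k] by (simp add: similar_mat_wit_def Let_def)
    then have "mtr (S ^\<^sub>m k) = mtr (B ^\<^sub>m k)"
      using PQD by (simp add: mtr_conj[of _ n])
    also have "\<dots> = (\<Sum>i<n. l i ^ k)"
      using upper_triangular_power_diag[OF B(1,2), of k] B(1) by (simp add: mtr_def l_def)
    finally show ?thesis .
  qed
  let ?V = "vmat n l"
  have "det (tgram n S) = det ?V * det ?V"
    unfolding tgram_vmat[OF tr] by (simp add: det_mult[of _ n] det_transpose[of _ n])
  then have V: "det ?V \<noteq> 0" using tg by auto
  have inj: "inj_on l {..<n}"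
  proof (rule inj_onI, rule ccontr)
    fix i j assume ij: "i \<in> {..<n}" "j \<in> {..<n}" "l i = l j" "i \<noteq> j"
    then have "row ?V i = row ?V j" by (intro eq_vecI) (auto simp: vmat_def)
    then show False using V det_identical_rows[OF vmat_carrier ij(4)] ij by auto
  qed
  have "\<exists>v. v \<in> carrier_vec n \<and> v \<noteq> 0\<^sub>v n \<and> S *\<^sub>v v = l i \<cdot>\<^sub>v v" if i: "i < n" for i
  proof -
    have "poly (char_poly S) (l i) = 0"
      unfolding char_poly_similar[OF B(3)] char_poly_upper_triangular[OF B(1,2)]
      using i B(1) by (auto simp: poly_prod_list prod_list_zero_iff diag_mat_def l_def)
    then have "eigenvalue S (l i)" using eigenvalue_root_char_poly[OF S] by simp
    then show ?thesis using S by (auto simp: eigenvalue_def eigenvector_def)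
  qed
  then obtain e where e: "\<And>i. i < n \<Longrightarrow> e i \<in> carrier_vec n \<and> e i \<noteq> 0\<^sub>v n \<and> S *\<^sub>v e i = l i \<cdot>\<^sub>v e i"
    by metis
  define R where "R = mat n n (\<lambda>(r, c). e c $ r)"
  have R: "R \<in> carrier_mat n n" by (simp add: R_def)
  have colR: "col R c = e c" if "c < n" for c
    using e[OF that] that by (auto simp: R_def)
  have SR: "S * R = R * dmat n l"
  proof (rule eq_matI)
    fix i j assume "i < dim_row (R * dmat n l)" "j < dim_col (R * dmat n l)"
    then have ij: "i < n" "j < n" using R by (auto simp: dmat_def)
    have "(S * R) $$ (i, j) = (S *\<^sub>v e j) $ i"
      using ij S R colR by auto
    also have "\<dots> = R $$ (i, j) * l j"
      using e[OF ij(2)] ij by (auto simp: R_def mult.commute)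
    finally show "(S * R) $$ (i, j) = (R * dmat n l) $$ (i, j)"
      using mult_dmat_entry[OF R ij] by simp
  qed (use S R in \<open>auto simp: dmat_def\<close>)
  have "det R \<noteq> 0"
  proof
    assume "det R = 0"
    then obtain c where c: "c \<in> carrier_vec n" "c \<noteq> 0\<^sub>v n" "R *\<^sub>v c = 0\<^sub>v n"
      using det_0_iff_vec_prod_zero_field[OF R] by blast
    \<comment> \<open>\<open>D\<close> has the columns c_i e_i. Applying S^k to the relation sum c_i
      e_i = 0 gives sum l_i^k c_i e_i = 0 for all k, that is, \<open>D * ?V = 0\<close>; since
      \<open>?V\<close> is invertible, every c_i e_i vanishes, although some c_i is nonzero.\<close>
    define D where "D = R * dmat n (\<lambda>i. c $ i)"
    have D: "D \<in> carrier_mat n n" by (simp add: D_def R mult_carrier_mat[OF R dmat_carrier])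
    have "(D * ?V) $$ (r, k) = 0" if rk: "r < n" "k < n" for r k
    proof -
      have "0\<^sub>v n = S ^\<^sub>m k *\<^sub>v (R *\<^sub>v c)"
        unfolding c(3) using S pow_carrier_mat[OF S, of k] by (intro eq_vecI) (auto simp: scalar_prod_def)
      also have "\<dots> = (S ^\<^sub>m k * R) *\<^sub>v c"
        using S R c by (simp add: assoc_mult_mat_vec[of _ n n _ n])
      also have "\<dots> = (R * dmat n (\<lambda>i. l i ^ k)) *\<^sub>v c"
        by (simp add: pow_mat_intertwine[OF S dmat_carrier R SR] dmat_power)
      finally have "0 = ((R * dmat n (\<lambda>i. l i ^ k)) *\<^sub>v c) $ r" using rk by (metis index_zero_vec(1))
      also have "\<dots> = (\<Sum>i<n. (R * dmat n (\<lambda>i. l i ^ k)) $$ (r, i) * c $ i)"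
        using rk R c by (auto simp: scalar_prod_def atLeast0LessThan dmat_def intro!: sum.cong)
      also have "\<dots> = (\<Sum>i<n. D $$ (r, i) * ?V $$ (i, k))"
        using rk by (auto simp: D_def mult_dmat_entry[OF R] vmat_def intro!: sum.cong)
      also have "\<dots> = (D * ?V) $$ (r, k)"
        by (rule mult_mat_entry[OF D vmat_carrier rk, symmetric])
      finally show ?thesis by simp
    qed
    then have "D * ?V = 0\<^sub>m n n * ?V"
      using D by (intro eq_matI) (auto simp: vmat_def)
    then have "D = 0\<^sub>m n n"
      by (rule mat_mult_right_cancel[OF D zero_carrier_mat vmat_carrier V])
    moreover obtain i where i: "i < n" "c $ i \<noteq> 0"
      using c by (metis eq_vecI carrier_vecD index_zero_vec)
    ultimately have "R $$ (r, i) = 0" if "r < n" for r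
      using mult_dmat_entry[OF R that i(1), of "\<lambda>i. c $ i"] that i by (simp add: D_def)
    then have "e i = 0\<^sub>v n"
      using e[OF i(1)] i(1) by (intro eq_vecI) (auto simp: R_def)
    then show False using e[OF i(1)] by simp
  qed
  then show thesis using that[OF R _ SR inj V] by blast
qed

section \<open>Frames adapted to self-adjoint and skew operators\<close>

lemma congruence_entry:
  fixes B :: "'a::comm_ring_1 mat"
  assumes "M \<in> carrier_mat n n" "B \<in> carrier_mat n n" "j < n" "k < n"
  shows "(M\<^sup>T * B * M) $$ (j, k) = col M j \<bullet> (B *\<^sub>v col M k)"
proof -
  have "(M\<^sup>T * B * M) $$ (j, k) = (M\<^sup>T * (B * M)) $$ (j, k)"
    using assms by (simp add: assoc_mult_mat[of _ n n _ n _ n])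
  also have "\<dots> = col M j \<bullet> col (B * M) k"
    using assms by (subst index_mult_mat) auto
  finally show ?thesis using assms by (simp only: col_mult2[of _ n n])
qed

lemma scalar_prod_smult_mat:
  fixes A :: "'a::comm_ring_1 mat"
  assumes "A \<in> carrier_mat n n" "e \<in> carrier_vec n"
  shows "e \<bullet> ((c \<cdot>\<^sub>m A) *\<^sub>v e) = c * (e \<bullet> (A *\<^sub>v e))"
proof -
  have "(c \<cdot>\<^sub>m A) *\<^sub>v e = c \<cdot>\<^sub>v (A *\<^sub>v e)"
    using assms by (intro eq_vecI) auto
  then show ?thesis using assms by simp
qed

lemma scalar_prod_transport:
  fixes A :: "'a::comm_ring_1 mat"
  assumes "A \<in> carrier_mat n n" "B \<in> carrier_mat n n" "C \<in> carrier_mat n n" "e \<in> carrier_vec n"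
  shows "(A *\<^sub>v e) \<bullet> (B *\<^sub>v (C *\<^sub>v e)) = e \<bullet> ((A\<^sup>T * B * C) *\<^sub>v e)"
proof -
  have "(A *\<^sub>v e) \<bullet> (B *\<^sub>v (C *\<^sub>v e)) = e \<bullet> (A\<^sup>T *\<^sub>v (B *\<^sub>v (C *\<^sub>v e)))"
    using transpose_vec_mult_scalar[of "A\<^sup>T" n n "B *\<^sub>v (C *\<^sub>v e)" e] assms by simp
  also have "\<dots> = e \<bullet> ((A\<^sup>T * B * C) *\<^sub>v e)"
    using assms by (simp add: assoc_mult_mat_vec[of _ n n _ n])
  finally show ?thesis .
qed

lemma mat_inv_cancel:
  assumes "G \<in> carrier_mat n n" "det G \<noteq> 0" "Z \<in> carrier_mat n n"
  shows "G * (mat_inv G * Z) = Z" "mat_inv G * (G * Z) = Z"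
  using assms mat_inv[OF assms(1)]
  by (simp_all del: assoc_mult_mat flip: assoc_mult_mat[of _ n n _ n _ n])

lemma mat_inv_transpose_cancel:
  assumes "G \<in> carrier_mat n n" "det G \<noteq> 0" "Z \<in> carrier_mat n n"
  shows "G\<^sup>T * ((mat_inv G)\<^sup>T * Z) = Z" "(mat_inv G)\<^sup>T * (G\<^sup>T * Z) = Z"
proof -
  note inv = mat_inv[OF assms(1)]
  have "G\<^sup>T * (mat_inv G)\<^sup>T = (mat_inv G * G)\<^sup>T" "(mat_inv G)\<^sup>T * G\<^sup>T = (G * mat_inv G)\<^sup>T"
    using assms(1) inv(1) by (simp_all add: transpose_mult[of _ n n _ n])
  then show "G\<^sup>T * ((mat_inv G)\<^sup>T * Z) = Z" "(mat_inv G)\<^sup>T * (G\<^sup>T * Z) = Z"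
    using assms inv
    by (simp_all del: assoc_mult_mat flip: assoc_mult_mat[of _ n n _ n _ n])
qed

lemma transpose_symmetric_inv:
  fixes G :: "'a::field mat"
  assumes "G \<in> carrier_mat n n" "G\<^sup>T = G" "det G \<noteq> 0"
  shows "(mat_inv G)\<^sup>T = mat_inv G"
proof -
  note inv = mat_inv[OF assms(1)]
  have "(mat_inv G)\<^sup>T * G = (G * mat_inv G)\<^sup>T"
    using assms inv(1) by (simp add: transpose_mult[of _ n n _ n])
  then have "(mat_inv G)\<^sup>T * G = mat_inv G * G"
    using inv assms by simp
  then show ?thesis
    using mat_mult_right_cancel[of "(mat_inv G)\<^sup>T" n n "mat_inv G" G] inv assms by simp
qed

text \<open>\<open>X\<close> is skew-adjoint for the symmetric form \<open>G\<close>, since X^T G =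
  K^T = -G X; each factor moved across \<open>G\<close> costs a sign. This collects both powers of a
  frame entry on one side of the form.\<close>

lemma skew_power_transpose:
  fixes G :: "'a::field mat"
  assumes G: "G \<in> carrier_mat n n" "G\<^sup>T = G" "det G \<noteq> 0"
    and K: "K \<in> carrier_mat n n" "K\<^sup>T = - K"
  defines "X \<equiv> mat_inv G * K"
  shows "(X ^\<^sub>m j)\<^sup>T * G = (-1) ^ j \<cdot>\<^sub>m (G * X ^\<^sub>m j)"
proof -
  note inv = mat_inv[OF G(1)]
  have X: "X \<in> carrier_mat n n" using inv(1) K by (simp add: X_def)
  have XG: "X\<^sup>T * G = - K"
    using inv G K by (simp add: X_def transpose_mult[of _ n n _ n] transpose_symmetric_inv[OF G]
        square_mult[where n = n])
  have GX: "G * X = K"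
    using mat_inv_cancel(1)[OF G(1,3) K(1)] by (simp add: X_def)
  show ?thesis
  proof (induction j)
    case 0
    show ?case using X G by (intro eq_matI) auto
  next
    case (Suc j)
    have Xj: "X ^\<^sub>m j \<in> carrier_mat n n" using X by simp
    have comm: "X ^\<^sub>m j * X = X * X ^\<^sub>m j"
      by (rule pow_mat_intertwine[OF X X X refl])
    have "(X ^\<^sub>m Suc j)\<^sup>T * G = X\<^sup>T * ((X ^\<^sub>m j)\<^sup>T * G)"
      using X Xj G by (simp add: transpose_mult[of _ n n _ n] square_mult[where n = n])
    also have "\<dots> = (-1) ^ j \<cdot>\<^sub>m (X\<^sup>T * G * X ^\<^sub>m j)"
      using X Xj G by (simp add: Suc mult_smult_distrib[of _ n n _ n] square_mult[where n = n])
    also have "X\<^sup>T * G * X ^\<^sub>m j = - (G * X * X ^\<^sub>m j)"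
      unfolding XG GX using K(1) Xj by auto
    also have "G * X * X ^\<^sub>m j = G * X ^\<^sub>m Suc j"
      using X Xj G by (simp add: comm square_mult[where n = n])
    also have "(-1) ^ j \<cdot>\<^sub>m (- (G * X ^\<^sub>m Suc j)) = (-1) ^ Suc j \<cdot>\<^sub>m (G * X ^\<^sub>m Suc j)"
      by (intro eq_matI) auto
    finally show ?case .
  qed
qed

text \<open>The Krylov matrix of \<open>e\<close>. It is defined for every vector and is singular
  exactly when \<open>e\<close> is not cyclic for \<open>X\<close>.\<close>

definition frame :: "nat \<Rightarrow> 'a::comm_ring_1 mat \<Rightarrow> 'a vec \<Rightarrow> 'a mat"
  where "frame n X e = mat n n (\<lambda>(r, k). (X ^\<^sub>m k *\<^sub>v e) $ r)"

lemma frame_carrier [simp]: "frame n X e \<in> carrier_mat n n"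
  by (simp add: frame_def)

lemma col_frame: "X \<in> carrier_mat n n \<Longrightarrow> k < n \<Longrightarrow> col (frame n X e) k = X ^\<^sub>m k *\<^sub>v e"
  by (intro eq_vecI) (auto simp: frame_def)

text \<open>Every form in the frame is reduced to values g(e, W e) with W = X^j (G^-1 B) X^k. Hence
  it is enough to choose \<open>e\<close> so that these values are expressible by traces.\<close>

lemma frame_form_entry:
  fixes G :: "'a::field mat"
  assumes G: "G \<in> carrier_mat n n" "G\<^sup>T = G" "det G \<noteq> 0"
    and K: "K \<in> carrier_mat n n" "K\<^sup>T = - K"
    and B: "B \<in> carrier_mat n n" and e: "e \<in> carrier_vec n" and jk: "j < n" "k < n"
  defines "X \<equiv> mat_inv G * K"
  shows "((frame n X e)\<^sup>T * B * frame n X e) $$ (j, k) =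
    (-1) ^ j * (e \<bullet> ((G * (X ^\<^sub>m j * (mat_inv G * B) * X ^\<^sub>m k)) *\<^sub>v e))"
proof -
  note inv = mat_inv[OF G(1)]
  have X: "X \<in> carrier_mat n n" using inv(1) K by (simp add: X_def)
  have Xp: "X ^\<^sub>m i \<in> carrier_mat n n" for i using X by simp
  have "((frame n X e)\<^sup>T * B * frame n X e) $$ (j, k) = (X ^\<^sub>m j *\<^sub>v e) \<bullet> (B *\<^sub>v (X ^\<^sub>m k *\<^sub>v e))"
    using congruence_entry[OF frame_carrier B jk] col_frame[OF X] jk by simp
  also have "\<dots> = e \<bullet> (((X ^\<^sub>m j)\<^sup>T * B * X ^\<^sub>m k) *\<^sub>v e)"
    by (rule scalar_prod_transport[OF Xp B Xp e])
  also have "(X ^\<^sub>m j)\<^sup>T * B * X ^\<^sub>m k = ((X ^\<^sub>m j)\<^sup>T * G) * (mat_inv G * B) * X ^\<^sub>m k"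
    using Xp G B inv(1) mat_inv_cancel(1)[OF G(1,3)] by (simp add: square_mult[where n = n])
  also have "\<dots> = (-1) ^ j \<cdot>\<^sub>m (G * (X ^\<^sub>m j * (mat_inv G * B) * X ^\<^sub>m k))"
    unfolding X_def skew_power_transpose[OF G K]
    unfolding X_def[symmetric]
    using Xp G(1) B inv(1) by (simp add: square_mult[where n = n]
        mult_smult_assoc_mat[of "G * _" n n _ n])
  also have "e \<bullet> (\<dots> *\<^sub>v e) = (-1) ^ j * (e \<bullet> ((G * (X ^\<^sub>m j * (mat_inv G * B) * X ^\<^sub>m k)) *\<^sub>v e))"
    using Xp G(1) B inv(1) e by (intro scalar_prod_smult_mat) (auto intro!: mult_carrier_mat[of _ n n])
  finally show ?thesis .
qed

lemma det_congruence:
  fixes B :: "'a::field mat"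
  assumes "M \<in> carrier_mat n n" "B \<in> carrier_mat n n"
  shows "det (M\<^sup>T * B * M) = det M ^ 2 * det B"
  using assms by (simp add: det_mult[of _ n] det_transpose[of _ n] power2_eq_square)

text \<open>The trace sees only the diagonal of \<open>Z\<close> in the eigenbasis, weighted by
  powers of the eigenvalues. The resulting Vandermonde system is later solved for that
  diagonal.\<close>

lemma mtr_power_diag:
  fixes S :: "'a::field mat"
  assumes S: "S \<in> carrier_mat n n" and P: "P \<in> carrier_mat n n" "det P \<noteq> 0" "S * P = P * dmat n l"
    and Z: "Z \<in> carrier_mat n n"
  shows "mtr (S ^\<^sub>m k * Z) = (\<Sum>i<n. l i ^ k * (mat_inv P * Z * P) $$ (i, i))"
proof -
  note inv = mat_inv[OF P(1)]
  have Sk: "S ^\<^sub>m k \<in> carrier_mat n n" using S by simp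
  let ?Y = "mat_inv P * Z * P" and ?D = "dmat n (\<lambda>i. l i ^ k)"
  have Y: "?Y \<in> carrier_mat n n" using P Z inv by simp
  have eq: "S ^\<^sub>m k * P = P * ?D"
    using pow_mat_intertwine[OF S dmat_carrier P(1,3)] by (simp add: dmat_power)
  have "S ^\<^sub>m k = P * ?D * mat_inv P"
  proof (rule mat_mult_right_cancel[OF Sk _ P(1,2)])
    show "S ^\<^sub>m k * P = P * ?D * mat_inv P * P"
      unfolding eq using P inv
      by (simp add: square_mult[where n = n] right_mult_one_mat[of _ n n])
  qed (use P inv in \<open>simp add: mult_carrier_mat[of _ n n _ n]\<close>)
  then have "S ^\<^sub>m k * Z = P * (?D * (mat_inv P * Z))"
    using P(1) Z inv(1) by (simp add: square_mult[where n = n])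
  then have "mtr (S ^\<^sub>m k * Z) = mtr (?D * (mat_inv P * Z) * P)"
    using P(1) Z inv(1) by (simp add: mtr_comm[of P n n] mult_carrier_mat[of _ n n _ n])
  also have "?D * (mat_inv P * Z) * P = ?D * ?Y"
    using P(1) Z inv(1) by (simp add: square_mult[where n = n])
  also have "mtr (?D * ?Y) = mtr (?Y * ?D)"
    by (rule mtr_comm[OF dmat_carrier Y])
  also have "\<dots> = (\<Sum>i<n. ?Y $$ (i, i) * l i ^ k)"
    unfolding mtr_def using mult_dmat_entry[OF Y] Y P(1) inv(1) by (intro sum.cong) auto
  finally show ?thesis by (simp add: mult.commute)
qed

lemma mtr_power_eq_sum:
  fixes S :: "'a::field mat"
  assumes "S \<in> carrier_mat n n" "P \<in> carrier_mat n n" "det P \<noteq> 0" "S * P = P * dmat n l"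
  shows "mtr (S ^\<^sub>m k) = (\<Sum>i<n. l i ^ k)"
  using mtr_power_diag[OF assms one_carrier_mat, of k] assms mat_inv[OF assms(2)]
  by (simp add: right_mult_one_mat[of _ n n] pow_carrier_mat[of _ n])

text \<open>A skew operator has a vector on which all its powers have, up to sign, their traces as
  matrix coefficients: pair the eigenvectors of opposite eigenvalues.\<close>

lemma skew_trace_vector:
  fixes G :: "complex mat"
  assumes G: "G \<in> carrier_mat n n" "G\<^sup>T = G" "det G \<noteq> 0"
    and K: "K \<in> carrier_mat n n" "K\<^sup>T = - K"
  defines "X \<equiv> mat_inv G * K"
  assumes tg: "det (tgram n X) \<noteq> 0"
  obtains e where "e \<in> carrier_vec n" "\<And>k. e \<bullet> ((G * X ^\<^sub>m k) *\<^sub>v e) = (-1) ^ k * mtr (X ^\<^sub>m k)"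
proof -
  note inv = mat_inv[OF G(1)]
  have X: "X \<in> carrier_mat n n" using inv(1) K by (simp add: X_def)
  have Xp: "X ^\<^sub>m i \<in> carrier_mat n n" for i using X by simp
  obtain P l where P: "P \<in> carrier_mat n n" "det P \<noteq> 0" "X * P = P * dmat n l" "inj_on l {..<n}"
    using diagonalizable_if_tgram[OF X tg] by metis
  note Pinv = mat_inv[OF P(1)]
  define H where "H = P\<^sup>T * G * P"
  have H: "H \<in> carrier_mat n n" using P(1) G(1) by (simp add: H_def)
  have Hsym: "H $$ (i, j) = H $$ (j, i)" if "i < n" "j < n" for i j
  proof -
    have "H\<^sup>T = H" using P G by (simp add: H_def transpose_mult[of _ n n _ n] square_mult[where n = n])
    then show ?thesis using H that by (metis carrier_matD index_transpose_mat(1))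
  qed
  have detH: "det H \<noteq> 0"
    using det_congruence[OF P(1) G(1)] G(3) P(2) by (simp add: H_def)
  have HXk: "P\<^sup>T * (G * X ^\<^sub>m k) * P = H * dmat n (\<lambda>i. l i ^ k)" for k
  proof -
    have "P\<^sup>T * (G * X ^\<^sub>m k) * P = P\<^sup>T * G * (X ^\<^sub>m k * P)"
      using P(1) G(1) Xp by (simp add: square_mult[where n = n])
    also have "\<dots> = P\<^sup>T * G * (P * dmat n (\<lambda>i. l i ^ k))"
      using pow_mat_intertwine[OF X dmat_carrier P(1,3)] by (simp add: dmat_power)
    finally show ?thesis
      using P(1) G(1) by (simp add: H_def square_mult[where n = n])
  qed
  \<comment> \<open>In the eigenbasis the skew form is \<open>H\<close> times the diagonal matrix of
    eigenvalues; comparing its skewness with the symmetry of \<open>H\<close> gives H_ij (l_i + l_j)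
    = 0.\<close>
  have skew: "H $$ (i, j) * l j = - (H $$ (i, j) * l i)" if ij: "i < n" "j < n" for i j
  proof -
    let ?W = "P\<^sup>T * K * P"
    have W: "?W \<in> carrier_mat n n" using P K by simp
    have "G * X = K"
      using mat_inv_cancel(1)[OF G(1,3) K(1)] by (simp add: X_def)
    then have eq: "?W = H * dmat n l" using HXk[of 1] X by simp
    have WT: "?W\<^sup>T = - ?W" using P K by (simp add: transpose_mult[of _ n n _ n] square_mult[where n = n])
    have "?W $$ (j, i) = ?W\<^sup>T $$ (i, j)"
      using ij W by (subst index_transpose_mat) auto
    then have "?W $$ (j, i) = - ?W $$ (i, j)"
      unfolding WT using ij W by (subst (asm) index_uminus_mat) auto
    then show ?thesis
      using mult_dmat_entry[OF H ij, of l] mult_dmat_entry[OF H ij(2,1), of l] Hsym[OF ij] unfolding eq by simp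
  qed
  have opp: "l j = - l i" if "i < n" "j < n" "H $$ (i, j) \<noteq> 0" for i j
    using skew[OF that(1,2)] that(3) by (metis mult_left_cancel mult_minus_right)
  have "\<exists>j<n. H $$ (i, j) \<noteq> 0" if i: "i < n" for i
  proof (rule ccontr)
    assume "\<not> ?thesis"
    then have "row H i = 0\<^sub>v n" using H i by (intro eq_vecI) auto
    then have "(H * mat_inv H) $$ (i, i) = 0" using i H mat_inv(1)[OF H] by simp
    then show False using mat_inv(2)[OF H detH] i by simp
  qed
  \<comment> \<open>Each row of the invertible \<open>H\<close> has a nonzero entry, and distinct
    eigenvalues leave room for only one: \<open>\<pi>\<close> pairs the eigenvalue l_i with -l_i,
    and with itself if it is 0.\<close>
  then obtain \<pi> where \<pi>: "\<And>i. i < n \<Longrightarrow> \<pi> i < n \<and> H $$ (i, \<pi> i) \<noteq> 0" by metis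
  have uniq: "j = \<pi> i" if "i < n" "j < n" "H $$ (i, j) \<noteq> 0" for i j
    using opp[OF that] opp[of i "\<pi> i"] \<pi>[OF that(1)] that inj_onD[OF P(4), of j "\<pi> i"] by auto
  \<comment> \<open>\<open>x\<close> takes the same square root at \<open>i\<close> and at
    \<open>\<pi> i\<close>, because the two entries of \<open>H\<close> agree. So each weight
    \<open>x i * H * x (\<pi> i)\<close> is 1, and g(e, X^k e) becomes the sum of the
    (-l_i)^k.\<close>
  define x where "x = vec n (\<lambda>i. csqrt (1 / H $$ (i, \<pi> i)))"
  have x: "x \<in> carrier_vec n" by (simp add: x_def)
  have xx: "x $ i * H $$ (i, \<pi> i) * x $ \<pi> i = 1" if i: "i < n" for i
  proof -
    have "H $$ (\<pi> i, i) \<noteq> 0" using \<pi>[OF i] Hsym[of i "\<pi> i"] i by simp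
    then have "\<pi> (\<pi> i) = i" using uniq[of "\<pi> i" i] \<pi>[OF i] i by simp
    then have "x $ \<pi> i = x $ i" using \<pi>[OF i] i Hsym[of i "\<pi> i"] by (simp add: x_def)
    moreover have "x $ i * x $ i = 1 / H $$ (i, \<pi> i)"
      using i power2_csqrt[of "1 / H $$ (i, \<pi> i)"] by (simp only: x_def index_vec power2_eq_square)
    moreover have "x $ i * H $$ (i, \<pi> i) * x $ i = (x $ i * x $ i) * H $$ (i, \<pi> i)"
      by simp
    ultimately show ?thesis using \<pi>[OF i] by simp
  qed
  note trX = mtr_power_eq_sum[OF X P(1-3)]
  define e where "e = P *\<^sub>v x"
  have e: "e \<in> carrier_vec n" using P x by (simp add: e_def)
  have "e \<bullet> ((G * X ^\<^sub>m k) *\<^sub>v e) = (-1) ^ k * mtr (X ^\<^sub>m k)" for k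
  proof -
    have GX: "G * X ^\<^sub>m k \<in> carrier_mat n n" using G(1) Xp by simp
    have "e \<bullet> ((G * X ^\<^sub>m k) *\<^sub>v e) = x \<bullet> ((H * dmat n (\<lambda>i. l i ^ k)) *\<^sub>v x)"
      unfolding e_def using scalar_prod_transport[OF P(1) GX P(1) x] HXk by simp
    also have "\<dots> = (\<Sum>i<n. x $ i * (\<Sum>j<n. H $$ (i, j) * l j ^ k * x $ j))"
    proof -
      have "((H * dmat n (\<lambda>i. l i ^ k)) *\<^sub>v x) $ i = (\<Sum>j<n. H $$ (i, j) * l j ^ k * x $ j)" if i: "i < n" for i
      proof -
        have "((H * dmat n (\<lambda>i. l i ^ k)) *\<^sub>v x) $ i
            = (\<Sum>j<n. (H * dmat n (\<lambda>i. l i ^ k)) $$ (i, j) * x $ j)"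
          using i x H by (auto simp: scalar_prod_def atLeast0LessThan dmat_def intro!: sum.cong)
        then show ?thesis using mult_dmat_entry[OF H i] by simp
      qed
      then show ?thesis using H x by (simp add: scalar_prod_def atLeast0LessThan dmat_def)
    qed
    also have "\<dots> = (\<Sum>i<n. (- l i) ^ k)"
    proof (rule sum.cong[OF refl])
      fix i assume "i \<in> {..<n}"
      then have i: "i < n" by simp
      have "(\<Sum>j<n. H $$ (i, j) * l j ^ k * x $ j)
          = (\<Sum>j<n. if j = \<pi> i then H $$ (i, j) * l j ^ k * x $ j else 0)"
        using uniq[OF i] by (intro sum.cong) auto
      also have "\<dots> = H $$ (i, \<pi> i) * l (\<pi> i) ^ k * x $ \<pi> i"
        using \<pi>[OF i] by simp
      finally have "x $ i * (\<Sum>j<n. H $$ (i, j) * l j ^ k * x $ j)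
          = (x $ i * H $$ (i, \<pi> i) * x $ \<pi> i) * l (\<pi> i) ^ k"
        by (simp add: mult_ac)
      then show "x $ i * (\<Sum>j<n. H $$ (i, j) * l j ^ k * x $ j) = (- l i) ^ k"
        using xx[OF i] opp[of i "\<pi> i"] \<pi>[OF i] i by simp
    qed
    also have "\<dots> = (-1) ^ k * mtr (X ^\<^sub>m k)"
      unfolding trX sum_distrib_left by (intro sum.cong refl) (metis mult_minus1 power_mult_distrib)
    finally show ?thesis .
  qed
  then show thesis using that e by blast
qed


text \<open>Eigenvectors to distinct eigenvalues are orthogonal for \<open>G\<close>. An isotropic
  one would be orthogonal to the whole space, against \<open>det G \<noteq> 0\<close>; so complex
  square roots normalize all of them.\<close>

lemma selfadjoint_eigenbasis:
  fixes G :: "complex mat"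
  assumes G: "G \<in> carrier_mat n n" "G\<^sup>T = G" "det G \<noteq> 0"
    and H: "H \<in> carrier_mat n n" "H\<^sup>T = H"
  defines "S \<equiv> mat_inv G * H"
  assumes tg: "det (tgram n S) \<noteq> 0"
  obtains P l where "P \<in> carrier_mat n n" "P\<^sup>T * G * P = 1\<^sub>m n" "S * P = P * dmat n l"
    "inj_on l {..<n}" "det (vmat n l) \<noteq> 0"
proof -
  note inv = mat_inv[OF G(1)]
  have S: "S \<in> carrier_mat n n" using inv(1) H by (simp add: S_def)
  obtain P l where P: "P \<in> carrier_mat n n" "det P \<noteq> 0" "S * P = P * dmat n l" "inj_on l {..<n}"
      "det (vmat n l) \<noteq> 0"
    using diagonalizable_if_tgram[OF S tg] by metis
  define C where "C = P\<^sup>T * G * P"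
  have C: "C \<in> carrier_mat n n" using P(1) G(1) by (simp add: C_def)
  have CT: "C\<^sup>T = C"
    using P G by (simp add: C_def transpose_mult[of _ n n _ n] assoc_mult_mat[of _ n n _ n _ n])
  have Csym: "C $$ (i, j) = C $$ (j, i)" if "i < n" "j < n" for i j
    using CT C that by (metis carrier_matD index_transpose_mat(1))
  have detC: "det C \<noteq> 0"
    using det_congruence[OF P(1) G(1)] G(3) P(2) by (simp add: C_def)
  have off: "C $$ (i, j) = 0" if ij: "i < n" "j < n" "i \<noteq> j" for i j
  proof -
    let ?W = "P\<^sup>T * H * P"
    have W: "?W \<in> carrier_mat n n" using P H by simp
    have GS: "G * S = H"
      using mat_inv_cancel(1)[OF G(1,3) H(1)] by (simp add: S_def)
    have "?W = P\<^sup>T * (G * (S * P))"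
      using P(1) G S by (simp flip: GS add: square_mult[where n = n])
    then have eq: "?W = C * dmat n l"
      using P(1) G(1) by (simp add: P(3) C_def square_mult[where n = n])
    have WT: "?W\<^sup>T = ?W"
      using P H by (simp add: transpose_mult[of _ n n _ n] assoc_mult_mat[of _ n n _ n _ n])
    have "?W $$ (j, i) = ?W\<^sup>T $$ (i, j)"
      using ij W by (subst index_transpose_mat) auto
    then have "C $$ (i, j) * l i = C $$ (i, j) * l j"
      unfolding WT
      using mult_dmat_entry[OF C ij(1,2), of l] mult_dmat_entry[OF C ij(2,1), of l] Csym[OF ij(1,2)]
      unfolding eq by simp
    then show ?thesis
      using inj_onD[OF P(4), of i j] ij by auto
  qed
  have C_dmat: "C = dmat n (\<lambda>i. C $$ (i, i))"
    using C off by (intro eq_matI) (auto simp: dmat_def)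
  have diag: "C $$ (i, i) \<noteq> 0" if i: "i < n" for i
  proof
    assume "C $$ (i, i) = 0"
    then have "C $$ (i, j) = 0" if "j < n" for j using off[OF i that] by (cases "i = j") auto
    then have "row C i = 0\<^sub>v n" using C i by (intro eq_vecI) auto
    then have "(C * mat_inv C) $$ (i, i) = 0" using i C mat_inv(1)[OF C] by simp
    then show False using mat_inv(2)[OF C detC] i by simp
  qed
  define x where "x = (\<lambda>i. csqrt (1 / C $$ (i, i)))"
  have xx: "x i * C $$ (i, i) * x i = 1" if "i < n" for i
  proof -
    have "x i * x i = 1 / C $$ (i, i)"
      using power2_csqrt[of "1 / C $$ (i, i)"] by (simp only: x_def power2_eq_square)
    moreover have "x i * C $$ (i, i) * x i = (x i * x i) * C $$ (i, i)" by simp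
    ultimately show ?thesis using diag[OF that] by simp
  qed
  define R where "R = P * dmat n x"
  have R: "R \<in> carrier_mat n n" using P(1) by (simp add: R_def mult_carrier_mat[of _ n n _ n])
  have dT: "(dmat n x)\<^sup>T = dmat n x" by (intro eq_matI) (auto simp: dmat_def)
  have "R\<^sup>T * G * R = dmat n x * C * dmat n x"
    using P(1) G(1) by (simp add: R_def C_def dT transpose_mult[of _ n n _ n] square_mult[where n = n])
  also have "\<dots> = 1\<^sub>m n"
  proof -
    have "dmat n x * C * dmat n x = dmat n (\<lambda>i. x i * C $$ (i, i) * x i)"
      by (subst C_dmat) (simp add: dmat_mult)
    then show ?thesis using xx by (intro eq_matI) (auto simp: dmat_def)
  qed
  finally have 1: "R\<^sup>T * G * R = 1\<^sub>m n" .
  have "S * R = S * P * dmat n x"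
    using P(1) S by (simp add: R_def square_mult[where n = n])
  also have "\<dots> = P * (dmat n l * dmat n x)"
    unfolding P(3) by (rule assoc_mult_mat[OF P(1) dmat_carrier dmat_carrier])
  also have "dmat n l * dmat n x = dmat n x * dmat n l"
    by (simp add: dmat_mult mult.commute)
  also have "P * (dmat n x * dmat n l) = R * dmat n l"
    unfolding R_def by (rule assoc_mult_mat[OF P(1) dmat_carrier dmat_carrier, symmetric])
  finally show thesis using that[OF R 1 _ P(4,5)] by blast
qed

text \<open>This is V (V^T V)^-1 V^T = 1. As a polynomial in y, the sum of T_bc l_i^c y^b is the
  Lagrange interpolation polynomial of l_i: it is 1 at l_i and 0 at the other eigenvalues, and its
  coefficients are polynomials in l_i over the field of the traces.\<close>

lemma vmat_tgram_inverse:
  fixes S :: "'a::field mat"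
  assumes tr: "\<And>k. mtr (S ^\<^sub>m k) = (\<Sum>i<n. l i ^ k)" and V: "det (vmat n l) \<noteq> 0"
    and ij: "i < n" "j < n"
  shows "(\<Sum>b<n. \<Sum>c<n. mat_inv (tgram n S) $$ (b, c) * l i ^ c * l j ^ b) = (if i = j then 1 else 0)"
proof -
  let ?V = "vmat n l" and ?T = "mat_inv (tgram n S)"
  have V': "?V \<in> carrier_mat n n" by simp
  note tgram = tgram_vmat[of S l n, OF tr]
  have "det (tgram n S) = det ?V * det ?V"
    unfolding tgram by (simp add: det_mult[of _ n] det_transpose[of _ n])
  then have dt: "det (tgram n S) \<noteq> 0" using V by simp
  note T = mat_inv[OF tgram_carrier[of n S]]
  have "(?V * ?T * ?V\<^sup>T) * ?V = ?V * (?T * tgram n S)"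
    unfolding tgram using T(1)[unfolded tgram]
    by (simp add: square_mult[where n = n])
  also have "\<dots> = 1\<^sub>m n * ?V"
    using T(3)[OF dt] by (simp add: right_mult_one_mat[OF V'] left_mult_one_mat[OF V'])
  finally have eq: "?V * ?T * ?V\<^sup>T * ?V = 1\<^sub>m n * ?V" .
  have "?V * ?T * ?V\<^sup>T = 1\<^sub>m n"
    by (rule mat_mult_right_cancel[of _ n n, OF _ _ V' V eq])
      (use T(1) in \<open>simp_all add: mult_carrier_mat[of _ n n _ n]\<close>)
  then have "(if i = j then 1 else 0) = (?V * (?T * ?V\<^sup>T)) $$ (j, i)"
    using ij T(1) by (simp add: assoc_mult_mat[of _ n n _ n _ n])
  also have "\<dots> = (\<Sum>b<n. l j ^ b * (?T * ?V\<^sup>T) $$ (b, i))"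
    using ij T(1) by (subst mult_mat_entry[of _ n n _ n]) (auto simp: vmat_def intro!: mult_carrier_mat[of _ n n _ n])
  also have "\<dots> = (\<Sum>b<n. l j ^ b * (\<Sum>c<n. ?T $$ (b, c) * l i ^ c))"
  proof (intro sum.cong refl arg_cong[where f = "\<lambda>x. _ * x"])
    fix b assume "b \<in> {..<n}"
    then have b: "b < n" by simp
    show "(?T * ?V\<^sup>T) $$ (b, i) = (\<Sum>c<n. ?T $$ (b, c) * l i ^ c)"
      using mult_mat_entry[OF T(1) _ b ij(1), of "?V\<^sup>T"] ij by (simp add: vmat_def)
  qed
  finally show ?thesis
    by (simp add: sum_distrib_left mult_ac)
qed

text \<open>The interpolation polynomial evaluated at \<open>S\<close> is the projector onto the
  i-th eigenline, and its trace against \<open>Z\<close> is the diagonal entry. The eigenvector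
  disappears from the formula; only \<open>l i\<close> remains.\<close>

lemma eigenvector_entry:
  fixes S :: "'a::field mat"
  assumes S: "S \<in> carrier_mat n n" and P: "P \<in> carrier_mat n n" "det P \<noteq> 0" "S * P = P * dmat n l"
    and V: "det (vmat n l) \<noteq> 0" and Z: "Z \<in> carrier_mat n n" and i: "i < n"
  shows "(mat_inv P * Z * P) $$ (i, i) =
    (\<Sum>b<n. \<Sum>c<n. mat_inv (tgram n S) $$ (b, c) * l i ^ c * mtr (S ^\<^sub>m b * Z))"
proof -
  let ?T = "mat_inv (tgram n S)" and ?y = "\<lambda>j. (mat_inv P * Z * P) $$ (j, j)"
  note tr = mtr_power_eq_sum[OF S P]
  have "(\<Sum>b<n. \<Sum>c<n. ?T $$ (b, c) * l i ^ c * mtr (S ^\<^sub>m b * Z))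
      = (\<Sum>b<n. \<Sum>c<n. \<Sum>j<n. ?T $$ (b, c) * l i ^ c * l j ^ b * ?y j)"
    unfolding mtr_power_diag[OF S P Z] by (simp add: sum_distrib_left mult_ac)
  also have "\<dots> = (\<Sum>b<n. \<Sum>j<n. \<Sum>c<n. ?T $$ (b, c) * l i ^ c * l j ^ b * ?y j)"
    by (intro sum.cong refl sum.swap)
  also have "\<dots> = (\<Sum>j<n. \<Sum>b<n. \<Sum>c<n. ?T $$ (b, c) * l i ^ c * l j ^ b * ?y j)"
    by (rule sum.swap)
  also have "\<dots> = (\<Sum>j<n. (if i = j then 1 else 0) * ?y j)"
    using vmat_tgram_inverse[OF tr V i] by (intro sum.cong refl) (simp flip: sum_distrib_right)
  also have "\<dots> = (\<Sum>j<n. if i = j then ?y j else 0)"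
    by (intro sum.cong) auto
  also have "\<dots> = ?y i" using i by simp
  finally show ?thesis by simp
qed

text \<open>The Cayley--Hamilton recursion, with coefficients expressed by traces.\<close>

lemma mtr_power_recursion:
  fixes S :: "'a::field mat"
  assumes S: "S \<in> carrier_mat n n" and P: "P \<in> carrier_mat n n" "det P \<noteq> 0" "S * P = P * dmat n l"
    and V: "det (vmat n l) \<noteq> 0"
  shows "mtr (S ^\<^sub>m (d + n)) =
    (\<Sum>b<n. \<Sum>c<n. mat_inv (tgram n S) $$ (b, c) * mtr (S ^\<^sub>m (n + c)) * mtr (S ^\<^sub>m (d + b)))"
proof -
  let ?T = "mat_inv (tgram n S)"
  note tr = mtr_power_eq_sum[OF S P]
  \<comment> \<open>The interpolation identity is multiplied by l_i^n l_j^d and summed over i and j;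
    the chain of swaps only moves the two eigenvalue sums outside.\<close>
  have "(\<Sum>b<n. \<Sum>c<n. ?T $$ (b, c) * mtr (S ^\<^sub>m (n + c)) * mtr (S ^\<^sub>m (d + b)))
      = (\<Sum>b<n. \<Sum>c<n. \<Sum>i<n. \<Sum>j<n. (l i ^ n * l j ^ d) * (?T $$ (b, c) * l i ^ c * l j ^ b))"
    unfolding tr by (simp add: sum_distrib_left sum_distrib_right power_add mult_ac)
  also have "\<dots> = (\<Sum>b<n. \<Sum>i<n. \<Sum>c<n. \<Sum>j<n. (l i ^ n * l j ^ d) * (?T $$ (b, c) * l i ^ c * l j ^ b))"
    by (intro sum.cong refl sum.swap)
  also have "\<dots> = (\<Sum>i<n. \<Sum>b<n. \<Sum>c<n. \<Sum>j<n. (l i ^ n * l j ^ d) * (?T $$ (b, c) * l i ^ c * l j ^ b))"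
    by (rule sum.swap)
  also have "\<dots> = (\<Sum>i<n. \<Sum>b<n. \<Sum>j<n. \<Sum>c<n. (l i ^ n * l j ^ d) * (?T $$ (b, c) * l i ^ c * l j ^ b))"
    by (intro sum.cong refl sum.swap)
  also have "\<dots> = (\<Sum>i<n. \<Sum>j<n. \<Sum>b<n. \<Sum>c<n. (l i ^ n * l j ^ d) * (?T $$ (b, c) * l i ^ c * l j ^ b))"
    by (intro sum.cong refl sum.swap)
  also have "\<dots> = (\<Sum>i<n. \<Sum>j<n. (l i ^ n * l j ^ d) * (if i = j then 1 else 0))"
    using vmat_tgram_inverse[OF tr V] by (intro sum.cong refl) (simp flip: sum_distrib_left)
  also have "\<dots> = (\<Sum>i<n. \<Sum>j<n. if i = j then l i ^ n * l j ^ d else 0)"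
    by (intro sum.cong) auto
  also have "\<dots> = mtr (S ^\<^sub>m (d + n))"
    unfolding tr by (simp add: power_add mult.commute)
  finally show ?thesis by simp
qed

section \<open>Rings of functions\<close>

text \<open>Only ring closure is recorded, so that the same matrix lemmas serve polynomial
  functions, functions regular at a point, the field \<open>K\<close>, polynomials in one variable,
  and polynomials in an eigenvalue over such a ring.\<close>

definition fun_ring :: "('v \<Rightarrow> complex) set \<Rightarrow> bool"
  where "fun_ring R \<longleftrightarrow> (\<forall>c. (\<lambda>_. c) \<in> R) \<and>
    (\<forall>f\<in>R. \<forall>g\<in>R. (\<lambda>v. f v + g v) \<in> R \<and> (\<lambda>v. f v * g v) \<in> R)"

definition mat_in :: "('v \<Rightarrow> complex) set \<Rightarrow> nat \<Rightarrow> ('v \<Rightarrow> complex mat) \<Rightarrow> bool"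
  where "mat_in R n M \<longleftrightarrow> (\<forall>v. M v \<in> carrier_mat n n) \<and>
    (\<forall>i<n. \<forall>j<n. (\<lambda>v. M v $$ (i, j)) \<in> R)"

lemma mat_in_carrier: "mat_in R n M \<Longrightarrow> M v \<in> carrier_mat n n"
  and mat_in_entry: "mat_in R n M \<Longrightarrow> i < n \<Longrightarrow> j < n \<Longrightarrow> (\<lambda>v. M v $$ (i, j)) \<in> R"
  by (auto simp: mat_in_def)

lemma mat_inI:
  assumes "\<And>v. M v \<in> carrier_mat n n" "\<And>i j. i < n \<Longrightarrow> j < n \<Longrightarrow> (\<lambda>v. M v $$ (i, j)) \<in> R"
  shows "mat_in R n M"
  using assms by (auto simp: mat_in_def)

context
  fixes R :: "('v \<Rightarrow> complex) set"
  assumes R: "fun_ring R"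
begin

lemma fun_ring_const: "(\<lambda>_. c) \<in> R"
  and fun_ring_add: "f \<in> R \<Longrightarrow> g \<in> R \<Longrightarrow> (\<lambda>v. f v + g v) \<in> R"
  and fun_ring_mult: "f \<in> R \<Longrightarrow> g \<in> R \<Longrightarrow> (\<lambda>v. f v * g v) \<in> R"
  using R by (auto simp: fun_ring_def)

lemma fun_ring_diff:
  assumes "f \<in> R" "g \<in> R"
  shows "(\<lambda>v. f v - g v) \<in> R"
  using fun_ring_add[OF assms(1) fun_ring_mult[OF fun_ring_const[of "-1"] assms(2)]] by simp

lemma fun_ring_sum: "(\<And>i. i \<in> I \<Longrightarrow> f i \<in> R) \<Longrightarrow> (\<lambda>v. \<Sum>i\<in>I. f i v) \<in> R"
proof (induction I rule: infinite_finite_induct)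
  case (insert i I)
  then show ?case using fun_ring_add[of "f i" "\<lambda>v. \<Sum>i\<in>I. f i v"] by simp
qed (simp_all add: fun_ring_const)

lemma fun_ring_prod: "(\<And>i. i \<in> I \<Longrightarrow> f i \<in> R) \<Longrightarrow> (\<lambda>v. \<Prod>i\<in>I. f i v) \<in> R"
proof (induction I rule: infinite_finite_induct)
  case (insert i I)
  then show ?case using fun_ring_mult[of "f i" "\<lambda>v. \<Prod>i\<in>I. f i v"] by simp
qed (simp_all add: fun_ring_const)

lemma mat_in_const: "A \<in> carrier_mat n n \<Longrightarrow> mat_in R n (\<lambda>_. A)"
  by (simp add: mat_in_def fun_ring_const)

lemma mat_in_add:
  assumes "mat_in R n A" "mat_in R n B"
  shows "mat_in R n (\<lambda>v. A v + B v)"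
proof (rule mat_inI)
  fix i j assume ij: "i < n" "j < n"
  have "(A v + B v) $$ (i, j) = A v $$ (i, j) + B v $$ (i, j)" for v
    using mat_in_carrier[OF assms(1)] mat_in_carrier[OF assms(2)] ij
    by (metis carrier_matD index_add_mat(1))
  then show "(\<lambda>v. (A v + B v) $$ (i, j)) \<in> R"
    using fun_ring_add[OF mat_in_entry[OF assms(1) ij] mat_in_entry[OF assms(2) ij]] by simp
qed (use assms in \<open>simp add: mat_in_def\<close>)

lemma mat_in_smult:
  assumes "f \<in> R" "mat_in R n B"
  shows "mat_in R n (\<lambda>v. f v \<cdot>\<^sub>m B v)"
proof (rule mat_inI)
  fix i j assume ij: "i < n" "j < n"
  have "(f v \<cdot>\<^sub>m B v) $$ (i, j) = f v * B v $$ (i, j)" for v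
    using mat_in_carrier[OF assms(2)] ij by (metis carrier_matD index_smult_mat(1))
  then show "(\<lambda>v. (f v \<cdot>\<^sub>m B v) $$ (i, j)) \<in> R"
    using fun_ring_mult[OF assms(1) mat_in_entry[OF assms(2) ij]] by simp
qed (use assms in \<open>simp add: mat_in_def\<close>)

lemma mat_in_mult:
  assumes "mat_in R n A" "mat_in R n B"
  shows "mat_in R n (\<lambda>v. A v * B v)"
proof (rule mat_inI)
  fix i j assume ij: "i < n" "j < n"
  have "(A v * B v) $$ (i, j) = (\<Sum>l<n. A v $$ (i, l) * B v $$ (l, j))" for v
    by (rule mult_mat_entry[OF mat_in_carrier[OF assms(1)] mat_in_carrier[OF assms(2)] ij])
  then show "(\<lambda>v. (A v * B v) $$ (i, j)) \<in> R"
    using assms ij by (auto intro!: fun_ring_sum fun_ring_mult mat_in_entry)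
qed (use assms in \<open>metis mat_in_carrier mult_carrier_mat\<close>)

lemma mat_in_transpose:
  assumes "mat_in R n A"
  shows "mat_in R n (\<lambda>v. (A v)\<^sup>T)"
proof (rule mat_inI)
  fix i j assume ij: "i < n" "j < n"
  have "(A v)\<^sup>T $$ (i, j) = A v $$ (j, i)" for v
    using mat_in_carrier[OF assms] ij by (metis carrier_matD index_transpose_mat(1))
  then show "(\<lambda>v. (A v)\<^sup>T $$ (i, j)) \<in> R"
    using mat_in_entry[OF assms ij(2,1)] by simp
qed (use mat_in_carrier[OF assms] in simp)

lemma mat_in_mtr:
  assumes "mat_in R n A"
  shows "(\<lambda>v. mtr (A v)) \<in> R"
proof -
  have "dim_row (A v) = n" for v using mat_in_carrier[OF assms] by auto
  then show ?thesis unfolding mtr_def by (auto intro!: fun_ring_sum mat_in_entry[OF assms])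
qed

lemma mat_in_det:
  assumes "mat_in R n A"
  shows "(\<lambda>v. det (A v)) \<in> R"
proof -
  have "det (A v) = (\<Sum>p | p permutes {0..<n}. signof p * (\<Prod>i = 0..<n. A v $$ (i, p i)))" for v
    using mat_in_carrier[OF assms, of v] by (auto simp: det_def)
  then show ?thesis
    using assms by (auto intro!: fun_ring_sum fun_ring_mult fun_ring_const fun_ring_prod mat_in_entry
        simp: permutes_in_image)
qed

lemma mat_in_mat_delete:
  assumes "mat_in R n A" "i < n" "j < n"
  shows "mat_in R (n - 1) (\<lambda>v. mat_delete (A v) i j)"
proof (rule mat_inI)
  fix v show "mat_delete (A v) i j \<in> carrier_mat (n - 1) (n - 1)"
    using mat_in_carrier[OF assms(1)] by (rule mat_delete_carrier)
next
  fix a b assume ab: "a < n - 1" "b < n - 1"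
  let ?a = "if a < i then a else Suc a" and ?b = "if b < j then b else Suc b"
  have "mat_delete (A v) i j $$ (a, b) = A v $$ (?a, ?b)" for v
    using mat_in_carrier[OF assms(1), of v] ab by (auto simp: mat_delete_def)
  then show "(\<lambda>v. mat_delete (A v) i j $$ (a, b)) \<in> R"
    using ab by (auto intro!: mat_in_entry[OF assms(1)])
qed

lemma mat_in_inv:
  assumes "mat_in R n A" "(\<lambda>v. inverse (det (A v))) \<in> R"
  shows "mat_in R n (\<lambda>v. mat_inv (A v))"
proof -
  have "mat_in R n (\<lambda>v. adj_mat (A v))"
  proof (rule mat_inI)
    fix i j assume ij: "i < n" "j < n"
    have "adj_mat (A v) $$ (i, j) = (-1) ^ (j + i) * det (mat_delete (A v) j i)" for v
      using mat_in_carrier[OF assms(1), of v] ij by (auto simp: adj_mat_def cofactor_def)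
    then show "(\<lambda>v. adj_mat (A v) $$ (i, j)) \<in> R"
      using ij assms(1)
      by (auto intro!: fun_ring_mult fun_ring_const mat_in_det[of "n - 1"] mat_in_mat_delete)
  qed (use adj_mat(1)[OF mat_in_carrier[OF assms(1)]] in simp)
  from mat_in_smult[OF assms(2) this] show ?thesis
    by (simp add: mat_inv_def inverse_eq_divide)
qed

lemma mat_in_tgram:
  assumes "\<And>k. k \<le> 2 * n - 2 \<Longrightarrow> (\<lambda>v. mtr (S v ^\<^sub>m k)) \<in> R"
  shows "mat_in R n (\<lambda>v. tgram n (S v))"
  using assms by (auto intro!: mat_inI simp: tgram_def)

end

lemma fun_ring_Int: "fun_ring A \<Longrightarrow> fun_ring B \<Longrightarrow> fun_ring (A \<inter> B)"
  by (auto simp: fun_ring_def)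

lemma fun_ring_polynomials: "fun_ring (range (poly :: complex poly \<Rightarrow> _))"
  unfolding fun_ring_def
proof (intro conjI allI ballI)
  show "(\<lambda>_. c) \<in> range poly" for c :: complex
    by (rule range_eqI[of _ _ "[:c:]"]) auto
next
  fix f g :: "complex \<Rightarrow> complex"
  assume "f \<in> range poly" "g \<in> range poly"
  then obtain p q where "f = poly p" "g = poly q" by blast
  then have "(\<lambda>v. f v + g v) = poly (p + q)" "(\<lambda>v. f v * g v) = poly (p * q)"
    by auto
  then show "(\<lambda>v. f v + g v) \<in> range poly" "(\<lambda>v. f v * g v) \<in> range poly"
    by blast+
qed

text \<open>\<open>R[x]\<close>, evaluated: the variable \<open>x\<close> will be an eigenvalue, which is not a function of \<open>v\<close>.\<close>

definition poly_ext :: "('v \<Rightarrow> complex) set \<Rightarrow> ('v \<times> complex \<Rightarrow> complex) set"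
  where "poly_ext R = {F. \<exists>P n. (\<forall>d. (\<lambda>v. Polynomial.coeff (P v) d) \<in> R) \<and> (\<forall>v. Polynomial.degree (P v) \<le> n) \<and>
    (\<forall>v x. F (v, x) = poly (P v) x)}"

lemma poly_ext_base:
  assumes "fun_ring R" "f \<in> R"
  shows "(\<lambda>(v, x). f v) \<in> poly_ext R"
  unfolding poly_ext_def mem_Collect_eq
proof (intro exI[of _ "\<lambda>v. [:f v:]"] exI[of _ 0] conjI allI)
  fix d show "(\<lambda>v. Polynomial.coeff [:f v:] d) \<in> R"
    using assms fun_ring_const[OF assms(1)] by (cases d) auto
qed auto

lemma poly_ext_var:
  assumes "fun_ring R"
  shows "(\<lambda>(v, x). x) \<in> poly_ext R"
  unfolding poly_ext_def mem_Collect_eq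
proof (intro exI[of _ "\<lambda>v. [:0, 1:]"] exI[of _ 1] conjI allI)
  fix d show "(\<lambda>v. Polynomial.coeff [:0, 1:] d) \<in> R"
    using fun_ring_const[OF assms(1)] by simp
qed auto

lemma fun_ring_poly_ext:
  fixes R :: "('v \<Rightarrow> complex) set"
  assumes R: "fun_ring R"
  shows "fun_ring (poly_ext R)"
  unfolding fun_ring_def
proof (intro conjI allI ballI)
  show "(\<lambda>_. c) \<in> poly_ext R" for c
    using poly_ext_base[OF R fun_ring_const[OF R, of c]] by (simp add: case_prod_unfold)
next
  fix F G assume "F \<in> poly_ext R" "G \<in> poly_ext R"
  then obtain P n Q k where P: "\<And>d. (\<lambda>v. Polynomial.coeff (P v) d) \<in> R" "\<And>v. Polynomial.degree (P v) \<le> n"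
      "\<And>v x. F (v, x) = poly (P v) x"
    and Q: "\<And>d. (\<lambda>v. Polynomial.coeff (Q v) d) \<in> R" "\<And>v. Polynomial.degree (Q v) \<le> k" "\<And>v x. G (v, x) = poly (Q v) x"
    unfolding poly_ext_def by blast
  show "(\<lambda>y. F y + G y) \<in> poly_ext R"
    unfolding poly_ext_def mem_Collect_eq
  proof (intro exI[of _ "\<lambda>v. P v + Q v"] exI[of _ "max n k"] conjI allI)
    show "(\<lambda>v. Polynomial.coeff (P v + Q v) d) \<in> R" for d
      using fun_ring_add[OF R P(1) Q(1)] by simp
    show "Polynomial.degree (P v + Q v) \<le> max n k" for v
      using P(2)[of v] Q(2)[of v] by (intro degree_add_le) auto
  qed (simp add: P Q)
  show "(\<lambda>y. F y * G y) \<in> poly_ext R"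
    unfolding poly_ext_def mem_Collect_eq
  proof (intro exI[of _ "\<lambda>v. P v * Q v"] exI[of _ "n + k"] conjI allI)
    show "(\<lambda>v. Polynomial.coeff (P v * Q v) d) \<in> R" for d
      unfolding coeff_mult by (intro fun_ring_sum[OF R] fun_ring_mult[OF R] P Q)
    show "Polynomial.degree (P v * Q v) \<le> n + k" for v
      using degree_mult_le[of "P v" "Q v"] P(2)[of v] Q(2)[of v] by simp
  qed (simp add: P Q)
qed

text \<open>The descent from the eigenvalues: expanding \<open>F\<close> by its coefficients turns
  the sum into a combination of power sums, which \<open>T\<close> supplies as functions of
  \<open>v\<close>. One \<open>f\<close> works for all \<open>v\<close> and all enumerations of the
  eigenvalues.\<close>

lemma poly_ext_power_sum:
  fixes R :: "('v \<Rightarrow> complex) set"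
  assumes R: "fun_ring R" and F: "F \<in> poly_ext R" and T: "\<And>d. T d \<in> R"
  obtains f where "f \<in> R"
    "\<And>v m x. (\<And>d. T d v = (\<Sum>i<m. x i ^ d)) \<Longrightarrow> f v = (\<Sum>i<m::nat. x i ^ l * F (v, x i))"
proof -
  obtain P n where P: "\<And>d. (\<lambda>v. Polynomial.coeff (P v) d) \<in> R" "\<And>v. Polynomial.degree (P v) \<le> n"
      "\<And>v x. F (v, x) = poly (P v) x"
    using F unfolding poly_ext_def by blast
  show thesis
  proof (rule that)
    show "(\<lambda>v. \<Sum>d\<le>n. Polynomial.coeff (P v) d * T (d + l) v) \<in> R"
      by (intro fun_ring_sum[OF R] fun_ring_mult[OF R] P T)
    fix v m x assume *: "\<And>d. T d v = (\<Sum>i<m::nat. x i ^ d)"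
    have "F (v, y) = (\<Sum>d\<le>n. Polynomial.coeff (P v) d * y ^ d)" for y
      unfolding P(3) poly_altdef using P(2)[of v]
      by (intro sum.mono_neutral_left) (auto simp: coeff_eq_0)
    then have "(\<Sum>i<m. x i ^ l * F (v, x i)) = (\<Sum>i<m. \<Sum>d\<le>n. Polynomial.coeff (P v) d * x i ^ (d + l))"
      by (simp add: sum_distrib_left power_add mult_ac)
    also have "\<dots> = (\<Sum>d\<le>n. Polynomial.coeff (P v) d * T (d + l) v)"
      unfolding * by (subst sum.swap) (simp add: sum_distrib_left)
    finally show "(\<Sum>d\<le>n. Polynomial.coeff (P v) d * T (d + l) v) = (\<Sum>i<m. x i ^ l * F (v, x i))" by simp
  qed
qed

section \<open>Regular functions\<close>

text \<open>\<open>poly_fun\<close> fixes the values outside \<open>V\<close> as well (functionals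
  vanish there), while matrix coordinates are given by formulas on the whole type; this closes it
  under changes off \<open>V\<close>.\<close>

definition poly_on :: "(complex \<Rightarrow> 'v \<Rightarrow> 'v) \<Rightarrow> 'v set \<Rightarrow> ('v::ab_group_add \<Rightarrow> complex) set"
  where "poly_on s V = {f. \<exists>p\<in>poly_fun s V. \<forall>v\<in>V. f v = p v}"

lemma fun_ring_poly_on: "fun_ring (poly_on s V)"
  unfolding fun_ring_def poly_on_def
  by (auto intro: poly_fun.const) (metis (no_types, lifting) poly_fun.add, metis (no_types, lifting) poly_fun.mult)

lemma poly_fun_poly_on: "p \<in> poly_fun s V \<Longrightarrow> p \<in> poly_on s V"
  by (auto simp: poly_on_def)

text \<open>The local ring at \<open>u\<close>, as functions. It serves to show that something is
  generically nonzero: a nonzero value at \<open>u\<close> is enough, also for expressions with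
  denominators.\<close>

definition regular_at ::
  "(complex \<Rightarrow> 'v \<Rightarrow> 'v) \<Rightarrow> 'v set \<Rightarrow> 'v \<Rightarrow> ('v::ab_group_add \<Rightarrow> complex) set"
  where "regular_at s V u = {f. \<exists>p\<in>poly_fun s V. \<exists>q\<in>poly_fun s V. q u \<noteq> 0 \<and>
    (\<forall>v\<in>V. q v \<noteq> 0 \<longrightarrow> f v = p v / q v)}"

lemma poly_on_regular_at:
  assumes "f \<in> poly_on s V"
  shows "f \<in> regular_at s V u"
proof -
  obtain p where p: "p \<in> poly_fun s V" "\<forall>v\<in>V. f v = p v"
    using assms unfolding poly_on_def by blast
  show ?thesis
    unfolding regular_at_def mem_Collect_eq
    by (rule bexI[OF _ p(1)], rule bexI[OF _ poly_fun.const[of 1]]) (use p(2) in auto)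
qed

lemma fun_ring_regular_at: "fun_ring (regular_at s V u)"
  unfolding fun_ring_def
proof (intro conjI allI ballI)
  show "(\<lambda>_. c) \<in> regular_at s V u" for c
    using fun_ring_const[OF fun_ring_poly_on] by (rule poly_on_regular_at)
next
  fix f g assume "f \<in> regular_at s V u" "g \<in> regular_at s V u"
  then obtain p q p' q' where
    f: "p \<in> poly_fun s V" "q \<in> poly_fun s V" "q u \<noteq> 0" "\<forall>v\<in>V. q v \<noteq> 0 \<longrightarrow> f v = p v / q v"
    and g: "p' \<in> poly_fun s V" "q' \<in> poly_fun s V" "q' u \<noteq> 0" "\<forall>v\<in>V. q' v \<noteq> 0 \<longrightarrow> g v = p' v / q' v"
    unfolding regular_at_def by blast
  have den: "(\<lambda>v. q v * q' v) \<in> poly_fun s V" "q u * q' u \<noteq> 0"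
    using f g by (auto intro: poly_fun.mult)
  have num: "(\<lambda>v. p v * q' v + p' v * q v) \<in> poly_fun s V" "(\<lambda>v. p v * p' v) \<in> poly_fun s V"
    using f g by (auto intro!: poly_fun.mult poly_fun.add)
  show "(\<lambda>v. f v + g v) \<in> regular_at s V u"
    unfolding regular_at_def mem_Collect_eq
    by (rule bexI[OF _ num(1)], rule bexI[OF _ den(1)]) (use den(2) f(4) g(4) in \<open>auto simp: field_simps\<close>)
  show "(\<lambda>v. f v * g v) \<in> regular_at s V u"
    unfolding regular_at_def mem_Collect_eq
    by (rule bexI[OF _ num(2)], rule bexI[OF _ den(1)]) (use den(2) f(4) g(4) in auto)
qed

lemma regular_at_inverse:
  assumes "f \<in> regular_at s V u" "f u \<noteq> 0" "u \<in> V"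
  shows "(\<lambda>v. inverse (f v)) \<in> regular_at s V u"
proof -
  obtain p q where
    f: "p \<in> poly_fun s V" "q \<in> poly_fun s V" "q u \<noteq> 0" "\<forall>v\<in>V. q v \<noteq> 0 \<longrightarrow> f v = p v / q v"
    using assms unfolding regular_at_def by blast
  have "p u \<noteq> 0" using f assms by auto
  then show ?thesis
    unfolding regular_at_def mem_Collect_eq
    by (intro bexI[OF _ poly_fun.mult[OF f(2,2)]] bexI[OF _ poly_fun.mult[OF f(1,2)]])
      (use f in auto)
qed

lemma regular_at_generically_nonzero:
  assumes "f \<in> regular_at s V u" "f u \<noteq> 0" "u \<in> V"
  shows "generically s V (\<lambda>v. f v \<noteq> 0)"
proof -
  obtain p q where
    f: "p \<in> poly_fun s V" "q \<in> poly_fun s V" "q u \<noteq> 0" "\<forall>v\<in>V. q v \<noteq> 0 \<longrightarrow> f v = p v / q v"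
    using assms unfolding regular_at_def by blast
  have "p u \<noteq> 0" using f assms by auto
  then show ?thesis
    unfolding generically_def using f assms(3)
    by (intro bexI[OF _ poly_fun.mult[OF f(1,2)]] conjI) auto
qed

lemma regular_at_carrier:
  assumes "vector_space s" "module.subspace s V" "f \<in> regular_at s V u" "u \<in> V"
  shows "germ s V f \<in> carrier (rat_field s V)"
proof -
  obtain p q where
    f: "p \<in> poly_fun s V" "q \<in> poly_fun s V" "q u \<noteq> 0" "\<forall>v\<in>V. q v \<noteq> 0 \<longrightarrow> f v = p v / q v"
    using assms unfolding regular_at_def by blast
  show ?thesis
    by (rule carrier_rat_fieldI[OF assms(1,2) f(1,2) assms(4) f(3)])
      (use f assms(4) in \<open>auto simp: generically_def\<close>)
qed

lemma generically_ex:
  assumes "generically s V P"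
  obtains v where "v \<in> V" "P v"
  using assms unfolding generically_def by blast

section \<open>Tuples of matrices under congruence\<close>

text \<open>What the argument needs from symbols: \<open>N\<close> matrices as polynomial
  coordinates, functionals linear in their entries, and a point \<open>mk B\<close> for every tuple.
  Points with the same matrices are not assumed equal, but by \<open>poly_fun_eqI\<close> no
  polynomial function separates them on \<open>V\<close>.\<close>

locale matrix_coords =
  fixes s :: "complex \<Rightarrow> 'v::ab_group_add \<Rightarrow> 'v" and V :: "'v set" and m N :: nat
    and Bm :: "'v \<Rightarrow> nat \<Rightarrow> complex mat" and mk :: "(nat \<Rightarrow> complex mat) \<Rightarrow> 'v"
  assumes vs: "vector_space s" and sub: "module.subspace s V"
    and Bm_carrier [simp]: "Bm v l \<in> carrier_mat m m"
    and Bm_poly: "l \<in> {1..N} \<Longrightarrow> j < m \<Longrightarrow> k < m \<Longrightarrow> (\<lambda>v. Bm v l $$ (j, k)) \<in> poly_on s V"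
    and functional_rep: "f \<in> lin_maps s V (*) UNIV \<Longrightarrow>
      \<exists>c. \<forall>v\<in>V. f v = (\<Sum>l\<in>{1..N}. \<Sum>j<m. \<Sum>k<m. c l j k * Bm v l $$ (j, k))"
    and mk_in: "(\<And>l. l \<in> {1..N} \<Longrightarrow> B l \<in> carrier_mat m m) \<Longrightarrow> mk B \<in> V"
    and Bm_mk: "(\<And>l. l \<in> {1..N} \<Longrightarrow> B l \<in> carrier_mat m m) \<Longrightarrow> l \<in> {1..N} \<Longrightarrow> Bm (mk B) l = B l"
    and N_pos: "N \<ge> 1" and m_pos: "m \<ge> 1"
begin

text \<open>Substitution: a point whose matrices have entries in \<open>R\<close> may be inserted
  into a polynomial function. Points given by traces, by a parameter, or by an eigenvalue variable
  are all handled this way.\<close>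

lemma poly_fun_comp:
  assumes R: "fun_ring R" and \<tau>: "\<And>x. \<tau> x \<in> V"
    and entries: "\<And>l. l \<in> {1..N} \<Longrightarrow> mat_in R m (\<lambda>x. Bm (\<tau> x) l)"
    and p: "p \<in> poly_fun s V"
  shows "(\<lambda>x. p (\<tau> x)) \<in> R"
  using p
proof induction
  case (const c)
  show ?case by (rule fun_ring_const[OF R])
next
  case (functional f)
  obtain c where "\<forall>v\<in>V. f v = (\<Sum>l\<in>{1..N}. \<Sum>j<m. \<Sum>k<m. c l j k * Bm v l $$ (j, k))"
    using functional_rep[OF functional] by blast
  then have "(\<lambda>x. f (\<tau> x)) = (\<lambda>x. \<Sum>l\<in>{1..N}. \<Sum>j<m. \<Sum>k<m. c l j k * Bm (\<tau> x) l $$ (j, k))"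
    using \<tau> by auto
  then show ?case
    by (auto intro!: fun_ring_sum[OF R] fun_ring_mult[OF R] fun_ring_const[OF R] mat_in_entry[OF entries])
qed (rule fun_ring_add[OF R] fun_ring_mult[OF R]; assumption)+

lemma poly_fun_eqI:
  assumes "v \<in> V" "w \<in> V" "\<And>l. l \<in> {1..N} \<Longrightarrow> Bm v l = Bm w l" "p \<in> poly_fun s V"
  shows "p v = p w"
  using assms(4)
proof induction
  case (functional f)
  then show ?case using functional_rep[OF functional] assms(1-3) by fastforce
qed auto

definition congr :: "complex mat \<Rightarrow> 'v \<Rightarrow> 'v"
  where "congr M v = mk (\<lambda>l. M\<^sup>T * Bm v l * M)"

lemma congr:
  assumes "M \<in> carrier_mat m m"
  shows "congr M v \<in> V" and "l \<in> {1..N} \<Longrightarrow> Bm (congr M v) l = M\<^sup>T * Bm v l * M"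
proof -
  have "M\<^sup>T * Bm v l * M \<in> carrier_mat m m" for l
    using assms Bm_carrier[of v l] by (simp add: mult_carrier_mat[of _ m m _ m])
  then show "congr M v \<in> V" "l \<in> {1..N} \<Longrightarrow> Bm (congr M v) l = M\<^sup>T * Bm v l * M"
    unfolding congr_def by (simp_all add: mk_in Bm_mk)
qed

lemma congr_one:
  assumes "p \<in> poly_fun s V" "v \<in> V"
  shows "p (congr (1\<^sub>m m) v) = p v"
  using assms congr(1)[OF one_carrier_mat, of v] congr(2)[OF one_carrier_mat, of _ v]
  by (intro poly_fun_eqI) (auto simp: left_mult_one_mat[OF Bm_carrier] right_mult_one_mat[OF Bm_carrier])

text \<open>Along the line M + t 1 the identity is polynomial in \<open>t\<close> and holds wherever
  det (M + t 1), the characteristic polynomial of \<open>- M\<close>, is nonzero; so it holds at t =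
  0. An eigenframe may be singular for some of the eigenvectors over which one later sums.\<close>

lemma congr_invariance_extend:
  assumes p: "p \<in> poly_fun s V" and q: "q \<in> poly_fun s V"
    and inv: "\<And>M. M \<in> carrier_mat m m \<Longrightarrow> det M \<noteq> 0 \<Longrightarrow> p (congr M v) * q v = p v * q (congr M v)"
    and M: "M \<in> carrier_mat m m"
  shows "p (congr M v) * q v = p v * q (congr M v)"
proof -
  let ?R = "range (poly :: complex poly \<Rightarrow> _)"
  note R = fun_ring_polynomials
  define W where "W = (\<lambda>t. M + t \<cdot>\<^sub>m 1\<^sub>m m)"
  have W: "W t \<in> carrier_mat m m" for t using M by (simp add: W_def)
  have id: "(\<lambda>t. t) \<in> ?R"
    by (rule range_eqI[of _ _ "[:0, 1:]"]) auto
  have WR: "mat_in ?R m W"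
    unfolding W_def by (intro mat_in_add[OF R] mat_in_smult[OF R] id mat_in_const[OF R] M one_carrier_mat)
  have "mat_in ?R m (\<lambda>t. Bm (congr (W t) v) l)" if "l \<in> {1..N}" for l
    unfolding congr(2)[OF W that] by (intro mat_in_mult[OF R] mat_in_transpose[OF R] WR mat_in_const[OF R]) simp
  then have comp: "(\<lambda>t. f (congr (W t) v)) \<in> ?R" if "f \<in> poly_fun s V" for f
    using that by (intro poly_fun_comp[OF R _ _ that] congr W) auto
  have "(\<lambda>t. p (congr (W t) v) * q v - p v * q (congr (W t) v)) \<in> ?R"
    by (intro fun_ring_diff[OF R] fun_ring_mult[OF R] fun_ring_const[OF R] comp p q)
  then obtain D where "(\<lambda>t. p (congr (W t) v) * q v - p v * q (congr (W t) v)) = poly D"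
    by blast
  note D = fun_cong[OF this]
  have det: "det (W t) = poly (char_poly (- M)) t" for t
  proof -
    have "W t = - char_matrix (- M) t"
      using M by (intro eq_matI) (auto simp: W_def char_matrix_def)
    then show ?thesis using char_poly_matrix[of "- M" m t] M by simp
  qed
  have "poly (D * char_poly (- M)) t = 0" for t
    using inv[OF W, of t] D[of t] det[of t] by (cases "det (W t) = 0") auto
  then have "D * char_poly (- M) = 0" using poly_all_0_iff_0 by blast
  moreover have "char_poly (- M) \<noteq> 0"
    using degree_monic_char_poly[of "- M" m] M by auto
  ultimately have "D = 0" by simp
  moreover have "W 0 = M" using M by (intro eq_matI) (auto simp: W_def)
  ultimately show ?thesis using D[of 0] by simp
qed

section \<open>Operators and their words in matrix coordinates\<close>

definition Gm :: "'v \<Rightarrow> complex mat"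
  where "Gm v = (1/2) \<cdot>\<^sub>m (Bm v 1 + (Bm v 1)\<^sup>T)"

definition Km :: "'v \<Rightarrow> complex mat"
  where "Km v = (1/2) \<cdot>\<^sub>m (Bm v 1 + (-1) \<cdot>\<^sub>m (Bm v 1)\<^sup>T)"

text \<open>A form is b(x, y) = x^T B y, so g^-1 b has the matrix G^-1 B^T and its
  \<open>g\<close>-dual has G^-1 B: the transpose stands on the letter that is not dual.\<close>

definition letter :: "'v \<Rightarrow> nat \<times> bool \<Rightarrow> complex mat"
  where "letter v = (\<lambda>(l, d). let C = (if l = 1 then Km v else Bm v l) in
    mat_inv (Gm v) * (if d then C else C\<^sup>T))"

definition word :: "'v \<Rightarrow> (nat \<times> bool) list \<Rightarrow> complex mat"
  where "word v I = foldr (\<lambda>x M. letter v x * M) I (1\<^sub>m m)"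

lemma Gm_carrier [simp]: "Gm v \<in> carrier_mat m m"
  and Km_carrier [simp]: "Km v \<in> carrier_mat m m"
  using Bm_carrier[of v 1] by (auto simp: Gm_def Km_def)

lemma Gm_sym: "(Gm v)\<^sup>T = Gm v"
  and Km_skew: "(Km v)\<^sup>T = - Km v"
  and Bm_1: "Bm v 1 = Gm v + Km v"
  using carrier_matD[OF Bm_carrier[of v 1]]
  by (auto intro!: eq_matI simp: Gm_def Km_def field_simps)

lemma letter_carrier [simp]: "letter v x \<in> carrier_mat m m"
  using mat_inv(1)[OF Gm_carrier[of v]]
  by (cases x) (auto simp: letter_def Let_def intro!: mult_carrier_mat[of _ m m _ m])

lemma word_Nil [simp]: "word v [] = 1\<^sub>m m"
  and word_Cons [simp]: "word v (x # I) = letter v x * word v I"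
  by (simp_all add: word_def)

lemma word_carrier [simp]: "word v I \<in> carrier_mat m m"
  by (induction I) (auto intro!: mult_carrier_mat[of _ m m _ m])

lemma word_append: "word v (I @ J) = word v I * word v J"
  by (induction I)
    (simp_all add: left_mult_one_mat[OF word_carrier] assoc_mult_mat[of _ m m _ m _ m])

lemma poly_on_Bm: "l \<in> {1..N} \<Longrightarrow> mat_in (poly_on s V) m (\<lambda>v. Bm v l)"
  by (rule mat_inI) (auto intro: Bm_poly)

lemma poly_on_Gm: "mat_in (poly_on s V) m Gm"
  and poly_on_Km: "mat_in (poly_on s V) m Km"
  unfolding Gm_def[abs_def] Km_def[abs_def]
  using fun_ring_const[OF fun_ring_poly_on[of s V]] N_pos
  by (auto intro!: mat_in_smult mat_in_add mat_in_transpose poly_on_Bm fun_ring_poly_on)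

lemma mat_in_regular: "mat_in (poly_on s V) n M \<Longrightarrow> mat_in (regular_at s V u) n M"
  by (auto simp: mat_in_def poly_on_regular_at)

lemma regular_letter:
  assumes u: "u \<in> V" "det (Gm u) \<noteq> 0" and x: "fst x \<in> {1..N}"
  shows "mat_in (regular_at s V u) m (\<lambda>v. letter v x)"
proof -
  note R = fun_ring_regular_at[of s V u]
  have "(\<lambda>v. inverse (det (Gm v))) \<in> regular_at s V u"
    using u by (intro regular_at_inverse mat_in_det[OF R mat_in_regular[OF poly_on_Gm]])
  then have inv: "mat_in (regular_at s V u) m (\<lambda>v. mat_inv (Gm v))"
    by (intro mat_in_inv[OF R] mat_in_regular poly_on_Gm)
  obtain l d where [simp]: "x = (l, d)" by (cases x)
  have C: "mat_in (regular_at s V u) m (\<lambda>v. if l = 1 then Km v else Bm v l)"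
    using x poly_on_Km poly_on_Bm by (cases "l = 1") (auto intro!: mat_in_regular)
  show ?thesis
    using mat_in_mult[OF R inv C] mat_in_mult[OF R inv mat_in_transpose[OF R C]]
    by (cases d) (simp_all add: letter_def Let_def)
qed

lemma regular_word:
  assumes u: "u \<in> V" "det (Gm u) \<noteq> 0" and I: "fst ` set I \<subseteq> {1..N}"
  shows "mat_in (regular_at s V u) m (\<lambda>v. word v I)"
  using I
proof (induction I)
  case Nil
  show ?case by (simp add: mat_in_const[OF fun_ring_regular_at])
next
  case (Cons x I)
  then show ?case
    using mat_in_mult[OF fun_ring_regular_at regular_letter[OF u, of x] Cons.IH] by simp
qed

text \<open>Linear combinations of words, graded by a length bound that adds under products. A trace
  then lies in the field \<open>K\<close> below once this bound is at most 2^m - 1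
  (\<open>wspan_mtr\<close>).\<close>

inductive_set wspan :: "nat \<Rightarrow> ('v \<Rightarrow> complex mat) set"
  for d where
  word: "length I \<le> d \<Longrightarrow> fst ` set I \<subseteq> {1..N} \<Longrightarrow> (\<lambda>v. word v I) \<in> wspan d"
| add: "M \<in> wspan d \<Longrightarrow> M' \<in> wspan d \<Longrightarrow> (\<lambda>v. M v + M' v) \<in> wspan d"
| smult: "M \<in> wspan d \<Longrightarrow> (\<lambda>v. c \<cdot>\<^sub>m M v) \<in> wspan d"

lemma wspan_carrier: "M \<in> wspan d \<Longrightarrow> M v \<in> carrier_mat m m"
  by (induction rule: wspan.induct) auto

lemma wspan_mult_word:
  assumes "M \<in> wspan d" "length I \<le> e" "fst ` set I \<subseteq> {1..N}"
  shows "(\<lambda>v. word v I * M v) \<in> wspan (e + d)"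
  using assms(1)
proof induction
  case (word J)
  have "(\<lambda>v. word v (I @ J)) \<in> wspan (e + d)"
    using assms word by (intro wspan.word) auto
  then show ?case by (simp add: word_append)
next
  case (add M M')
  then show ?case
    using wspan.add[OF add.IH] by (simp add: mult_add_distrib_mat[OF word_carrier wspan_carrier wspan_carrier])
next
  case (smult M c)
  then show ?case
    using wspan.smult[OF smult.IH, of c] by (simp add: mult_smult_distrib[OF word_carrier wspan_carrier])
qed

lemma wspan_mult:
  assumes "M \<in> wspan d" "M' \<in> wspan e"
  shows "(\<lambda>v. M v * M' v) \<in> wspan (d + e)"
  using assms(1)
proof induction
  case (word I)
  then show ?case by (rule wspan_mult_word[OF assms(2)])
next
  case (add M1 M2)
  then show ?case
    using wspan.add[OF add.IH]
    by (simp add: add_mult_distrib_mat[OF wspan_carrier wspan_carrier wspan_carrier[OF assms(2)]])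
next
  case (smult M c)
  then show ?case
    using wspan.smult[OF smult.IH, of c]
    by (simp add: mult_smult_assoc_mat[OF wspan_carrier wspan_carrier[OF assms(2)]])
qed

lemma wspan_letter: "fst x \<in> {1..N} \<Longrightarrow> (\<lambda>v. letter v x) \<in> wspan 1"
  using wspan.word[of "[x]" 1] by (simp add: right_mult_one_mat[OF letter_carrier])

lemma wspan_one: "(\<lambda>v. 1\<^sub>m m) \<in> wspan d"
  using wspan.word[of "[]" d] by simp

lemma wspan_power:
  assumes "M \<in> wspan 1"
  shows "(\<lambda>v. M v ^\<^sub>m k) \<in> wspan k"
proof (induction k)
  case 0
  have "dim_row (M v) = m" for v using wspan_carrier[OF assms] by auto
  then show ?case by (simp add: wspan_one)
next
  case (Suc k)
  then show ?case using wspan_mult[OF Suc assms] by simp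
qed

lemma regular_wspan:
  assumes u: "u \<in> V" "det (Gm u) \<noteq> 0" and M: "M \<in> wspan d"
  shows "mat_in (regular_at s V u) m M"
  using M
  by induction (auto intro!: regular_word[OF u] mat_in_add[OF fun_ring_regular_at]
      mat_in_smult[OF fun_ring_regular_at] fun_ring_const[OF fun_ring_regular_at])

lemma Gm_Km_mk:
  assumes "\<And>l. l \<in> {1..N} \<Longrightarrow> B l \<in> carrier_mat m m" "G \<in> carrier_mat m m" "A \<in> carrier_mat m m"
    "B 1 = G + A" "G\<^sup>T = G" "A\<^sup>T = - A"
  shows "Gm (mk B) = G" "Km (mk B) = A"
proof -
  have 1: "Bm (mk B) 1 = G + A"
    using Bm_mk[of B 1] assms N_pos by simp
  have T: "(G + A)\<^sup>T = G + - A"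
    using assms by (simp add: transpose_add[of _ m m])
  show "Gm (mk B) = G" "Km (mk B) = A"
    unfolding Gm_def Km_def 1 T using assms(2,3) by (auto intro!: eq_matI)
qed

lemma congruence_combination:
  fixes B M :: "complex mat"
  assumes "M \<in> carrier_mat m m" "B \<in> carrier_mat m m"
  shows "M\<^sup>T * (a \<cdot>\<^sub>m (B + c \<cdot>\<^sub>m B\<^sup>T)) * M = a \<cdot>\<^sub>m (M\<^sup>T * B * M + c \<cdot>\<^sub>m (M\<^sup>T * B * M)\<^sup>T)"
proof -
  have T: "(M\<^sup>T * B * M)\<^sup>T = M\<^sup>T * B\<^sup>T * M"
    using assms by (simp add: transpose_mult[of _ m m _ m] square_mult[where n = m])
  have "M\<^sup>T * (a \<cdot>\<^sub>m (B + c \<cdot>\<^sub>m B\<^sup>T)) = a \<cdot>\<^sub>m (M\<^sup>T * B + c \<cdot>\<^sub>m (M\<^sup>T * B\<^sup>T))"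
    using assms by (simp add: mult_smult_distrib[of _ m m _ m] mult_add_distrib_mat[of _ m m _ m])
  then show ?thesis
    unfolding T using assms by (simp add: mult_smult_assoc_mat[of _ m m _ m] add_mult_distrib_mat[of _ m m _ _ m]
        mult_carrier_mat[of _ m m _ m])
qed

lemma Gm_congr:
  assumes "M \<in> carrier_mat m m"
  shows "Gm (congr M v) = M\<^sup>T * Gm v * M"
proof -
  have one: "1 \<cdot>\<^sub>m A = A" for A :: "complex mat" by (intro eq_matI) auto
  show ?thesis
    using congruence_combination[OF assms Bm_carrier[of v 1], of "1/2" 1] congr(2)[OF assms, of 1 v] N_pos
    by (simp add: Gm_def one)
qed

lemma Km_congr:
  assumes "M \<in> carrier_mat m m"
  shows "Km (congr M v) = M\<^sup>T * Km v * M"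
  using congruence_combination[OF assms Bm_carrier[of v 1], of "1/2" "-1"] congr(2)[OF assms, of 1 v] N_pos
  by (simp add: Km_def)

text \<open>Congruence changes G^-1 to M^-1 G^-1 M^-T and a form C to M^T C M; in the product the
  inner factors cancel.\<close>

lemma letter_congr:
  assumes M: "M \<in> carrier_mat m m" "det M \<noteq> 0" and G: "det (Gm v) \<noteq> 0" and x: "fst x \<in> {1..N}"
  shows "letter (congr M v) x = mat_inv M * letter v x * M"
proof -
  obtain l d where [simp]: "x = (l, d)" by (cases x)
  note Mi = mat_inv[OF M(1)] and Gi = mat_inv[OF Gm_carrier[of v]]
  let ?Mi = "mat_inv M" and ?Gi = "mat_inv (Gm v)"
  define D where "D = (\<lambda>v. let C = (if l = 1 then Km v else Bm v l) in if d then C else C\<^sup>T)"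
  have D: "D v \<in> carrier_mat m m" for v by (auto simp: D_def Let_def)
  have letter: "letter v x = mat_inv (Gm v) * D v" for v by (simp add: letter_def D_def Let_def)
  note MT = mat_inv_transpose_cancel(2)[OF M]
  have "D (congr M v) = M\<^sup>T * D v * M"
  proof -
    have "(M\<^sup>T * C * M)\<^sup>T = M\<^sup>T * C\<^sup>T * M" if "C \<in> carrier_mat m m" for C
      using that M(1) by (simp add: transpose_mult[of _ m m _ m] square_mult[where n = m])
    then show ?thesis
      using x by (cases d) (simp_all add: D_def Let_def Km_congr[OF M(1)] congr(2)[OF M(1)])
  qed
  moreover have "mat_inv (Gm (congr M v)) = ?Mi * ?Gi * ?Mi\<^sup>T"
  proof (rule mat_inv_eqI)
    have "?Mi * ?Gi * ?Mi\<^sup>T * (M\<^sup>T * Gm v * M) = ?Mi * (?Gi * (?Mi\<^sup>T * (M\<^sup>T * (Gm v * M))))"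
      using Mi(1) Gi(1) M(1) by (simp add: square_mult[where n = m])
    also have "\<dots> = ?Mi * (?Gi * (Gm v * M))"
      using M(1) by (subst MT) (auto simp: mult_carrier_mat[of _ m m _ m])
    also have "\<dots> = 1\<^sub>m m"
      using mat_inv_cancel(2)[OF Gm_carrier G M(1)] Mi(3)[OF M(2)] by simp
    finally show "?Mi * ?Gi * ?Mi\<^sup>T * Gm (congr M v) = 1\<^sub>m m" unfolding Gm_congr[OF M(1)] .
  qed (use Mi(1) Gi(1) in \<open>auto intro!: mult_carrier_mat[of _ m m _ m]\<close>)
  ultimately have "letter (congr M v) x = ?Mi * ?Gi * ?Mi\<^sup>T * (M\<^sup>T * D v * M)"
    by (simp only: letter)
  also have "\<dots> = ?Mi * (?Gi * (?Mi\<^sup>T * (M\<^sup>T * (D v * M))))"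
    using Mi(1) Gi(1) M(1) D by (simp add: square_mult[where n = m])
  also have "\<dots> = ?Mi * (?Gi * (D v * M))"
    using M(1) D by (subst MT) (auto simp: mult_carrier_mat[of _ m m _ m])
  also have "\<dots> = ?Mi * letter v x * M"
    unfolding letter using Mi(1) Gi(1) M(1) D
    by (simp add: square_mult[where n = m])
  finally show ?thesis .
qed

lemma word_congr:
  assumes M: "M \<in> carrier_mat m m" "det M \<noteq> 0" and G: "det (Gm v) \<noteq> 0" and I: "fst ` set I \<subseteq> {1..N}"
  shows "word (congr M v) I = mat_inv M * word v I * M"
  using I
proof (induction I)
  case Nil
  then show ?case using mat_inv[OF M(1)] M by (simp add: right_mult_one_mat[of _ m m])
next
  case (Cons x I)
  note Mi = mat_inv[OF M(1)]
  have "word (congr M v) (x # I) = mat_inv M * (letter v x * (M * (mat_inv M * (word v I * M))))"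
    using Cons letter_congr[OF M G, of x] Mi(1) M(1)
    by (simp add: square_mult[where n = m])
  then show ?case
    using mat_inv_cancel(1)[OF M, of "word v I * M"] Mi(1) M(1)
    by (simp add: square_mult[where n = m])
qed

lemma mtr_word_congr:
  assumes "M \<in> carrier_mat m m" "det M \<noteq> 0" "det (Gm v) \<noteq> 0" "fst ` set I \<subseteq> {1..N}"
  shows "mtr (word (congr M v) I) = mtr (word v I)"
  unfolding word_congr[OF assms] using mat_inv[OF assms(1)] assms by (intro mtr_conj[of _ m]) auto

section \<open>Generic nondegeneracy and the invariance identity\<close>

lemma nondegenerate_exists: "\<exists>u\<in>V. det (Gm u) \<noteq> 0"
proof
  let ?B = "\<lambda>l::nat. 1\<^sub>m m :: complex mat"
  show "mk ?B \<in> V" by (rule mk_in) simp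
  have z: "- 0\<^sub>m m m = (0\<^sub>m m m :: complex mat)" by (intro eq_matI) auto
  have "Gm (mk ?B) = 1\<^sub>m m"
    by (rule Gm_Km_mk(1)[of ?B "1\<^sub>m m" "0\<^sub>m m m"]) (simp_all add: right_add_zero_mat[of _ m m] z)
  then show "det (Gm (mk ?B)) \<noteq> 0" by simp
qed

lemma nondegenerate_generic: "generically s V (\<lambda>v. det (Gm v) \<noteq> 0)"
proof -
  obtain u where "u \<in> V" "det (Gm u) \<noteq> 0" using nondegenerate_exists by blast
  then show ?thesis
    by (intro regular_at_generically_nonzero[of "\<lambda>v. det (Gm v)" s V u])
      (auto intro!: mat_in_det[OF fun_ring_regular_at mat_in_regular[OF poly_on_Gm]])
qed

lemma congr_cancel:
  assumes M: "M \<in> carrier_mat m m" "det M \<noteq> 0" and f: "f \<in> poly_fun s V" and v: "v \<in> V"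
  shows "f (congr M (congr (mat_inv M) v)) = f v"
proof (rule poly_fun_eqI[OF congr(1)[OF M(1)] v _ f])
  note Mi = mat_inv[OF M(1)]
  let ?Mi = "mat_inv M"
  fix l assume l: "l \<in> {1..N}"
  note MT = mat_inv_transpose_cancel(1)[OF M]
  have B: "Bm v l \<in> carrier_mat m m" by simp
  have "M\<^sup>T * (?Mi\<^sup>T * Bm v l * ?Mi) * M = M\<^sup>T * (?Mi\<^sup>T * Bm v l) * (?Mi * M)"
    using M(1) Mi(1) B by (simp add: square_mult[where n = m])
  also have "\<dots> = Bm v l"
    unfolding MT[OF B] Mi(3)[OF M(2)] by (rule right_mult_one_mat[OF B])
  finally show "Bm (congr M (congr ?Mi v)) l = Bm v l"
    unfolding congr(2)[OF M(1) l] congr(2)[OF Mi(1) l] .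
qed

lemma poly_on_congr:
  assumes "M \<in> carrier_mat m m" "f \<in> poly_fun s V"
  shows "(\<lambda>v. f (congr M v)) \<in> poly_on s V"
proof (rule poly_fun_comp[OF fun_ring_poly_on _ _ assms(2)])
  show "mat_in (poly_on s V) m (\<lambda>v. Bm (congr M v) l)" if "l \<in> {1..N}" for l
    unfolding congr(2)[OF assms(1) that]
    by (intro mat_in_mult[OF fun_ring_poly_on] mat_in_const[OF fun_ring_poly_on] poly_on_Bm that assms(1))
      (simp add: assms(1))
qed (rule congr(1)[OF assms(1)])

text \<open>The value \<open>f w\<close> is attained at the preimage
  \<open>congr (mat_inv M) w\<close>, so the pullback cannot vanish identically.\<close>

lemma congr_generically_nonzero:
  assumes M: "M \<in> carrier_mat m m" "det M \<noteq> 0" and f: "f \<in> poly_fun s V" and w: "w \<in> V" "f w \<noteq> 0"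
  shows "generically s V (\<lambda>v. f (congr M v) \<noteq> 0)"
proof (rule regular_at_generically_nonzero)
  show "(\<lambda>v. f (congr M v)) \<in> regular_at s V (congr (mat_inv M) w)"
    by (rule poly_on_regular_at[OF poly_on_congr[OF M(1) f]])
  show "f (congr M (congr (mat_inv M) w)) \<noteq> 0" unfolding congr_cancel[OF M f w(1)] by (rule w(2))
qed (rule congr(1)[OF mat_inv(1)[OF M(1)]])

lemma generically_congr:
  assumes "generically s V P" and M: "M \<in> carrier_mat m m" "det M \<noteq> 0"
  shows "generically s V (\<lambda>v. P (congr M v))"
proof -
  obtain h w where h: "h \<in> poly_fun s V" "w \<in> V" "h w \<noteq> 0" "\<forall>v\<in>V. h v \<noteq> 0 \<longrightarrow> P v"
    using assms(1) unfolding generically_def by blast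
  show ?thesis
    by (rule generically_mono[OF congr_generically_nonzero[OF M h(1-3)]]) (use h(4) congr(1)[OF M(1)] in blast)
qed

text \<open>After clearing denominators both sides are polynomial, so a failure at one point would
  be a generic failure. This makes the identity available at every point of \<open>V\<close>, zeros
  of \<open>q\<close> included.\<close>

lemma congr_invariance:
  assumes M: "M \<in> carrier_mat m m" "det M \<noteq> 0"
    and p: "p \<in> poly_fun s V" and q: "q \<in> poly_fun s V" "w \<in> V" "q w \<noteq> 0"
    and inv: "generically s V (\<lambda>v. p v / q v = p (congr M v) / q (congr M v))"
    and v: "v \<in> V"
  shows "p (congr M v) * q v = p v * q (congr M v)"
proof (rule ccontr)
  assume neq: "\<not> ?thesis"
  define D where "D = (\<lambda>v. p (congr M v) * q v - p v * q (congr M v))"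
  have "D \<in> poly_on s V"
    unfolding D_def using fun_ring_poly_on[of s V] p q(1)
    by (intro fun_ring_diff fun_ring_mult poly_on_congr[OF M(1)]) (auto intro: poly_fun_poly_on)
  then have "generically s V (\<lambda>v. D v \<noteq> 0)"
    using neq v by (intro regular_at_generically_nonzero[of D s V v] poly_on_regular_at) (auto simp: D_def)
  moreover have "generically s V (\<lambda>v. q v \<noteq> 0)"
    using q unfolding generically_def by blast
  moreover note congr_generically_nonzero[OF M q] inv
  ultimately have "generically s V (\<lambda>v. D v \<noteq> 0 \<and> q v \<noteq> 0 \<and> q (congr M v) \<noteq> 0 \<and>
      p v / q v = p (congr M v) / q (congr M v))"
    by (intro generically_conj[OF vs sub])
  then obtain v where "D v \<noteq> 0" "q v \<noteq> 0" "q (congr M v) \<noteq> 0" "p v / q v = p (congr M v) / q (congr M v)"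
    by (rule generically_ex) blast
  then show False by (simp add: D_def field_simps)
qed

end

text \<open>Replaces the one word of length four that exceeds the bound \<open>2\<^sup>m - 1\<close> for \<open>m = 2\<close>.\<close>

lemma mtr_sandwich_2:
  fixes S X Y :: "complex mat"
  assumes "S \<in> carrier_mat 2 2" "X \<in> carrier_mat 2 2" "Y \<in> carrier_mat 2 2"
  shows "mtr (S * (X * Y * X)) = 1/2 * (mtr X * mtr X - mtr (X * X)) * mtr (S * Y)
    + mtr (S * X) * mtr (X * Y) + (mtr (S * (X * X)) - mtr X * mtr (S * X)) * mtr Y"
proof -
  have ent: "(A * B) $$ (i, j) = A $$ (i, 0) * B $$ (0, j) + A $$ (i, 1) * B $$ (1, j)"
    if "A \<in> carrier_mat 2 2" "B \<in> carrier_mat 2 2" "i < 2" "j < 2" for A B :: "complex mat" and i j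
    by (subst mult_mat_entry[OF that]) (simp add: numeral_2_eq_2 lessThan_Suc)
  have tr: "mtr A = A $$ (0, 0) + A $$ (1, 1)" if "A \<in> carrier_mat 2 2" for A :: "complex mat"
    using that by (simp add: mtr_def numeral_2_eq_2 lessThan_Suc)
  have pos: "(0::nat) < 2" "(1::nat) < 2" by auto
  note c = mult_carrier_mat[of _ 2 2 _ 2]
  show ?thesis
    by (simp only: tr ent c assms pos) (simp add: field_simps)
qed

text \<open>\<open>K\<close> will be the set of functions whose germ lies in the Procesi field, so
  that the core argument can work with functions. \<open>K_inv\<close> relies on
  \<open>inverse 0 = 0\<close> for functions that vanish generically.\<close>

locale procesi_core = matrix_coords +
  fixes K :: "('a \<Rightarrow> complex) set"
  assumes K_const: "(\<lambda>_. c) \<in> K"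
    and K_add: "f \<in> K \<Longrightarrow> g \<in> K \<Longrightarrow> (\<lambda>v. f v + g v) \<in> K"
    and K_mult: "f \<in> K \<Longrightarrow> g \<in> K \<Longrightarrow> (\<lambda>v. f v * g v) \<in> K"
    and K_inv: "f \<in> K \<Longrightarrow> (\<lambda>v. inverse (f v)) \<in> K"
    and K_cong: "f \<in> K \<Longrightarrow> generically s V (\<lambda>v. f v = g v) \<Longrightarrow> g \<in> K"
    and word_K: "I \<in> procesi_words N m \<Longrightarrow> (\<lambda>v. mtr (word v I)) \<in> K"
begin

lemma fun_ring_K: "fun_ring K"
  using K_const K_add K_mult by (simp add: fun_ring_def)

text \<open>Membership in \<open>K\<close> says nothing about zeros. Keeping regularity at a base
  point alongside lets a denominator be shown generically nonzero by its value at
  \<open>u\<close>.\<close>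

abbreviation regK :: "'a \<Rightarrow> ('a \<Rightarrow> complex) set"
  where "regK u \<equiv> K \<inter> regular_at s V u"

lemma fun_ring_regK: "fun_ring (regK u)"
  by (intro fun_ring_Int fun_ring_K fun_ring_regular_at)

lemma regK_inverse: "f \<in> regK u \<Longrightarrow> f u \<noteq> 0 \<Longrightarrow> u \<in> V \<Longrightarrow> (\<lambda>v. inverse (f v)) \<in> regK u"
  by (auto intro: K_inv regular_at_inverse)

lemma wspan_mtr:
  assumes "M \<in> wspan d" "d \<le> 2 ^ m - 1"
  shows "(\<lambda>v. mtr (M v)) \<in> K"
  using assms(1)
proof induction
  case (word I)
  then show ?case using assms(2) by (intro word_K) (auto simp: procesi_words_def)
next
  case (add M M')
  then show ?case
    using K_add[OF add.IH] by (simp add: mtr_add[OF wspan_carrier wspan_carrier])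
next
  case (smult M c)
  then show ?case
    using K_mult[OF K_const[of c] smult.IH] by (simp add: mtr_smult[OF wspan_carrier])
qed

lemma wspan_mtr_regK:
  assumes "M \<in> wspan d" "d \<le> 2 ^ m - 1" "u \<in> V" "det (Gm u) \<noteq> 0"
  shows "(\<lambda>v. mtr (M v)) \<in> regK u"
  using wspan_mtr[OF assms(1,2)] mat_in_mtr[OF fun_ring_regular_at regular_wspan[OF assms(3,4,1)]] by simp

text \<open>The exponent \<open>2 * m - 1\<close> occurs as j + k + 1 with j, k < m in
  \<open>skew_normal\<close>; \<open>tgram\<close> goes up to \<open>2 * m - 2\<close>.\<close>

lemma length_bound_linear: "2 * m - 1 \<le> 2 ^ m - 1"
proof -
  have "2 * n \<le> 2 ^ n" if "n \<ge> 1" for n :: nat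
    using that by (induction n rule: nat_induct_at_least) auto
  then show ?thesis using m_pos by (simp add: diff_le_mono)
qed

text \<open>\<open>3 * m - 2\<close> counts the letters of S^b X^j Y X^k with b = j = k = m - 1. For
  m = 2 this is 4, against a bound of 3.\<close>

lemma length_bound_three:
  assumes "m \<noteq> 2"
  shows "3 * m - 2 \<le> 2 ^ m - 1"
proof -
  have "3 * n \<le> 2 ^ n + 1" if "n \<ge> 3" for n :: nat
    using that by (induction n rule: nat_induct_at_least) auto
  moreover have "m = 1 \<or> m \<ge> 3" using assms m_pos by linarith
  ultimately show ?thesis by force
qed

text \<open>The dual letter is taken because its matrix is G^-1 K; it is the negative of
  A_1.\<close>

definition Xop :: "'a \<Rightarrow> complex mat" where "Xop v = letter v (1, True)"

text \<open>For l = 1 the form is G + K, so its operator is 1 + X: a combination of words of length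
  at most one, which counts as one letter in the length estimate.\<close>

definition Yop :: "nat \<Rightarrow> 'a \<Rightarrow> complex mat"
  where "Yop l v = (if l = 1 then 1\<^sub>m m + Xop v else letter v (l, True))"

lemma Xop_eq: "Xop v = mat_inv (Gm v) * Km v"
  by (simp add: Xop_def letter_def)

lemma Xop_carrier [simp]: "Xop v \<in> carrier_mat m m"
  by (simp add: Xop_def)

lemma Yop_carrier [simp]: "Yop l v \<in> carrier_mat m m"
  by (simp add: Yop_def)

lemma Xop_wspan: "Xop \<in> wspan 1"
  unfolding Xop_def[abs_def] using N_pos by (intro wspan_letter) simp

lemma Yop_wspan: "l \<in> {1..N} \<Longrightarrow> Yop l \<in> wspan 1"
  using wspan.add[OF wspan_one Xop_wspan] wspan_letter[of "(l, True)"]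
  by (cases "l = 1") (auto simp: Yop_def[abs_def])

lemma Yop_eq:
  assumes "det (Gm v) \<noteq> 0"
  shows "mat_inv (Gm v) * Bm v l = Yop l v"
proof (cases "l = 1")
  case True
  have "mat_inv (Gm v) * Bm v 1 = mat_inv (Gm v) * Gm v + mat_inv (Gm v) * Km v"
    unfolding Bm_1 by (rule mult_add_distrib_mat[OF mat_inv(1)[OF Gm_carrier] Gm_carrier Km_carrier])
  then show ?thesis using True mat_inv(3)[OF Gm_carrier assms] by (simp add: Yop_def Xop_eq)
qed (simp add: Yop_def letter_def)

text \<open>Solves the linear equation for the invariant; the point \<open>u\<close> certifies that
  neither \<open>b\<close> nor \<open>q\<close> vanishes identically.\<close>

lemma quotient_in_K:
  assumes a: "a \<in> K" and b: "b \<in> regK u" "b u \<noteq> 0" and u: "u \<in> V"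
    and q: "q \<in> poly_fun s V" "q u \<noteq> 0"
    and eq: "generically s V (\<lambda>v. p v * b v = a v * q v)"
  shows "(\<lambda>v. p v / q v) \<in> K"
proof (rule K_cong)
  show "(\<lambda>v. a v * inverse (b v)) \<in> K"
    using a b(1) by (intro K_mult K_inv) auto
  have "generically s V (\<lambda>v. b v \<noteq> 0)"
    using b u by (intro regular_at_generically_nonzero[of _ s V u]) auto
  moreover have "generically s V (\<lambda>v. q v \<noteq> 0)"
    using q u unfolding generically_def by blast
  ultimately have "generically s V (\<lambda>v. p v * b v = a v * q v \<and> b v \<noteq> 0 \<and> q v \<noteq> 0)"
    by (intro generically_conj[OF vs sub] eq)
  then show "generically s V (\<lambda>v. a v * inverse (b v) = p v / q v)"
    by (rule generically_mono) (auto simp: field_simps)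
qed

subsection \<open>A single form\<close>

definition cyclic_at :: "'a \<Rightarrow> bool"
  where "cyclic_at v \<longleftrightarrow> v \<in> V \<and> det (Gm v) \<noteq> 0 \<and> det (tgram m (Xop v)) \<noteq> 0"

text \<open>The entries \<open>g(X\<^sup>j e, (1 + X) X\<^sup>k e)\<close> of \<open>B\<^sub>1\<close> in the frame of the vector of \<open>skew_trace_vector\<close>\<close>

definition skew_normal :: "'a \<Rightarrow> complex mat"
  where "skew_normal v = mat m m (\<lambda>(j, k). (-1) ^ k * (mtr (Xop v ^\<^sub>m (j + k)) - mtr (Xop v ^\<^sub>m (j + k + 1))))"

lemma mtr_power_regK:
  assumes "M \<in> wspan 1" "u \<in> V" "det (Gm u) \<noteq> 0" "k \<le> 2 * m - 1"
  shows "(\<lambda>v. mtr (M v ^\<^sub>m k)) \<in> regK u"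
  using assms length_bound_linear by (intro wspan_mtr_regK[OF wspan_power]) auto

lemma regK_tgram:
  assumes "M \<in> wspan 1" "u \<in> V" "det (Gm u) \<noteq> 0"
  shows "mat_in (regK u) m (\<lambda>v. tgram m (M v))"
  by (rule mat_in_tgram[OF fun_ring_regK mtr_power_regK[OF assms]]) simp

lemma tgram_generic:
  assumes M: "M \<in> wspan 1" and w: "w \<in> V" "det (Gm w) \<noteq> 0" "det (tgram m (M w)) \<noteq> 0"
  shows "generically s V (\<lambda>v. det (Gm v) \<noteq> 0 \<and> det (tgram m (M v)) \<noteq> 0)"
proof (rule generically_conj[OF vs sub nondegenerate_generic])
  show "generically s V (\<lambda>v. det (tgram m (M v)) \<noteq> 0)"
    using mat_in_det[OF fun_ring_regK regK_tgram[OF M w(1,2)]]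
    by (intro regular_at_generically_nonzero[where f = "\<lambda>v. det (tgram m (M v))", OF _ w(3,1)]) blast
qed

lemma regK_skew_normal:
  assumes u: "u \<in> V" "det (Gm u) \<noteq> 0"
  shows "mat_in (regK u) m skew_normal"
proof (rule mat_inI)
  fix j k assume jk: "j < m" "k < m"
  then have "(\<lambda>v. (-1) ^ k * (mtr (Xop v ^\<^sub>m (j + k)) - mtr (Xop v ^\<^sub>m (j + k + 1)))) \<in> regK u"
    by (intro fun_ring_mult[OF fun_ring_regK] fun_ring_diff[OF fun_ring_regK] mtr_power_regK[OF Xop_wspan u]
        fun_ring_const[OF fun_ring_regK]) auto
  then show "(\<lambda>v. skew_normal v $$ (j, k)) \<in> regK u"
    using jk by (simp add: skew_normal_def)
qed (simp add: skew_normal_def)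

text \<open>Moving X^j across the form leaves (-1)^j g(e, (1 + X) X^(j+k) e), and the trace vector
  turns both terms into signed traces. So the result depends on \<open>v\<close> through traces
  alone, although \<open>M\<close> involves eigenvectors and square roots.\<close>

lemma skew_normal:
  assumes v: "cyclic_at v"
  obtains M where "M \<in> carrier_mat m m" "det M \<noteq> 0" "M\<^sup>T * Bm v 1 * M = skew_normal v"
proof -
  let ?X = "Xop v"
  have G: "Gm v \<in> carrier_mat m m" "(Gm v)\<^sup>T = Gm v" "det (Gm v) \<noteq> 0" and tg: "det (tgram m ?X) \<noteq> 0"
    using v Gm_sym by (auto simp: cyclic_at_def)
  have Kc: "Km v \<in> carrier_mat m m" "(Km v)\<^sup>T = - Km v" using Km_skew by auto
  obtain e where e: "e \<in> carrier_vec m" "\<And>k. e \<bullet> ((Gm v * ?X ^\<^sub>m k) *\<^sub>v e) = (-1) ^ k * mtr (?X ^\<^sub>m k)"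
    using skew_trace_vector[OF G Kc] tg unfolding Xop_eq by blast
  let ?M = "frame m ?X e"
  have Xk: "?X ^\<^sub>m k \<in> carrier_mat m m" for k by (simp add: pow_carrier_mat)
  have GX: "Gm v * ?X ^\<^sub>m k \<in> carrier_mat m m" for k
    using Xk by (simp add: mult_carrier_mat[of _ m m])
  have XX: "?X ^\<^sub>m j * ?X ^\<^sub>m k = ?X ^\<^sub>m (j + k)" for j k
    by (rule pow_mat_plus[OF Xop_carrier, symmetric])
  have entry: "(?M\<^sup>T * B * ?M) $$ (j, k) =
      (-1) ^ j * (e \<bullet> ((Gm v * (?X ^\<^sub>m j * (mat_inv (Gm v) * B) * ?X ^\<^sub>m k)) *\<^sub>v e))"
    if "B \<in> carrier_mat m m" "j < m" "k < m" for B j k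
    using frame_form_entry[OF G Kc that(1) e(1) that(2,3)] unfolding Xop_eq .
  have "?M\<^sup>T * Bm v 1 * ?M = skew_normal v"
  proof (rule eq_matI)
    fix j k assume "j < dim_row (skew_normal v)" "k < dim_col (skew_normal v)"
    then have jk: "j < m" "k < m" by (auto simp: skew_normal_def)
    have "Gm v * (?X ^\<^sub>m j * (mat_inv (Gm v) * Bm v 1) * ?X ^\<^sub>m k)
        = Gm v * (?X ^\<^sub>m (j + k) + ?X ^\<^sub>m (j + k + 1))"
    proof -
      have "?X ^\<^sub>m j * (1\<^sub>m m + ?X) * ?X ^\<^sub>m k = ?X ^\<^sub>m j * ?X ^\<^sub>m k + ?X ^\<^sub>m (j + 1) * ?X ^\<^sub>m k"
        using mult_add_distrib_mat[OF Xk one_carrier_mat Xop_carrier, of j v]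
          add_mult_distrib_mat[OF Xk Xk Xk, of j "j + 1" k] right_mult_one_mat[OF Xk] by simp
      then show ?thesis
        using Yop_eq[OF G(3), of 1] unfolding XX by (simp add: Yop_def)
    qed
    also have "\<dots> = Gm v * ?X ^\<^sub>m (j + k) + Gm v * ?X ^\<^sub>m (j + k + 1)"
      by (rule mult_add_distrib_mat[OF G(1) Xk Xk])
    finally have "(?M\<^sup>T * Bm v 1 * ?M) $$ (j, k) = (-1) ^ j *
        (e \<bullet> ((Gm v * ?X ^\<^sub>m (j + k)) *\<^sub>v e + (Gm v * ?X ^\<^sub>m (j + k + 1)) *\<^sub>v e))"
      using entry[OF Bm_carrier jk] by (simp only: add_mult_distrib_mat_vec[OF GX GX e(1)])
    also have "\<dots> = (-1) ^ j * ((-1) ^ (j + k) * mtr (?X ^\<^sub>m (j + k)) + (-1) ^ (j + k + 1) * mtr (?X ^\<^sub>m (j + k + 1)))"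
      using e GX by (subst scalar_prod_add_distrib[of _ m]) (auto simp: mult_mat_vec_carrier[OF GX e(1)] simp del: pow_mat.simps)
    also have "\<dots> = skew_normal v $$ (j, k)"
      using jk by (simp add: skew_normal_def algebra_simps power_add flip: power_mult_distrib)
    finally show "(?M\<^sup>T * Bm v 1 * ?M) $$ (j, k) = skew_normal v $$ (j, k)" .
  qed (auto simp: skew_normal_def carrier_matD[OF frame_carrier])
  \<comment> \<open>The Gram matrix of the frame is the trace Gram matrix up to column signs, so a
    simple spectrum of \<open>X\<close> makes the frame a basis.\<close>
  moreover have "det ?M \<noteq> 0"
  proof -
    have "?M\<^sup>T * Gm v * ?M = tgram m ?X * dmat m (\<lambda>k. (-1) ^ k)"
    proof (rule eq_matI)
      fix j k assume "j < dim_row (tgram m ?X * dmat m (\<lambda>k. (-1) ^ k))"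
        "k < dim_col (tgram m ?X * dmat m (\<lambda>k. (-1) ^ k))"
      then have jk: "j < m" "k < m" by (auto simp: tgram_def dmat_def)
      have "?X ^\<^sub>m j * (mat_inv (Gm v) * Gm v) * ?X ^\<^sub>m k = ?X ^\<^sub>m (j + k)"
        using mat_inv(3)[OF G(1,3)] XX right_mult_one_mat[OF Xk] by simp
      then have "(?M\<^sup>T * Gm v * ?M) $$ (j, k) = (-1) ^ j * ((-1) ^ (j + k) * mtr (?X ^\<^sub>m (j + k)))"
        using entry[OF G(1) jk] e(2) by simp
      also have "\<dots> = (tgram m ?X * dmat m (\<lambda>k. (-1) ^ k)) $$ (j, k)"
        unfolding mult_dmat_entry[OF tgram_carrier jk]
        using jk by (simp add: tgram_def power_add flip: power_mult_distrib)
      finally show "(?M\<^sup>T * Gm v * ?M) $$ (j, k) = (tgram m ?X * dmat m (\<lambda>k. (-1) ^ k)) $$ (j, k)" .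
    qed (auto simp: dmat_def tgram_def carrier_matD[OF frame_carrier])
    moreover have "det (dmat m (\<lambda>k. (-1) ^ k :: complex)) \<noteq> 0"
    proof -
      have "dmat m (\<lambda>k. (-1) ^ k :: complex) * dmat m (\<lambda>k. (-1) ^ k) = 1\<^sub>m m"
        unfolding dmat_mult by (intro eq_matI) (auto simp: dmat_def simp flip: power_mult_distrib)
      then show ?thesis using det_nonzero_if_inverse[OF dmat_carrier dmat_carrier] by blast
    qed
    ultimately have "det ?M ^ 2 * det (Gm v) \<noteq> 0"
      using det_congruence[OF frame_carrier G(1), of ?X e] tg
        det_mult[OF tgram_carrier dmat_carrier, of m ?X "\<lambda>k. (-1) ^ k"] by (metis mult_eq_0_iff)
    then show ?thesis by auto
  qed
  ultimately show thesis using that[OF frame_carrier] by blast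
qed

lemma single_form_invariant:
  assumes N1: "N = 1" and w: "cyclic_at w"
    and p: "p \<in> poly_fun s V" and q: "q \<in> poly_fun s V" "q w' \<noteq> 0" "w' \<in> V"
    and inv: "\<And>M v. M \<in> carrier_mat m m \<Longrightarrow> det M \<noteq> 0 \<Longrightarrow> v \<in> V \<Longrightarrow> p (congr M v) * q v = p v * q (congr M v)"
  shows "(\<lambda>v. p v / q v) \<in> K"
proof -
  have cyc: "generically s V cyclic_at"
    by (rule generically_mono[OF tgram_generic[OF Xop_wspan, of w]]) (use w in \<open>auto simp: cyclic_at_def\<close>)
  moreover have "generically s V (\<lambda>v. q v \<noteq> 0)"
    using q unfolding generically_def by blast
  ultimately obtain u where u: "u \<in> V" "cyclic_at u" "q u \<noteq> 0"
    using generically_ex[OF generically_conj[OF vs sub]] by blast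
  obtain M0 where M0: "M0 \<in> carrier_mat m m" "det M0 \<noteq> 0" "M0\<^sup>T * Bm u 1 * M0 = skew_normal u"
    using skew_normal[OF u(2)] .
  \<comment> \<open>\<open>C\<close> undoes the frame at \<open>u\<close>: then
    \<open>\<tau> u\<close> has the coordinates of \<open>u\<close> and
    \<open>q (\<tau> u) = q u \<noteq> 0\<close>, whereas \<open>q\<close> could vanish on every
    untwisted normal form.\<close>
  define C where "C = mat_inv M0"
  have C: "C \<in> carrier_mat m m" "M0 * C = 1\<^sub>m m"
    using mat_inv[OF M0(1)] M0(2) by (simp_all add: C_def)
  define \<tau> where "\<tau> = (\<lambda>v. mk (\<lambda>l. C\<^sup>T * skew_normal v * C))"
  have c: "C\<^sup>T * skew_normal v * C \<in> carrier_mat m m" for v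
    using C by (auto simp: skew_normal_def intro!: mult_carrier_mat[of _ m m])
  have \<tau>V: "\<tau> v \<in> V" for v unfolding \<tau>_def by (rule mk_in) (rule c)
  have \<tau>B: "Bm (\<tau> v) l = C\<^sup>T * skew_normal v * C" if "l \<in> {1..N}" for v l
    unfolding \<tau>_def using that by (rule Bm_mk[OF c])
  have u': "det (Gm u) \<noteq> 0" using u by (simp add: cyclic_at_def)
  have comp: "(\<lambda>v. f (\<tau> v)) \<in> regK u" if "f \<in> poly_fun s V" for f
    using that C(1) by (intro poly_fun_comp[OF fun_ring_regK \<tau>V])
      (auto simp: \<tau>B intro!: mat_in_mult[OF fun_ring_regK] mat_in_const[OF fun_ring_regK] regK_skew_normal[OF u(1) u'])
  have \<tau>_congr: "f (\<tau> v) = f (congr (M * C) v)"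
    if M: "M \<in> carrier_mat m m" "M\<^sup>T * Bm v 1 * M = skew_normal v" and f: "f \<in> poly_fun s V" for M v f
  proof (rule poly_fun_eqI[OF \<tau>V _ _ f])
    have MC: "M * C \<in> carrier_mat m m" using M C by simp
    show "congr (M * C) v \<in> V" by (rule congr(1)[OF MC])
    fix l assume l: "l \<in> {1..N}"
    then have "l = 1" using N1 by auto
    then show "Bm (\<tau> v) l = Bm (congr (M * C) v) l"
      unfolding \<tau>B[OF l] congr(2)[OF MC l] M(2)[symmetric]
      using M(1) C(1) Bm_carrier[of v 1]
      by (simp add: transpose_mult[of _ m m _ m] square_mult[where n = m])
  qed
  show ?thesis
  proof (rule quotient_in_K[of "\<lambda>v. p (\<tau> v)" "\<lambda>v. q (\<tau> v)" u])
    show "q (\<tau> u) \<noteq> 0"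
      unfolding \<tau>_congr[OF M0(1,3) q(1)] C(2) congr_one[OF q(1) u(1)] by (rule u(3))
    show "generically s V (\<lambda>v. p v * q (\<tau> v) = p (\<tau> v) * q v)"
    proof (rule generically_mono[OF cyc])
      fix v assume v: "v \<in> V" "cyclic_at v"
      obtain M where M: "M \<in> carrier_mat m m" "det M \<noteq> 0" "M\<^sup>T * Bm v 1 * M = skew_normal v"
        using skew_normal[OF v(2)] .
      have "det (M * C) \<noteq> 0"
        using M C det_mult[OF M(1) C(1)] det_nonzero_if_inverse(2)[OF M0(1) C] by simp
      then show "p v * q (\<tau> v) = p (\<tau> v) * q v"
        using inv[of "M * C" v] M C(1) v by (simp add: \<tau>_congr[OF M(1,3)] p q)
    qed
  qed (use comp p q u in auto)
qed

end

text \<open>The sums are the entries of V^T y, and V is invertible. This picks the exponent for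
  which a denominator survives the summation over the eigenvalues.\<close>

lemma power_sum_nonzero:
  fixes x y :: "nat \<Rightarrow> 'a::field"
  assumes V: "det (vmat n x) \<noteq> 0" and i: "i < n" "y i \<noteq> 0"
  obtains l where "(\<Sum>i<n. x i ^ l * y i) \<noteq> 0"
proof (rule ccontr)
  assume "\<not> thesis"
  then have z: "(\<Sum>i<n. x i ^ l * y i) = 0" for l using that by blast
  have "(vmat n x)\<^sup>T *\<^sub>v vec n y = 0\<^sub>v n"
    using z by (intro eq_vecI) (auto simp: vmat_def scalar_prod_def atLeast0LessThan)
  moreover have "vec n y \<noteq> 0\<^sub>v n" using i by (metis index_vec index_zero_vec(1))
  moreover have "det (vmat n x)\<^sup>T \<noteq> 0" using V by (simp add: det_transpose[of _ n])
  ultimately show False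
    using det_0_iff_vec_prod_zero_field[of "(vmat n x)\<^sup>T" n] vec_carrier[of n y]
    by (metis transpose_carrier_mat vmat_carrier)
qed

context procesi_core
begin

subsection \<open>Several forms\<close>

definition Sop :: "'a \<Rightarrow> complex mat"
  where "Sop v = (1/2) \<cdot>\<^sub>m (letter v (2, True) + letter v (2, False))"

definition eig_at :: "'a \<Rightarrow> bool"
  where "eig_at v \<longleftrightarrow> v \<in> V \<and> det (Gm v) \<noteq> 0 \<and> det (tgram m (Sop v)) \<noteq> 0"

text \<open>A predicate, not a chosen basis: eigenvectors do not depend rationally on
  \<open>v\<close>, and the functions built from them below agree for all choices.\<close>

definition eigenbasis_at :: "'a \<Rightarrow> complex mat \<Rightarrow> (nat \<Rightarrow> complex) \<Rightarrow> bool"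
  where "eigenbasis_at v P x \<longleftrightarrow> P \<in> carrier_mat m m \<and> P\<^sup>T * Gm v * P = 1\<^sub>m m \<and>
    Sop v * P = P * dmat m x \<and> det (vmat m x) \<noteq> 0"

lemma Sop_carrier [simp]: "Sop v \<in> carrier_mat m m"
  by (simp add: Sop_def)

lemma Sop_eq: "Sop v = mat_inv (Gm v) * ((1/2) \<cdot>\<^sub>m (Bm v 2 + (Bm v 2)\<^sup>T))"
proof -
  note inv = mat_inv(1)[OF Gm_carrier[of v]]
  have B: "Bm v 2 \<in> carrier_mat m m" "(Bm v 2)\<^sup>T \<in> carrier_mat m m" by simp_all
  show ?thesis
    using mult_smult_distrib[OF inv add_carrier_mat[OF B(2), of "Bm v 2"], of "1/2"]
      mult_add_distrib_mat[OF inv B] by (simp add: Sop_def letter_def)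
qed

lemma eigenbasis_exists:
  assumes "eig_at v"
  obtains P x where "eigenbasis_at v P x"
proof -
  let ?H = "(1/2) \<cdot>\<^sub>m (Bm v 2 + (Bm v 2)\<^sup>T)"
  have H: "?H \<in> carrier_mat m m" "?H\<^sup>T = ?H"
    using carrier_matD[OF Bm_carrier[of v 2]] by (auto intro!: eq_matI simp: add.commute)
  show thesis
    using selfadjoint_eigenbasis[OF Gm_carrier Gm_sym _ H, of v] assms that
    unfolding eig_at_def eigenbasis_at_def Sop_eq by metis
qed

lemma eigenbasis_det:
  assumes "eigenbasis_at v P x"
  shows "det P \<noteq> 0"
proof -
  have "det P ^ 2 * det (Gm v) = 1"
    using assms det_congruence[of P m "Gm v"] by (simp add: eigenbasis_at_def)
  then show ?thesis by auto
qed

lemma mtr_Sop_sum: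
  assumes "eigenbasis_at v P x"
  shows "mtr (Sop v ^\<^sub>m d) = (\<Sum>i<m. x i ^ d)"
  using assms eigenbasis_det[OF assms] by (intro mtr_power_eq_sum[of _ _ P]) (auto simp: eigenbasis_at_def)

end

locale procesi_core2 = procesi_core +
  assumes N2: "N \<ge> 2"
begin

lemma Sop_wspan: "Sop \<in> wspan 1"
  unfolding Sop_def[abs_def] using N2 by (intro wspan.smult wspan.add wspan_letter) auto

lemma mtr_sandwich_K:
  assumes Y: "Y \<in> wspan 1" and bjk: "b < m" "j < m" "k < m"
  shows "(\<lambda>v. mtr (Sop v ^\<^sub>m b * (Xop v ^\<^sub>m j * Y v * Xop v ^\<^sub>m k))) \<in> K"
proof (cases "b + (j + 1 + k) \<le> 2 ^ m - 1")
  case True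
  show ?thesis
    by (rule wspan_mtr[OF wspan_mult[OF wspan_power[OF Sop_wspan] wspan_mult[OF wspan_mult[OF
      wspan_power[OF Xop_wspan] Y] wspan_power[OF Xop_wspan]]] True])
next
  case False
  then have "m = 2" using length_bound_three bjk by linarith
  \<comment> \<open>For \<open>m = 2\<close> every exponent is at most 1, so a length above 3 forces
    all of them to be 1: the word is S X Y X.\<close>
  then have 1: "b = 1" "j = 1" "k = 1" and m3: "2 ^ m - 1 = (3::nat)" using False bjk by auto
  note S = Sop_wspan and X = Xop_wspan
  have tr: "(\<lambda>v. mtr (M v)) \<in> K" if "M \<in> wspan d" "d \<le> 3" for M d
    using wspan_mtr[of M d] that m3 by simp
  have "(\<lambda>v. 1/2 * (mtr (Xop v) * mtr (Xop v) - mtr (Xop v * Xop v)) * mtr (Sop v * Y v)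
    + mtr (Sop v * Xop v) * mtr (Xop v * Y v)
    + (mtr (Sop v * (Xop v * Xop v)) - mtr (Xop v) * mtr (Sop v * Xop v)) * mtr (Y v)) \<in> K"
    by (intro fun_ring_add[OF fun_ring_K] fun_ring_mult[OF fun_ring_K] fun_ring_diff[OF fun_ring_K]
        fun_ring_const[OF fun_ring_K] tr[OF X] tr[OF Y] tr[OF wspan_mult[OF X X]] tr[OF wspan_mult[OF S X]]
        tr[OF wspan_mult[OF S Y]] tr[OF wspan_mult[OF X Y]] tr[OF wspan_mult[OF S wspan_mult[OF X X]]]) simp_all
  moreover have "Sop v ^\<^sub>m 1 = Sop v" "Xop v ^\<^sub>m 1 = Xop v" for v
    using Sop_carrier[of v] Xop_carrier[of v] by auto
  moreover have "M v \<in> carrier_mat 2 2" if "M \<in> wspan 1" for M v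
    using wspan_carrier[OF that] \<open>m = 2\<close> by simp
  ultimately show ?thesis
    unfolding 1 using S X Y by (simp add: mtr_sandwich_2)
qed

text \<open>Regularity holds for words of any length; only membership in \<open>K\<close> is tied to
  the length bound, and it is supplied separately.\<close>

lemma regK_entry:
  assumes "f \<in> K" "M \<in> wspan d" "u \<in> V" "det (Gm u) \<noteq> 0" "f = (\<lambda>v. mtr (M v))"
  shows "f \<in> regK u"
  using assms mat_in_mtr[OF fun_ring_regular_at regular_wspan[OF assms(3,4,2)]] by simp

lemma mtr_sandwich_regK:
  assumes Y: "Y \<in> wspan 1" and bjk: "b < m" "j < m" "k < m" and u: "u \<in> V" "det (Gm u) \<noteq> 0"
  shows "(\<lambda>v. mtr (Sop v ^\<^sub>m b * (Xop v ^\<^sub>m j * Y v * Xop v ^\<^sub>m k))) \<in> regK u"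
  by (rule regK_entry[OF mtr_sandwich_K[OF Y bjk] wspan_mult[OF wspan_power[OF Sop_wspan]
      wspan_mult[OF wspan_mult[OF wspan_power[OF Xop_wspan] Y] wspan_power[OF Xop_wspan]]] u refl])

lemma regK_tgram_inv:
  assumes u: "eig_at u"
  shows "mat_in (regK u) m (\<lambda>v. mat_inv (tgram m (Sop v)))"
proof (rule mat_in_inv[OF fun_ring_regK regK_tgram[OF Sop_wspan]])
  show "(\<lambda>v. inverse (det (tgram m (Sop v)))) \<in> regK u"
    using u by (intro regK_inverse[of "\<lambda>v. det (tgram m (Sop v))"] mat_in_det[OF fun_ring_regK regK_tgram[OF Sop_wspan]])
      (auto simp: eig_at_def)
qed (use u in \<open>auto simp: eig_at_def\<close>)

lemma eig_at_generic:
  assumes w: "eig_at w"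
  shows "generically s V eig_at"
  by (rule generically_mono[OF tgram_generic[OF Sop_wspan, of w]]) (use w in \<open>auto simp: eig_at_def\<close>)

text \<open>All exponents are needed, since the degree in the eigenvalue of the functions to be
  summed has no fixed bound. Beyond \<open>2 * m - 1\<close> the trace recursion leads back to
  smaller exponents.\<close>

lemma mtr_Sop_regK:
  assumes u: "eig_at u"
  shows "(\<lambda>v. mtr (Sop v ^\<^sub>m d)) \<in> regK u"
proof (induction d rule: less_induct)
  case (less d)
  have u': "u \<in> V" "det (Gm u) \<noteq> 0" using u by (auto simp: eig_at_def)
  show ?case
  proof (cases "d \<le> 2 * m - 1")
    case True
    then show ?thesis by (rule mtr_power_regK[OF Sop_wspan u'])
  next
    case False
    \<comment> \<open>\<open>e + b\<close> and \<open>m + c\<close> with b, c < m are both below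
      \<open>d\<close>, the second because \<open>d\<close> is at least
      \<open>2 * m\<close>.\<close>
    define e where "e = d - m"
    have d: "d = e + m" "m \<le> e" using False m_pos by (auto simp: e_def)
    let ?T = "\<lambda>v. mat_inv (tgram m (Sop v))"
    have "(\<lambda>v. \<Sum>b<m. \<Sum>c<m. ?T v $$ (b, c) * mtr (Sop v ^\<^sub>m (m + c)) * mtr (Sop v ^\<^sub>m (e + b))) \<in> regK u"
      using d by (intro fun_ring_sum[OF fun_ring_regK] fun_ring_mult[OF fun_ring_regK] less
          mat_in_entry[OF regK_tgram_inv[OF u]]) auto
    then have "(\<lambda>v. \<Sum>b<m. \<Sum>c<m. ?T v $$ (b, c) * mtr (Sop v ^\<^sub>m (m + c)) * mtr (Sop v ^\<^sub>m (e + b))) \<in> K"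
      by blast
    moreover have "generically s V (\<lambda>v. (\<Sum>b<m. \<Sum>c<m. ?T v $$ (b, c) * mtr (Sop v ^\<^sub>m (m + c)) *
        mtr (Sop v ^\<^sub>m (e + b))) = mtr (Sop v ^\<^sub>m d))"
    proof (rule generically_mono[OF eig_at_generic[OF u]])
      fix v assume "eig_at v"
      then obtain P x where P: "eigenbasis_at v P x" by (rule eigenbasis_exists)
      then show "(\<Sum>b<m. \<Sum>c<m. ?T v $$ (b, c) * mtr (Sop v ^\<^sub>m (m + c)) * mtr (Sop v ^\<^sub>m (e + b)))
          = mtr (Sop v ^\<^sub>m d)"
        unfolding d(1) using mtr_power_recursion[OF Sop_carrier _ eigenbasis_det[OF P]]
        by (auto simp: eigenbasis_at_def)
    qed
    ultimately have "(\<lambda>v. mtr (Sop v ^\<^sub>m d)) \<in> K" by (rule K_cong)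
    then show ?thesis by (rule regK_entry[OF _ wspan_power[OF Sop_wspan] u' refl])
  qed
qed

text \<open>\<open>eigenvector_entry\<close> with the eigenvalue turned into a variable
  \<open>x\<close>; the sign is that of \<open>frame_form_entry\<close>. It represents a form in a
  frame only where \<open>x\<close> is an eigenvalue, but is polynomial in \<open>x\<close>
  throughout.\<close>

definition eig_form :: "nat \<Rightarrow> 'a \<times> complex \<Rightarrow> complex mat"
  where "eig_form l = (\<lambda>(v, x). mat m m (\<lambda>(j, k). \<Sum>b<m. \<Sum>c<m. mat_inv (tgram m (Sop v)) $$ (b, c) * x ^ c *
    ((-1) ^ j * mtr (Sop v ^\<^sub>m b * (Xop v ^\<^sub>m j * Yop l v * Xop v ^\<^sub>m k)))))"

lemma poly_ext_eig_form:
  assumes u: "eig_at u" and l: "l \<in> {1..N}"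
  shows "mat_in (poly_ext (regK u)) m (eig_form l)"
proof (rule mat_inI)
  show "eig_form l y \<in> carrier_mat m m" for y by (cases y) (simp add: eig_form_def)
next
  fix j k assume jk: "j < m" "k < m"
  have u': "u \<in> V" "det (Gm u) \<noteq> 0" using u by (auto simp: eig_at_def)
  note R = fun_ring_regK[of u]
  note E = fun_ring_poly_ext[OF R]
  have pow: "(\<lambda>(v, x). x ^ c) \<in> poly_ext (regK u)" for c
  proof (induction c)
    case 0
    then show ?case using fun_ring_const[OF E, of 1] by (simp add: case_prod_unfold)
  next
    case (Suc c)
    then show ?case using fun_ring_mult[OF E poly_ext_var[OF R] Suc] by (simp add: case_prod_unfold)
  qed
  have "(\<lambda>y. \<Sum>b<m. \<Sum>c<m. (\<lambda>(v, x). mat_inv (tgram m (Sop v)) $$ (b, c)) y * (\<lambda>(v, x). x ^ c) y *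
      (\<lambda>(v, x). (-1) ^ j * mtr (Sop v ^\<^sub>m b * (Xop v ^\<^sub>m j * Yop l v * Xop v ^\<^sub>m k))) y) \<in> poly_ext (regK u)"
    using jk by (intro fun_ring_sum[OF E] fun_ring_mult[OF E] pow poly_ext_base[OF R] fun_ring_mult[OF R]
        fun_ring_const[OF R] mtr_sandwich_regK Yop_wspan l u' mat_in_entry[OF regK_tgram_inv[OF u]]) auto
  then show "(\<lambda>y. eig_form l y $$ (j, k)) \<in> poly_ext (regK u)"
    using jk by (simp add: eig_form_def case_prod_unfold)
qed

text \<open>The normalization P^T G P = 1 makes P^T G the inverse of \<open>P\<close>; hence g(e, Z
  e) for a column \<open>e\<close> of \<open>P\<close> is a diagonal entry of P^-1 Z P, and
  \<open>eigenvector_entry\<close> applies.\<close>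

lemma frame_eig_form:
  assumes v: "eig_at v" and P: "eigenbasis_at v P x" and i: "i < m"
  shows "(frame m (Xop v) (col P i))\<^sup>T * Bm v l * frame m (Xop v) (col P i) = eig_form l (v, x i)"
    (is "?M\<^sup>T * _ * ?M = _")
proof (rule eq_matI)
  have G: "Gm v \<in> carrier_mat m m" "(Gm v)\<^sup>T = Gm v" "det (Gm v) \<noteq> 0"
    using v Gm_sym by (auto simp: eig_at_def)
  have Kc: "Km v \<in> carrier_mat m m" "(Km v)\<^sup>T = - Km v" using Km_skew by auto
  have Pc: "P \<in> carrier_mat m m" "det P \<noteq> 0" "Sop v * P = P * dmat m x" "det (vmat m x) \<noteq> 0"
      "P\<^sup>T * Gm v * P = 1\<^sub>m m"
    using P eigenbasis_det[OF P] by (auto simp: eigenbasis_at_def)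
  have "P\<^sup>T * Gm v = mat_inv P"
  proof (rule mat_mult_right_cancel[OF _ _ Pc(1,2)])
    show "P\<^sup>T * Gm v \<in> carrier_mat m m" using Pc(1) by (simp add: mult_carrier_mat[of _ m m])
    show "P\<^sup>T * Gm v * P = mat_inv P * P" using Pc mat_inv(3)[OF Pc(1,2)] by simp
  qed (rule mat_inv(1)[OF Pc(1)])
  then have Pinv: "P\<^sup>T * (Gm v * Z) * P = mat_inv P * Z * P" if "Z \<in> carrier_mat m m" for Z
  proof -
    have "P\<^sup>T * (Gm v * Z) = P\<^sup>T * Gm v * Z"
      using Pc(1) that by (simp add: assoc_mult_mat[of _ m m _ m _ m])
    then show ?thesis by (simp only: \<open>P\<^sup>T * Gm v = mat_inv P\<close>)
  qed
  fix j k assume "j < dim_row (eig_form l (v, x i))" "k < dim_col (eig_form l (v, x i))"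
  then have jk: "j < m" "k < m" by (auto simp: eig_form_def)
  define Z where "Z = Xop v ^\<^sub>m j * Yop l v * Xop v ^\<^sub>m k"
  have Z: "Z \<in> carrier_mat m m"
    by (simp add: Z_def mult_carrier_mat[of _ m m] pow_carrier_mat)
  have "(?M\<^sup>T * Bm v l * ?M) $$ (j, k) = (-1) ^ j * (col P i \<bullet> ((Gm v * Z) *\<^sub>v col P i))"
    using frame_form_entry[OF G Kc Bm_carrier[of v l] _ jk, of "col P i"] Pc(1)
    unfolding Xop_eq[symmetric] Yop_eq[OF G(3)] Z_def by auto
  also have "col P i \<bullet> ((Gm v * Z) *\<^sub>v col P i) = (P\<^sup>T * (Gm v * Z) * P) $$ (i, i)"
    using Z by (intro congruence_entry[OF Pc(1) _ i i, symmetric]) (simp add: mult_carrier_mat[of _ m m])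
  also have "\<dots> = (\<Sum>b<m. \<Sum>c<m. mat_inv (tgram m (Sop v)) $$ (b, c) * x i ^ c * mtr (Sop v ^\<^sub>m b * Z))"
    unfolding Pinv[OF Z] by (rule eigenvector_entry[OF Sop_carrier Pc(1-4) Z i])
  finally show "(?M\<^sup>T * Bm v l * ?M) $$ (j, k) = eig_form l (v, x i) $$ (j, k)"
    using jk by (simp add: eig_form_def Z_def sum_distrib_left mult_ac)
qed (auto simp: eig_form_def carrier_matD[OF frame_carrier])

text \<open>Inserting \<open>eig_form\<close> into \<open>f\<close> gives a polynomial in the
  eigenvalue over \<open>regK u\<close>, whose power-weighted sum descends. The matrix
  \<open>C\<close> is left free so that the frames can be normalized at \<open>u\<close>.\<close>

lemma eig_transform:
  assumes u: "eig_at u" and f: "f \<in> poly_fun s V" and C: "C \<in> carrier_mat m m"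
  obtains b where "b \<in> regK u"
    "\<And>v P x. eig_at v \<Longrightarrow> eigenbasis_at v P x \<Longrightarrow>
      b v = (\<Sum>i<m. x i ^ l * f (congr (frame m (Xop v) (col P i) * C) v))"
proof -
  define \<tau> where "\<tau> = (\<lambda>y. mk (\<lambda>l. C\<^sup>T * eig_form l y * C))"
  have c: "C\<^sup>T * eig_form l y * C \<in> carrier_mat m m" for l y
    using C by (cases y) (auto simp: eig_form_def intro!: mult_carrier_mat[of _ m m])
  have \<tau>V: "\<tau> y \<in> V" for y unfolding \<tau>_def by (rule mk_in) (rule c)
  have \<tau>B: "Bm (\<tau> y) l = C\<^sup>T * eig_form l y * C" if "l \<in> {1..N}" for y l
    unfolding \<tau>_def using that by (rule Bm_mk[OF c])
  note E = fun_ring_poly_ext[OF fun_ring_regK[of u]]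
  have "(\<lambda>y. f (\<tau> y)) \<in> poly_ext (regK u)"
    by (rule poly_fun_comp[OF E \<tau>V _ f])
      (auto simp: \<tau>B intro!: mat_in_mult[OF E] mat_in_const[OF E] poly_ext_eig_form[OF u] C)
  then obtain b where b: "b \<in> regK u"
    "\<And>v n x. (\<And>d. mtr (Sop v ^\<^sub>m d) = (\<Sum>i<n. x i ^ d)) \<Longrightarrow> b v = (\<Sum>i<n::nat. x i ^ l * f (\<tau> (v, x i)))"
    using poly_ext_power_sum[where R = "regK u" and F = "\<lambda>y. f (\<tau> y)" and l = l
        and T = "\<lambda>d v. mtr (Sop v ^\<^sub>m d)", OF fun_ring_regK] mtr_Sop_regK[OF u] by blast
  show thesis
  proof (rule that[OF b(1)])
    fix v P x assume v: "eig_at v" and P: "eigenbasis_at v P x"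
    have "f (\<tau> (v, x i)) = f (congr (frame m (Xop v) (col P i) * C) v)" if i: "i < m" for i
    proof (rule poly_fun_eqI[OF \<tau>V _ _ f])
      let ?M = "frame m (Xop v) (col P i)"
      have MC: "?M * C \<in> carrier_mat m m" by (rule mult_carrier_mat[OF frame_carrier C])
      show "congr (?M * C) v \<in> V" by (rule congr(1)[OF MC])
      fix l assume l: "l \<in> {1..N}"
      show "Bm (\<tau> (v, x i)) l = Bm (congr (?M * C) v) l"
        unfolding \<tau>B[OF l] congr(2)[OF MC l] frame_eig_form[OF v P i, symmetric]
        using frame_carrier[of m "Xop v" "col P i"] C(1) Bm_carrier[of v l]
        by (simp add: transpose_mult[of _ m m _ m] square_mult[where n = m])
    qed
    then show "b v = (\<Sum>i<m. x i ^ l * f (congr (frame m (Xop v) (col P i) * C) v))"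
      using b(2)[OF mtr_Sop_sum[OF P]] by simp
  qed
qed

lemma several_forms_invariant:
  assumes w: "eig_at w" "eigenbasis_at w P0 x0" "i0 < m" "det (frame m (Xop w) (col P0 i0)) \<noteq> 0"
    and p: "p \<in> poly_fun s V" and q: "q \<in> poly_fun s V" "q w' \<noteq> 0" "w' \<in> V"
    and inv: "\<And>M v. M \<in> carrier_mat m m \<Longrightarrow> det M \<noteq> 0 \<Longrightarrow> v \<in> V \<Longrightarrow> p (congr M v) * q v = p v * q (congr M v)"
  shows "(\<lambda>v. p v / q v) \<in> K"
proof -
  let ?F = "\<lambda>v P i. frame m (Xop v) (col P i)"
  \<comment> \<open>At a tuple pulled back along a frame, \<open>d\<close> is det(frame)^2 det G, so
    it detects singular frames; as a polynomial function it can be summed over the eigenvalues by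
    \<open>eig_transform\<close>.\<close>
  obtain d where d: "d \<in> poly_fun s V" "\<And>v. v \<in> V \<Longrightarrow> det (Gm v) = d v"
    using mat_in_det[OF fun_ring_poly_on poly_on_Gm] unfolding poly_on_def by blast
  have d_congr: "d (congr (M * 1\<^sub>m m) v) = det M ^ 2 * det (Gm v)" if "M \<in> carrier_mat m m" for M v
  proof -
    have "d (congr M v) = det (Gm (congr M v))" using d(2)[OF congr(1)[OF that]] by simp
    then show ?thesis
      using Gm_congr[OF that, of v] det_congruence[OF that Gm_carrier] that by simp
  qed
  have w': "w \<in> V" "det (Gm w) \<noteq> 0" and V0: "det (vmat m x0) \<noteq> 0"
    using w(1,2) by (auto simp: eig_at_def eigenbasis_at_def)
  have fr: "?F v P i \<in> carrier_mat m m" for v P i by simp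
  have "d (congr (?F w P0 i0 * 1\<^sub>m m) w) \<noteq> 0"
    unfolding d_congr[OF fr] using w(4) w' by simp
  then obtain l0 where l0: "(\<Sum>i<m. x0 i ^ l0 * d (congr (?F w P0 i * 1\<^sub>m m) w)) \<noteq> 0"
    using power_sum_nonzero[OF V0 w(3), of "\<lambda>i. d (congr (?F w P0 i * 1\<^sub>m m) w)"] by blast
  \<comment> \<open>\<open>D\<close> turns the existence of a nonsingular eigenframe, known only at
    \<open>w\<close>, into a generic property, so that \<open>u\<close> can also be taken off the
    zeros of \<open>q\<close>.\<close>
  obtain D where D: "D \<in> regK w"
    "\<And>v P x. eig_at v \<Longrightarrow> eigenbasis_at v P x \<Longrightarrow>
      D v = (\<Sum>i<m. x i ^ l0 * d (congr (?F v P i * 1\<^sub>m m) v))"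
    by (rule eig_transform[where l = l0, OF w(1) d(1) one_carrier_mat]) (rule that)
  have "generically s V (\<lambda>v. D v \<noteq> 0)"
    using D(1) D(2)[OF w(1,2)] l0 w'(1) by (intro regular_at_generically_nonzero[of _ s V w]) auto
  moreover have "generically s V (\<lambda>v. q v \<noteq> 0)"
    using q unfolding generically_def by blast
  ultimately have "generically s V (\<lambda>v. eig_at v \<and> q v \<noteq> 0 \<and> D v \<noteq> 0)"
    using eig_at_generic[OF w(1)] by (intro generically_conj[OF vs sub])
  then obtain u where u: "u \<in> V" "eig_at u" "q u \<noteq> 0" "D u \<noteq> 0" by (rule generically_ex) blast
  obtain P x where P: "eigenbasis_at u P x" using eigenbasis_exists[OF u(2)] .
  have "\<exists>i<m. d (congr (?F u P i * 1\<^sub>m m) u) \<noteq> 0"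
  proof (rule ccontr)
    assume "\<not> ?thesis"
    then show False using D(2)[OF u(2) P] u(4) by simp
  qed
  then obtain i where i: "i < m" "det (?F u P i) \<noteq> 0"
    unfolding d_congr[OF fr] by auto
  \<comment> \<open>For the index \<open>i\<close> the tuple at \<open>u\<close> is now pulled back
    by the identity matrix, which keeps one summand of the denominator nonzero.\<close>
  define C where "C = mat_inv (?F u P i)"
  have C: "C \<in> carrier_mat m m" "?F u P i * C = 1\<^sub>m m"
    using mat_inv[OF fr] i(2) by (simp_all add: C_def)
  have "q (congr (?F u P i * C) u) \<noteq> 0"
    unfolding C(2) congr_one[OF q(1) u(1)] by (rule u(3))
  moreover have "det (vmat m x) \<noteq> 0" using P by (simp add: eigenbasis_at_def)
  ultimately obtain l where l: "(\<Sum>i<m. x i ^ l * q (congr (?F u P i * C) u)) \<noteq> 0"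
    using power_sum_nonzero[of m x i "\<lambda>i. q (congr (?F u P i * C) u)"] i(1) by blast
  obtain b where b: "b \<in> regK u"
    "\<And>v P x. eig_at v \<Longrightarrow> eigenbasis_at v P x \<Longrightarrow> b v = (\<Sum>i<m. x i ^ l * q (congr (?F v P i * C) v))"
    by (rule eig_transform[where l = l, OF u(2) q(1) C(1)]) (rule that)
  obtain a where a: "a \<in> regK u"
    "\<And>v P x. eig_at v \<Longrightarrow> eigenbasis_at v P x \<Longrightarrow> a v = (\<Sum>i<m. x i ^ l * p (congr (?F v P i * C) v))"
    by (rule eig_transform[where l = l, OF u(2) p C(1)]) (rule that)
  show ?thesis
  proof (rule quotient_in_K[OF _ b(1) _ u(1) q(1) u(3)])
    show "a \<in> K" using a(1) by blast
    show "b u \<noteq> 0" using b(2)[OF u(2) P] l by simp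
    show "generically s V (\<lambda>v. p v * b v = a v * q v)"
    proof (rule generically_mono[OF eig_at_generic[OF w(1)]])
      fix v assume v: "v \<in> V" "eig_at v"
      obtain P x where P: "eigenbasis_at v P x" using eigenbasis_exists[OF v(2)] .
      have "p (congr (?F v P i * C) v) * q v = p v * q (congr (?F v P i * C) v)" for i
        by (rule congr_invariance_extend[OF p q(1) inv[OF _ _ v(1)] mult_carrier_mat[OF fr C(1)]])
      from arg_cong[OF this, of "\<lambda>y. x _ ^ l * y"]
      have "p v * (x i ^ l * q (congr (?F v P i * C) v)) = x i ^ l * p (congr (?F v P i * C) v) * q v" for i
        by (simp only: mult_ac)
      then show "p v * b v = a v * q v"
        unfolding a(2)[OF v(2) P] b(2)[OF v(2) P]
        unfolding sum_distrib_left sum_distrib_right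
        by (rule sum.cong[OF refl])
    qed
  qed
qed

end

section \<open>Tuples that witness the generic conditions\<close>

context procesi_core
begin

text \<open>The test tuple has \<open>G = J\<close>, the antidiagonal unit matrix, and
  \<open>X\<close> diagonal with eigenvalues -(m-1), -(m-3), ..., m-1. Their symmetry about 0 is
  what makes \<open>J * dmat m x\<close> skew.\<close>

lemma cyclic_at_exists: "\<exists>w. cyclic_at w"
proof -
  define J :: "complex mat" where "J = mat m m (\<lambda>(i, j). if i + j = m - 1 then 1 else 0)"
  define x where "x = (\<lambda>j::nat. 2 * of_nat j - of_nat (m - 1) :: complex)"
  have J: "J \<in> carrier_mat m m" "J\<^sup>T = J" "J * J = 1\<^sub>m m"
  proof -
    show "J * J = 1\<^sub>m m"
    proof (rule eq_matI)
      fix i j assume "i < dim_row (1\<^sub>m m)" "j < dim_col (1\<^sub>m m)"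
      then have ij: "i < m" "j < m" by auto
      have "(J * J) $$ (i, j) = (\<Sum>l<m. if l = m - 1 - i then (if l + j = m - 1 then 1 else 0) else 0)"
      proof (subst mult_mat_entry[of _ m m _ m])
        show "(\<Sum>l<m. J $$ (i, l) * J $$ (l, j)) =
            (\<Sum>l<m. if l = m - 1 - i then (if l + j = m - 1 then 1 else 0) else 0)"
          using ij by (intro sum.cong) (auto simp: J_def)
      qed (use ij in \<open>auto simp: J_def\<close>)
      then show "(J * J) $$ (i, j) = 1\<^sub>m m $$ (i, j)"
        using ij by (auto simp: J_def)
    qed (auto simp: J_def)
  qed (auto simp: J_def intro!: eq_matI)
  define A where "A = J * dmat m x"
  have A: "A \<in> carrier_mat m m" using J(1) by (simp add: A_def mult_carrier_mat[of _ m m])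
  have A_entry: "A $$ (i, j) = (if i + j = m - 1 then x j else 0)" if "i < m" "j < m" for i j
    using that unfolding A_def mult_dmat_entry[OF J(1) that] by (simp add: J_def)
  have skew: "A\<^sup>T = - A"
  proof (rule eq_matI)
    fix i j assume "i < dim_row (- A)" "j < dim_col (- A)"
    then have ij: "i < m" "j < m" using A by auto
    have "x i = - x j" if "i + j = m - 1"
      unfolding x_def that[symmetric] by simp
    then show "A\<^sup>T $$ (i, j) = (- A) $$ (i, j)"
      using ij A A_entry[OF ij] A_entry[OF ij(2,1)] by (auto simp: add.commute)
  qed (use A in auto)
  let ?B = "\<lambda>l::nat. J + A"
  have B: "\<And>l. l \<in> {1..N} \<Longrightarrow> ?B l \<in> carrier_mat m m" using J A by auto
  have GK: "Gm (mk ?B) = J" "Km (mk ?B) = A"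
    by (rule Gm_Km_mk[of ?B J A]; use J A skew in simp)+
  have "Xop (mk ?B) = J * A"
    unfolding Xop_eq GK mat_inv_eqI[OF J(1,1,3)] ..
  also have "\<dots> = dmat m x"
    using J by (simp add: A_def left_mult_one_mat[of _ m m] flip: assoc_mult_mat[of J m m J m "dmat m x" m] del: assoc_mult_mat)
  finally have X: "Xop (mk ?B) = dmat m x" .
  have "inj_on x {..<m}" by (rule inj_onI) (simp add: x_def)
  then have "cyclic_at (mk ?B)"
    unfolding cyclic_at_def X GK
    using mk_in[of ?B] J(1) A det_nonzero_if_inverse(1)[OF J(1,1,3)] det_tgram_dmat[of x m] by auto
  then show ?thesis by blast
qed

end

context procesi_core2
begin

text \<open>The test tuple has G = 1, S = diag(0, ..., m-1) and a skew \<open>A\<close> with entries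
  1 below and -1 above the diagonal. Starting from the unit vector e with index 0, A^k e has its
  last nonzero coordinate at index k, equal to 1; so the frame is upper triangular with unit
  diagonal.\<close>

lemma eigenframe_exists:
  "\<exists>w P x i. eig_at w \<and> eigenbasis_at w P x \<and> i < m \<and> det (frame m (Xop w) (col P i)) \<noteq> 0"
proof -
  define A :: "complex mat" where
    "A = mat m m (\<lambda>(i, j). if i = Suc j then 1 else if j = Suc i then -1 else 0)"
  define x where "x = (\<lambda>j::nat. of_nat j :: complex)"
  have A: "A \<in> carrier_mat m m" "A\<^sup>T = - A"
    by (auto simp: A_def intro!: eq_matI)
  define B where "B = (\<lambda>l::nat. if l = 1 then 1\<^sub>m m + A else if l = 2 then dmat m x else 0\<^sub>m m m)"
  have B: "\<And>l. l \<in> {1..N} \<Longrightarrow> B l \<in> carrier_mat m m" using A by (auto simp: B_def)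
  have B1: "B 1 = 1\<^sub>m m + A" by (simp add: B_def)
  let ?w = "mk B"
  have GK: "Gm ?w = 1\<^sub>m m" "Km ?w = A"
    by (rule Gm_Km_mk[of B "1\<^sub>m m" A]; use B A B1 in simp)+
  have inv1: "mat_inv (1\<^sub>m m :: complex mat) = 1\<^sub>m m" by (rule mat_inv_eqI) auto
  have X: "Xop ?w = A"
    unfolding Xop_eq GK inv1 using A(1) by simp
  have B2: "Bm ?w 2 = dmat m x"
    using Bm_mk[of B 2] B N2 by (auto simp: B_def)
  have dT: "(dmat m x)\<^sup>T = dmat m x" by (intro eq_matI) (auto simp: dmat_def)
  have S: "Sop ?w = dmat m x"
    unfolding Sop_eq GK inv1 B2 dT by (intro eq_matI) (auto simp: dmat_def)
  have inj: "inj_on x {..<m}" by (rule inj_onI) (simp add: x_def)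
  have eig: "eig_at ?w"
    unfolding eig_at_def S GK using mk_in[of B] B det_tgram_dmat[OF inj] by auto
  have basis: "eigenbasis_at ?w (1\<^sub>m m) x"
    unfolding eigenbasis_at_def S GK using det_vmat_nonzero[OF inj]
    by (simp add: right_mult_one_mat[of _ m m] left_mult_one_mat[of _ m m])
  let ?e = "col (1\<^sub>m m) 0 :: complex vec"
  have e: "?e \<in> carrier_vec m" by (intro carrier_vecI) simp
  have Ak: "A ^\<^sub>m k \<in> carrier_mat m m" for k using A(1) by (rule pow_carrier_mat)
  have tri: "(A ^\<^sub>m k *\<^sub>v ?e) $ r = (if r = k then 1 else 0)" if "k \<le> r" "r < m" for k r
    using that
  proof (induction k arbitrary: r)
    case 0
    then show ?case using A(1) by auto
  next
    case (Suc k)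
    have "A ^\<^sub>m Suc k *\<^sub>v ?e = (A * A ^\<^sub>m k) *\<^sub>v ?e"
      using pow_mat_intertwine[OF A(1) A(1) A(1) refl, of k] by simp
    also have "\<dots> = A *\<^sub>v (A ^\<^sub>m k *\<^sub>v ?e)"
      by (rule assoc_mult_mat_vec[OF A(1) Ak e])
    finally have eq: "A ^\<^sub>m Suc k *\<^sub>v ?e = A *\<^sub>v (A ^\<^sub>m k *\<^sub>v ?e)" .
    have "(A *\<^sub>v y) $ r = (\<Sum>j<m. A $$ (r, j) * y $ j)" if "y \<in> carrier_vec m" for y
      using Suc.prems A(1) that by (auto simp: scalar_prod_def atLeast0LessThan intro!: sum.cong)
    from this[OF mult_mat_vec_carrier[OF Ak e]]
    have "(A ^\<^sub>m Suc k *\<^sub>v ?e) $ r = (\<Sum>j<m. A $$ (r, j) * (A ^\<^sub>m k *\<^sub>v ?e) $ j)"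
      unfolding eq .
    also have "\<dots> = (\<Sum>j<m. if j = r - 1 then (if r - 1 = k then 1 else 0) else 0)"
    proof (rule sum.cong[OF refl])
      fix j assume "j \<in> {..<m}"
      then have j: "j < m" by simp
      show "A $$ (r, j) * (A ^\<^sub>m k *\<^sub>v ?e) $ j = (if j = r - 1 then (if r - 1 = k then 1 else 0) else 0)"
      proof (cases "j \<ge> k")
        case True
        then show ?thesis using Suc.IH[of j] Suc.prems j by (auto simp: A_def)
      next
        case False
        then show ?thesis using Suc.prems j by (auto simp: A_def)
      qed
    qed
    also have "\<dots> = (if r = Suc k then 1 else 0)"
      using Suc.prems by auto
    finally show ?case .
  qed
  let ?F = "frame m A ?e"
  have "upper_triangular ?F"
    using tri by (intro upper_triangularI) (auto simp: frame_def)
  then have "det ?F = prod_list (diag_mat ?F)"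
    by (rule det_upper_triangular[OF _ frame_carrier])
  moreover have "0 \<notin> set (diag_mat ?F)"
    using tri by (auto simp: frame_def diag_mat_def)
  ultimately have "det ?F \<noteq> 0" by (simp add: prod_list_zero_iff)
  then show ?thesis using eig basis m_pos X by (metis less_eq_Suc_le One_nat_def)
qed

end

theorem (in procesi_core) rational_invariant_in_K:
  assumes p: "p \<in> poly_fun s V" and q: "q \<in> poly_fun s V" "q w \<noteq> 0" "w \<in> V"
    and inv: "\<And>M v. M \<in> carrier_mat m m \<Longrightarrow> det M \<noteq> 0 \<Longrightarrow> v \<in> V \<Longrightarrow> p (congr M v) * q v = p v * q (congr M v)"
  shows "(\<lambda>v. p v / q v) \<in> K"
proof (cases "N = 1")
  case True
  then show ?thesis using cyclic_at_exists single_form_invariant[OF True _ p q inv] by blast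
next
  case False
  then interpret procesi_core2 using N_pos by unfold_locales simp
  show ?thesis using eigenframe_exists several_forms_invariant[OF _ _ _ _ p q inv] by blast
qed

section \<open>Symmetric and alternating forms\<close>

text \<open>Permutations are built from transpositions. The form with a predicate serves symmetric
  forms (constant value) and also alternating ones, where a swap changes the sign but preserves
  vanishing.\<close>

lemma swap_invariant_mset:
  assumes swap: "\<And>xs i j. length xs = n \<Longrightarrow> i < n \<Longrightarrow> j < n \<Longrightarrow> i \<noteq> j \<Longrightarrow> P xs \<Longrightarrow> P (xs[i := xs ! j, j := xs ! i])"
    and "mset xs = mset ys" "length ys = n" "P ys"
  shows "P xs"
proof -
  obtain p where p: "p permutes {..<length ys}" "permute_list p ys = xs"
    using mset_eq_permutation[OF assms(2)] .
  have "P (permute_list p ys)"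
    using finite_lessThan p(1)
  proof (induction p rule: permutes_rev_induct)
    case id
    then show ?case using assms(4) by simp
  next
    case (swap a b p)
    let ?zs = "permute_list p ys"
    have len: "length ?zs = n" using assms(3) by simp
    have tp: "Transposition.transpose a b permutes {..<length ys}"
      using swap by (intro permutes_swap_id) auto
    have "permute_list (p \<circ> Transposition.transpose a b) ys = permute_list (Transposition.transpose a b) ?zs"
      by (rule permute_list_compose[OF tp])
    also have "\<dots> = ?zs[a := ?zs ! b, b := ?zs ! a]"
      using swap(1,2) tp len assms(3)
      by (intro nth_equalityI) (auto simp: permute_list_nth nth_list_update Transposition.transpose_def)
    finally have eq: "permute_list (p \<circ> Transposition.transpose a b) ys = ?zs[a := ?zs ! b, b := ?zs ! a]" .
    show ?case
      unfolding eq using swap len assms(3) by (intro assms(1)) auto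
  qed
  then show ?thesis using p(2) by simp
qed

text \<open>Basis vectors are replaced by arbitrary ones slot by slot: \<open>i\<close> counts the
  leading slots that may already hold arbitrary vectors.\<close>

lemma multilinear_eq_0:
  assumes "finite_dimensional_vector_space sT BT" and w: "w \<in> multilinear_forms sT k"
    and z: "\<And>xs. length xs = k \<Longrightarrow> set xs \<subseteq> BT \<Longrightarrow> w xs = 0"
  shows "w = 0"
proof -
  interpret T: finite_dimensional_vector_space sT BT by fact
  have "w xs = 0" if "length xs = k" "i \<le> k" "\<And>j. i \<le> j \<Longrightarrow> j < k \<Longrightarrow> xs ! j \<in> BT" for xs i
    using that
  proof (induction i arbitrary: xs)
    case 0
    then show ?case by (intro z) (auto simp: in_set_conv_nth)
  next
    case (Suc i)
    let ?f = "\<lambda>x. w (xs[i := x])"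
    have "Vector_Spaces.linear sT (*) ?f"
      using w Suc.prems by (auto simp: multilinear_forms_def)
    then interpret f: Vector_Spaces.linear sT "(*)" ?f .
    have "?f x = 0" if "x \<in> BT" for x
    proof (rule Suc.IH)
      fix j assume j: "i \<le> j" "j < k"
      show "xs[i := x] ! j \<in> BT"
        using Suc.prems(1) Suc.prems(3)[of j] that j by (cases "i = j") auto
    qed (use Suc.prems in auto)
    then have "?f (xs ! i) = 0"
      by (rule f.eq_0_on_span[of BT]) (use T.span_Basis in auto)
    then show ?case by simp
  qed
  from this[of _ k] have "w xs = 0" if "length xs = k" for xs using that by auto
  then show ?thesis using w by (auto simp: multilinear_forms_def fun_eq_iff)
qed

lemma sym_forms_mset:
  assumes "w \<in> sym_forms sT k" "mset xs = mset ys" "length ys = k"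
  shows "w xs = w ys"
proof (rule swap_invariant_mset[where P = "\<lambda>zs. w zs = w ys", OF _ assms(2,3) refl])
  show "w (zs[i := zs ! j, j := zs ! i]) = w ys"
    if "length zs = k" "i < k" "j < k" "w zs = w ys" for zs i j
    using assms(1) that by (auto simp: sym_forms_def)
qed

lemma vector_space_complex: "vector_space ((*) :: complex \<Rightarrow> complex \<Rightarrow> complex)"
  by (auto simp: vector_space_def algebra_simps)

text \<open>Evaluation at multisets of \<open>k\<close> basis vectors is injective on symmetric
  forms, and there are exactly \<open>N\<close> such multisets. A form outside the span would give
  \<open>N + 1\<close> independent ones.\<close>

lemma sym_forms_spanned:
  fixes q :: "nat \<Rightarrow> 't::ab_group_add list \<Rightarrow> complex"
  assumes T: "finite_dimensional_vector_space sT BT"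
    and N: "N = (vector_space.dim sT UNIV + k - 1) choose k"
    and q: "\<forall>i\<in>{1..N}. q i \<in> sym_forms sT k" "inj_on q {1..N}"
      "\<not> module.dependent (fun_scale (*)) (q ` {1..N})"
  shows "sym_forms sT k \<subseteq> Modules.module.span (fun_scale (*)) (q ` {1..N})"
proof
  interpret T: finite_dimensional_vector_space sT BT by fact
  interpret W: vector_space "fun_scale ((*) :: complex \<Rightarrow> complex \<Rightarrow> complex) :: complex \<Rightarrow> ('t list \<Rightarrow> complex) \<Rightarrow> _"
    by (rule vector_space_fun_scale[OF vector_space_complex])
  interpret M: vector_space "fun_scale ((*) :: complex \<Rightarrow> complex \<Rightarrow> complex) :: complex \<Rightarrow> ('t multiset \<Rightarrow> complex) \<Rightarrow> _"
    by (rule vector_space_fun_scale[OF vector_space_complex])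
  define I where "I = multisets_of_size BT k"
  have cardI: "card I = N" and finI: "finite I"
    using card_multisets_of_size[OF T.finite_Basis, of k] finite_multisets_of_size[OF T.finite_Basis, of k]
    by (simp_all add: I_def N T.dim_UNIV)
  \<comment> \<open>Any listing of the multiset; a symmetric form takes the same value on all of
    them.\<close>
  define rep where "rep = (\<lambda>X::'t multiset. SOME xs. mset xs = X)"
  have rep: "mset (rep X) = X" for X
    unfolding rep_def by (rule someI_ex) (rule ex_mset)
  define \<Phi> where "\<Phi> = (\<lambda>w::'t list \<Rightarrow> complex. \<lambda>X. if X \<in> I then w (rep X) else 0)"
  interpret \<Phi>: Vector_Spaces.linear "fun_scale (*)" "fun_scale (*)" \<Phi>
    by unfold_locales (auto simp: \<Phi>_def fun_scale_def fun_eq_iff)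
  have inj: "w = 0" if w: "w \<in> sym_forms sT k" "\<Phi> w = 0" for w
  proof (rule multilinear_eq_0[OF T])
    show "w \<in> multilinear_forms sT k" using w by (simp add: sym_forms_def)
    fix xs assume xs: "length xs = k" "set xs \<subseteq> BT"
    then have "mset xs \<in> I" by (simp add: I_def multisets_of_size_def)
    then have "w (rep (mset xs)) = 0" using fun_cong[OF w(2), of "mset xs"] by (simp add: \<Phi>_def)
    then show "w xs = 0" using sym_forms_mset[OF w(1), of "rep (mset xs)" xs] rep xs by simp
  qed
  note sub = subspace_sym_forms[OF T.vector_space_axioms, of k]
  fix w assume w: "w \<in> sym_forms sT k"
  show "w \<in> W.span (q ` {1..N})"
  proof (rule ccontr)
    assume nw: "w \<notin> W.span (q ` {1..N})"
    define S where "S = insert w (q ` {1..N})"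
    have indS: "W.independent S" using q(3) nw by (simp add: S_def W.independent_insert W.span_base)
    have SS: "W.span S \<subseteq> sym_forms sT k"
      using q(1) w sub by (intro W.span_minimal) (auto simp: S_def)
    have injS: "inj_on \<Phi> (W.span S)"
    proof (rule inj_onI)
      fix a b assume ab: "a \<in> W.span S" "b \<in> W.span S" "\<Phi> a = \<Phi> b"
      have "a - b \<in> W.span S" using ab by (intro W.span_diff)
      then have "a - b = 0" using ab(3) SS by (intro inj) (auto simp: \<Phi>.diff)
      then show "a = b" by simp
    qed
    have "M.independent (\<Phi> ` S)"
      by (rule \<Phi>.independent_injective_image[OF indS injS])
    moreover have "\<Phi> ` S \<subseteq> M.span ((\<lambda>X Y. if X = Y then 1 else 0) ` I)"
    proof -
      have "\<Phi> v \<in> M.span ((\<lambda>X Y. if X = Y then 1 else 0) ` I)" for v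
      proof -
        have "\<Phi> v = (\<Sum>X\<in>I. fun_scale (*) (v (rep X)) (\<lambda>Y. if X = Y then 1 else 0))"
        proof
          fix Y
          have "(\<Sum>X\<in>I. fun_scale (*) (v (rep X)) (\<lambda>Y. if X = Y then 1 else 0)) Y
              = (\<Sum>X\<in>I. if X = Y then v (rep X) else 0)"
            by (induction rule: finite_induct[OF finI]) (auto simp: fun_scale_def)
          then show "\<Phi> v Y = (\<Sum>X\<in>I. fun_scale (*) (v (rep X)) (\<lambda>Y. if X = Y then 1 else 0)) Y"
            using finI by (simp add: \<Phi>_def)
        qed
        then show ?thesis by (simp only:) (intro M.span_sum M.span_scale M.span_base imageI)
      qed
      then show ?thesis by blast
    qed
    ultimately have "card (\<Phi> ` S) \<le> card ((\<lambda>X Y. if X = Y then 1 else 0 :: complex) ` I)"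
      using M.independent_span_bound[OF finite_imageI[OF finI]] by blast
    also have "\<dots> \<le> N" using card_image_le[OF finI] cardI by blast
    finally have "card (\<Phi> ` S) \<le> N" .
    moreover have "card (\<Phi> ` S) = card S"
      by (rule card_image[OF inj_on_subset[OF injS W.span_superset]])
    moreover have "card S = Suc N"
      using nw W.span_base[of w "q ` {1..N}"] q(2) unfolding S_def
      by (subst card_insert_disjoint) (auto simp: card_image)
    ultimately show False by simp
  qed
qed

text \<open>Put the sum of the two entries into both slots and expand.\<close>

lemma alt_forms_swap:
  assumes "vector_space sT" "w \<in> alt_forms sT k" "length xs = k" "i < k" "j < k" "i \<noteq> j"
  shows "w (xs[i := xs ! j, j := xs ! i]) = - w xs"
proof -
  have alt: "w ys = 0" if "length ys = k" "a < b" "b < k" "ys ! a = ys ! b" for ys a b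
    using assms(2) that by (auto simp: alt_forms_def)
  have z: "w (xs[i := x, j := x]) = 0" for x
    using alt[of "xs[i := x, j := x]" "min i j" "max i j"] assms(3-6) by (auto simp: min_def max_def nth_list_update)
  have lin: "Vector_Spaces.linear sT (*) (\<lambda>x. w (ys[a := x]))" if "length ys = k" "a < k" for ys a
    using assms(2) that by (auto simp: alt_forms_def multilinear_forms_def)
  have add1: "w (xs[i := x, j := y + y']) = w (xs[i := x, j := y]) + w (xs[i := x, j := y'])" for x y y'
    using module_hom.add[OF Vector_Spaces.linear.axioms(3)[OF lin[of "xs[i := x]" j]]] assms(3-6) by simp
  have add2: "w (xs[i := x + x', j := y]) = w (xs[i := x, j := y]) + w (xs[i := x', j := y])" for x x' y
    using module_hom.add[OF Vector_Spaces.linear.axioms(3)[OF lin[of "xs[j := y]" i]], of x x'] assms(3-6)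
    by (simp add: list_update_swap[of j i])
  have "0 = w (xs[i := xs ! i + xs ! j, j := xs ! i + xs ! j])" using z by simp
  also have "\<dots> = w (xs[i := xs ! i, j := xs ! j]) + w (xs[i := xs ! j, j := xs ! i])"
    unfolding add1 add2 unfolding z by simp
  finally have "0 = w (xs[i := xs ! i, j := xs ! j]) + w (xs[i := xs ! j, j := xs ! i])" .
  then have "w xs + w (xs[i := xs ! j, j := xs ! i]) = 0" unfolding list_update_id by (rule sym)
  then show ?thesis by (simp add: eq_neg_iff_add_eq_0 add.commute)
qed

text \<open>A top form is determined by its value on one list of the basis: a list of basis vectors
  with a repetition gives 0, and any other is a permutation of that list.\<close>

lemma alt_forms_line:
  fixes sT :: "complex \<Rightarrow> 't::ab_group_add \<Rightarrow> 't"
  assumes T: "finite_dimensional_vector_space sT BT" and n: "n = vector_space.dim sT UNIV"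
    and w0: "w0 \<in> alt_forms sT n" "w0 \<noteq> 0" and w: "w \<in> alt_forms sT n"
  shows "\<exists>c. w = fun_scale (*) c w0"
proof -
  interpret T: finite_dimensional_vector_space sT BT by fact
  interpret W: vector_space "fun_scale ((*) :: complex \<Rightarrow> complex \<Rightarrow> complex) :: complex \<Rightarrow> ('t list \<Rightarrow> complex) \<Rightarrow> _"
    by (rule vector_space_fun_scale[OF vector_space_complex])
  obtain bs where bs: "set bs = BT" "distinct bs" using finite_distinct_list[OF T.finite_Basis] by blast
  have len: "length bs = n" using distinct_card[OF bs(2)] bs(1) by (simp add: n T.dim_UNIV)
  have zero: "u = 0" if u: "u \<in> alt_forms sT n" "u bs = 0" for u
  proof (rule multilinear_eq_0[OF T])
    show "u \<in> multilinear_forms sT n" using u by (simp add: alt_forms_def)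
    fix xs assume xs: "length xs = n" "set xs \<subseteq> BT"
    show "u xs = 0"
    proof (cases "distinct xs")
      case True
      then have "set xs = BT"
        using xs len bs distinct_card[OF True] distinct_card[OF bs(2)] by (intro card_subset_eq) auto
      then have "mset xs = mset bs" using True bs by (metis set_eq_iff_mset_eq_distinct)
      show ?thesis
      proof (rule swap_invariant_mset[where P = "\<lambda>zs. u zs = 0", OF _ \<open>mset xs = mset bs\<close> len u(2)])
        show "u (zs[i := zs ! j, j := zs ! i]) = 0"
          if "length zs = n" "i < n" "j < n" "i \<noteq> j" "u zs = 0" for zs i j
          using alt_forms_swap[OF T.vector_space_axioms u(1) that(1-4)] that(5) by simp
      qed
    next
      case False
      then obtain i j where "i < j" "j < n" "xs ! i = xs ! j"
        unfolding distinct_conv_nth xs(1) by (metis nat_neq_iff)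
      then show ?thesis using u(1) xs(1) by (auto simp: alt_forms_def)
    qed
  qed
  have w0bs: "w0 bs \<noteq> 0" using zero[OF w0(1)] w0(2) by blast
  define c where "c = w bs / w0 bs"
  have "w - fun_scale (*) c w0 = 0"
  proof (rule zero)
    show "w - fun_scale (*) c w0 \<in> alt_forms sT n"
      using subspace_alt_forms[OF T.vector_space_axioms, of n] w w0(1)
      by (intro W.subspace_diff W.subspace_scale)
  qed (use w0bs in \<open>simp add: c_def fun_scale_def\<close>)
  then show ?thesis by (intro exI[of _ c]) simp
qed

section \<open>Coordinates of symbols\<close>

lemma lin_maps_sum:
  assumes "vector_space s1" "Modules.module.subspace s1 U" "vector_space s2" "f \<in> lin_maps s1 U s2 W"
    "\<And>i. i \<in> I \<Longrightarrow> x i \<in> U"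
  shows "f (\<Sum>i\<in>I. s1 (c i) (x i)) = (\<Sum>i\<in>I. s2 (c i) (f (x i)))"
proof -
  interpret v1: vector_space s1 by fact
  interpret v2: vector_space s2 by fact
  have f: "\<And>x y. x \<in> U \<Longrightarrow> y \<in> U \<Longrightarrow> f (x + y) = f x + f y" "\<And>c x. x \<in> U \<Longrightarrow> f (s1 c x) = s2 c (f x)"
    using assms(4) by (auto simp: lin_maps_def)
  have U: "0 \<in> U" "\<And>c x. x \<in> U \<Longrightarrow> s1 c x \<in> U" using assms(2) by (auto simp: v1.subspace_def)
  have "f 0 = 0" using f(2)[OF U(1), of 0] by simp
  then show ?thesis
    using assms(5)
  proof (induction I rule: infinite_finite_induct)
    case (insert i I)
    have "(\<Sum>i\<in>I. s1 (c i) (x i)) \<in> U"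
      using insert U by (intro v1.subspace_sum[OF assms(2)]) auto
    then show ?case using insert U f by simp
  qed auto
qed

lemma sum_fun_apply: "(\<Sum>i\<in>I. f i) x = (\<Sum>i\<in>I. f i x)"
  by (induction I rule: infinite_finite_induct) auto

text \<open>Both choices of E^t at once: after fixing a generator \<open>\<ll>\<close> of
  \<open>L\<close>, forms with values in \<open>L\<close> become complex matrices.\<close>

locale line_symbols =
  E: finite_dimensional_vector_space sE BE + Lv: vector_space sL + Tv: vector_space sT
  for sE :: "complex \<Rightarrow> 'e::ab_group_add \<Rightarrow> 'e" and BE :: "'e set"
    and sL :: "complex \<Rightarrow> 'l::ab_group_add \<Rightarrow> 'l"
    and sT :: "complex \<Rightarrow> 't::ab_group_add \<Rightarrow> 't" +
  fixes L :: "'l set" and \<ll> :: 'l and k N :: nat and q :: "nat \<Rightarrow> 't list \<Rightarrow> complex"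
  assumes subL: "Lv.subspace L"
    and line: "\<ll> \<in> L" "\<ll> \<noteq> 0" "\<And>u. u \<in> L \<Longrightarrow> \<exists>c. u = sL c \<ll>"
    and q_in: "\<And>i. i \<in> {1..N} \<Longrightarrow> q i \<in> sym_forms sT k"
    and q_inj: "inj_on q {1..N}"
    and q_indep: "\<not> Modules.module.dependent (fun_scale (*)) (q ` {1..N})"
    and q_span: "sym_forms sT k \<subseteq> Modules.module.span (fun_scale (*)) (q ` {1..N})"
    and BE_nonempty: "BE \<noteq> {}" and N_ge: "N \<ge> 1"
begin

sublocale Q: vector_space "fun_scale ((*) :: complex \<Rightarrow> complex \<Rightarrow> complex) :: complex \<Rightarrow> ('t list \<Rightarrow> complex) \<Rightarrow> _"
  by (rule vector_space_fun_scale[OF vector_space_complex])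

abbreviation SF where "SF \<equiv> sym_forms sT k"

abbreviation VS where "VS \<equiv> symbols sE sT sL L k"

lemma subSF: "Q.subspace SF"
  by (rule subspace_sym_forms[OF Tv.vector_space_axioms])

definition m :: nat where "m = card BE"

definition e :: "nat \<Rightarrow> 'e" where "e = (SOME h. bij_betw h {..<m} BE)"

lemma e_bij: "bij_betw e {..<m} BE"
proof -
  have "\<exists>h. bij_betw h {..<m} BE"
    using ex_bij_betw_nat_finite[OF E.finite_Basis] by (simp add: atLeast0LessThan m_def)
  then show ?thesis unfolding e_def by (rule someI_ex)
qed

lemma e_in: "j < m \<Longrightarrow> e j \<in> BE"
  using e_bij by (auto simp: bij_betw_def)

definition xc :: "'e \<Rightarrow> nat \<Rightarrow> complex" where "xc x j = E.representation BE x (e j)"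

lemma xc_add: "xc (x + y) j = xc x j + xc y j"
  and xc_scale: "xc (sE c x) j = c * xc x j"
  by (simp_all add: xc_def E.representation_add[OF E.independent_Basis] E.span_Basis
      E.representation_scale[OF E.independent_Basis])

lemma xc_e: "i < m \<Longrightarrow> j < m \<Longrightarrow> xc (e i) j = (if i = j then 1 else 0)"
  using e_bij unfolding xc_def E.representation_basis[OF E.independent_Basis e_in]
  by (auto simp: bij_betw_def inj_on_def)

lemma sum_BE: "(\<Sum>b\<in>BE. f b) = (\<Sum>j<m. f (e j))"
  using sum.reindex_bij_betw[OF e_bij, of f] by simp

lemma x_expand: "x = (\<Sum>j<m. sE (xc x j) (e j))"
  unfolding xc_def sum_BE[of "\<lambda>b. sE (E.representation BE x b) b", symmetric]
  by (rule E.sum_representation_eq[symmetric])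
    (auto simp: E.independent_Basis E.span_Basis E.finite_Basis)

lemma xc_eqI: "(\<And>j. j < m \<Longrightarrow> xc x j = xc y j) \<Longrightarrow> x = y"
  by (subst x_expand[of x], subst x_expand[of y]) simp

lemma xc_sum: "xc (\<Sum>i\<in>I. f i) j = (\<Sum>i\<in>I. xc (f i) j)"
proof -
  have "xc 0 j = 0" using xc_scale[of 0 0 j] by simp
  then show ?thesis by (induction I rule: infinite_finite_induct) (auto simp: xc_add)
qed

definition lc :: "'l \<Rightarrow> complex" where "lc u = (THE c. u = sL c \<ll>)"

lemma lc_scale_line: "lc (sL c \<ll>) = c"
  unfolding lc_def using line(2) by (intro the_equality) auto

lemma lc: "u \<in> L \<Longrightarrow> sL (lc u) \<ll> = u"
  using line(3)[of u] lc_scale_line by auto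

lemma lc_add: "u \<in> L \<Longrightarrow> u' \<in> L \<Longrightarrow> lc (u + u') = lc u + lc u'"
  and lc_scale: "u \<in> L \<Longrightarrow> lc (sL c u) = c * lc u"
  using lc_scale_line[of "lc u + lc u'"] lc_scale_line[of "c * lc u"] lc[of u] lc[of u']
  by (auto simp: Lv.scale_left_distrib simp flip: Lv.scale_scale)

lemma scale_line_in: "sL c \<ll> \<in> L"
  using subL line(1) by (auto simp: Lv.subspace_def)

definition QB :: "('t list \<Rightarrow> complex) set" where "QB = q ` {1..N}"

lemma QB_indep: "Q.independent QB"
  and QB_span: "w \<in> SF \<Longrightarrow> w \<in> Q.span QB"
  using q_indep q_span by (auto simp only: QB_def)

definition coef :: "('t list \<Rightarrow> complex) \<Rightarrow> nat \<Rightarrow> complex"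
  where "coef w i = Q.representation QB w (q i)"

lemma coef_add: "w \<in> SF \<Longrightarrow> w' \<in> SF \<Longrightarrow> coef (w + w') i = coef w i + coef w' i"
  and coef_scale: "w \<in> SF \<Longrightarrow> coef (fun_scale (*) c w) i = c * coef w i"
  by (simp_all add: coef_def Q.representation_add[OF QB_indep] Q.representation_scale[OF QB_indep] QB_span)

lemma coef_q:
  assumes "i \<in> {1..N}" "l \<in> {1..N}"
  shows "coef (q l) i = (if l = i then 1 else 0)"
proof -
  have "q l \<in> QB" using assms(2) unfolding QB_def by (rule imageI)
  moreover have "q i = q l \<longleftrightarrow> i = l" using inj_on_eq_iff[OF q_inj assms] .
  ultimately show ?thesis by (simp add: coef_def Q.representation_basis[OF QB_indep])
qed

lemma w_expand:
  assumes "w \<in> SF"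
  shows "w = (\<Sum>l\<in>{1..N}. fun_scale (*) (coef w l) (q l))"
proof -
  have "w = (\<Sum>b\<in>QB. fun_scale (*) (Q.representation QB w b) b)"
    by (rule Q.sum_representation_eq[OF QB_indep QB_span[OF assms] _ order_refl, symmetric]) (simp add: QB_def)
  then show ?thesis
    unfolding coef_def QB_def sum.reindex[OF q_inj] comp_def .
qed

lemma Hom_iff: "b \<in> Hom_E_Et sE sL L \<longleftrightarrow> (\<forall>x y. b x y \<in> L) \<and>
   (\<forall>x x' y. b (x + x') y = b x y + b x' y) \<and> (\<forall>c x y. b (sE c x) y = sL c (b x y)) \<and>
   (\<forall>x y y'. b x (y + y') = b x y + b x y') \<and> (\<forall>c x y. b x (sE c y) = sL c (b x y))"
  by (auto simp: Hom_E_Et_def Et_def lin_maps_def fun_scale_def fun_eq_iff)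

lemma VS_iff: "\<sigma> \<in> VS \<longleftrightarrow> (\<forall>w\<in>SF. \<sigma> w \<in> Hom_E_Et sE sL L) \<and>
   (\<forall>w\<in>SF. \<forall>w'\<in>SF. \<sigma> (w + w') = \<sigma> w + \<sigma> w') \<and>
   (\<forall>c. \<forall>w\<in>SF. \<sigma> (fun_scale (*) c w) = fun_scale (fun_scale sL) c (\<sigma> w)) \<and> (\<forall>w. w \<notin> SF \<longrightarrow> \<sigma> w = 0)"
  by (simp add: symbols_def lin_maps_def)

definition bmat :: "('e \<Rightarrow> 'e \<Rightarrow> 'l) \<Rightarrow> complex mat"
  where "bmat b = mat m m (\<lambda>(i, j). lc (b (e i) (e j)))"

definition xvec :: "'e \<Rightarrow> complex vec" where "xvec x = vec m (xc x)"

lemma bmat_carrier [simp]: "bmat b \<in> carrier_mat m m"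
  and xvec_carrier [simp]: "xvec x \<in> carrier_vec m"
  by (simp_all add: bmat_def xvec_def)

lemma xvec_inj: "xvec x = xvec y \<Longrightarrow> x = y"
  by (rule xc_eqI) (metis index_vec xvec_def)

lemma form_expand:
  assumes "b \<in> Hom_E_Et sE sL L"
  shows "b x y = sL (\<Sum>i<m. \<Sum>j<m. bmat b $$ (i, j) * xc x i * xc y j) \<ll>"
proof -
  have b1: "(\<lambda>x. b x y) \<in> lin_maps sE UNIV sL L" and b2: "b x \<in> lin_maps sE UNIV sL L" for x y
    using assms by (auto simp: Hom_iff lin_maps_def)
  have bL: "b x y \<in> L" for x y using assms by (simp add: Hom_iff)
  note lsum = lin_maps_sum[OF E.vector_space_axioms E.subspace_UNIV Lv.vector_space_axioms _ UNIV_I]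
  have "b x y = (\<Sum>i<m. sL (xc x i) (b (e i) y))"
    by (subst x_expand[of x]) (rule lsum[OF b1])
  also have "\<dots> = (\<Sum>i<m. sL (xc x i) (\<Sum>j<m. sL (xc y j) (b (e i) (e j))))"
    by (subst x_expand[of y]) (simp only: lsum[OF b2])
  also have "\<dots> = (\<Sum>i<m. sL (xc x i) (\<Sum>j<m. sL (xc y j) (sL (bmat b $$ (i, j)) \<ll>)))"
    using lc[OF bL] by (simp add: bmat_def)
  also have "\<dots> = sL (\<Sum>i<m. \<Sum>j<m. bmat b $$ (i, j) * xc x i * xc y j) \<ll>"
    by (simp add: Lv.scale_sum_left Lv.scale_sum_right mult_ac)
  finally show ?thesis .
qed

lemma form_lc:
  assumes "b \<in> Hom_E_Et sE sL L"
  shows "lc (b x y) = xvec x \<bullet> (bmat b *\<^sub>v xvec y)"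
proof -
  have "xvec x \<bullet> (bmat b *\<^sub>v xvec y) = (\<Sum>i<m. xc x i * (\<Sum>j<m. bmat b $$ (i, j) * xc y j))"
    by (auto simp: scalar_prod_def atLeast0LessThan xvec_def bmat_def intro!: sum.cong)
  also have "\<dots> = (\<Sum>i<m. \<Sum>j<m. bmat b $$ (i, j) * xc x i * xc y j)"
    by (simp add: sum_distrib_left mult_ac)
  finally show ?thesis
    using arg_cong[OF form_expand[OF assms], of lc x y] by (simp only: lc_scale_line)
qed

lemma form_eqI:
  assumes "b \<in> Hom_E_Et sE sL L" "b' \<in> Hom_E_Et sE sL L" "lc (b x y) = lc (b' x' y')"
  shows "b x y = b' x' y'"
proof -
  have "b x y \<in> L" "b' x' y' \<in> L" using assms(1,2) by (simp_all add: Hom_iff)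
  then show ?thesis using lc assms(3) by metis
qed

definition Bm :: "(('t list \<Rightarrow> complex) \<Rightarrow> 'e \<Rightarrow> 'e \<Rightarrow> 'l) \<Rightarrow> nat \<Rightarrow> complex mat"
  where "Bm \<sigma> l = bmat (\<sigma> (q l))"

definition mk :: "(nat \<Rightarrow> complex mat) \<Rightarrow> ('t list \<Rightarrow> complex) \<Rightarrow> 'e \<Rightarrow> 'e \<Rightarrow> 'l"
  where "mk B w x y = (if w \<in> SF
    then sL (\<Sum>l\<in>{1..N}. \<Sum>i<m. \<Sum>j<m. coef w l * (B l $$ (i, j) * xc x i * xc y j)) \<ll> else 0)"

lemma mk_in: "mk B \<in> VS"
proof -
  have "w + w' \<in> SF" "fun_scale (*) c w \<in> SF" if "w \<in> SF" "w' \<in> SF" for w w' c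
    using that subSF by (auto simp: Q.subspace_def)
  then show ?thesis
    by (auto simp: VS_iff Hom_iff mk_def scale_line_in xc_add xc_scale coef_add coef_scale fun_eq_iff fun_scale_def[of "fun_scale sL"]
        fun_scale_def[of sL] distrib_left distrib_right sum.distrib Lv.scale_left_distrib sum_distrib_left mult_ac)
qed

lemma Bm_mk:
  assumes "l \<in> {1..N}" "B l \<in> carrier_mat m m"
  shows "Bm (mk B) l = B l"
proof (rule eq_matI)
  fix i j assume "i < dim_row (B l)" "j < dim_col (B l)"
  then have ij: "i < m" "j < m" using assms by auto
  have "(\<Sum>l'\<in>{1..N}. \<Sum>a<m. \<Sum>b<m. coef (q l) l' * (B l' $$ (a, b) * xc (e i) a * xc (e j) b))
    = (\<Sum>l'\<in>{1..N}. if l' = l then (\<Sum>a<m. \<Sum>b<m. B l' $$ (a, b) * xc (e i) a * xc (e j) b) else 0)"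
    using assms(1) by (intro sum.cong refl) (auto simp: coef_q)
  also have "\<dots> = (\<Sum>a<m. \<Sum>b<m. B l $$ (a, b) * xc (e i) a * xc (e j) b)"
    using assms(1) by simp
  also have "\<dots> = (\<Sum>a<m. if a = i then (\<Sum>b<m. if b = j then B l $$ (a, b) else 0) else 0)"
  proof (intro sum.cong refl)
    fix a assume "a \<in> {..<m}"
    then show "(\<Sum>b<m. B l $$ (a, b) * xc (e i) a * xc (e j) b)
        = (if a = i then (\<Sum>b<m. if b = j then B l $$ (a, b) else 0) else 0)"
      using ij by (auto simp: xc_e if_distrib[of "(*) _"] cong: if_cong)
  qed
  also have "\<dots> = B l $$ (i, j)" using ij by simp
  finally show "Bm (mk B) l $$ (i, j) = B l $$ (i, j)"
    using ij q_in[OF assms(1)] by (simp add: Bm_def bmat_def mk_def lc_scale_line)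
qed (use assms in \<open>auto simp: Bm_def bmat_def\<close>)

lemma mk_Bm:
  assumes "\<sigma> \<in> VS"
  shows "mk (Bm \<sigma>) = \<sigma>"
proof (intro ext)
  fix w x y
  show "mk (Bm \<sigma>) w x y = \<sigma> w x y"
  proof (cases "w \<in> SF")
    case True
    have \<sigma>: "\<sigma> \<in> lin_maps (fun_scale (*)) SF (fun_scale (fun_scale sL)) (Hom_E_Et sE sL L)"
      using assms by (simp add: symbols_def)
    have H: "\<sigma> (q l) \<in> Hom_E_Et sE sL L" if "l \<in> {1..N}" for l
      using assms q_in[OF that] by (simp add: VS_iff)
    have "\<sigma> w = (\<Sum>l\<in>{1..N}. fun_scale (fun_scale sL) (coef w l) (\<sigma> (q l)))"
      by (subst w_expand[OF True])
        (rule lin_maps_sum[OF Q.vector_space_axioms subSF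
          vector_space_fun_scale[OF vector_space_fun_scale[OF Lv.vector_space_axioms]] \<sigma> q_in])
    then have "\<sigma> w x y = (\<Sum>l\<in>{1..N}. sL (coef w l) (\<sigma> (q l) x y))"
      by (simp add: sum_fun_apply fun_scale_def)
    also have "\<dots> = (\<Sum>l\<in>{1..N}. sL (coef w l) (sL (\<Sum>i<m. \<Sum>j<m. Bm \<sigma> l $$ (i, j) * xc x i * xc y j) \<ll>))"
      unfolding Bm_def using form_expand[OF H] by (intro sum.cong refl) simp
    also have "\<dots> = sL (\<Sum>l\<in>{1..N}. coef w l * (\<Sum>i<m. \<Sum>j<m. Bm \<sigma> l $$ (i, j) * xc x i * xc y j)) \<ll>"
      unfolding Lv.scale_scale by (rule Lv.scale_sum_left[symmetric])
    also have "\<dots> = mk (Bm \<sigma>) w x y"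
      using True by (simp add: mk_def sum_distrib_left)
    finally show ?thesis by simp
  qed (use assms in \<open>simp add: mk_def VS_iff\<close>)
qed

lemma vs_symbols: "vector_space (symbol_scale sL)"
  by (intro vector_space_fun_scale Lv.vector_space_axioms)

lemma sub_symbols: "Modules.module.subspace (symbol_scale sL) VS"
  by (rule subspace_symbols[OF E.vector_space_axioms Tv.vector_space_axioms Lv.vector_space_axioms subL])

text \<open>The basis of the symbol space dual to the matrix entries; the values of a functional on
  it are its coefficients in those entries.\<close>

definition unit_symbol :: "nat \<times> nat \<times> nat \<Rightarrow> ('t list \<Rightarrow> complex) \<Rightarrow> 'e \<Rightarrow> 'e \<Rightarrow> 'l"
  where "unit_symbol = (\<lambda>(l, i, j) w x y. if w \<in> SF then sL (coef w l * (xc x i * xc y j)) \<ll> else 0)"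

lemma unit_symbol_in: "unit_symbol t \<in> VS"
proof -
  have "w + w' \<in> SF" "fun_scale (*) c w \<in> SF" if "w \<in> SF" "w' \<in> SF" for w w' c
    using that subSF by (auto simp: Q.subspace_def)
  then show ?thesis
    by (cases t) (auto simp: VS_iff Hom_iff unit_symbol_def scale_line_in xc_add xc_scale coef_add coef_scale fun_eq_iff
        fun_scale_def[of "fun_scale sL"] fun_scale_def[of sL] distrib_left distrib_right Lv.scale_left_distrib mult_ac)
qed

lemma symbol_expand:
  assumes "\<sigma> \<in> VS"
  shows "\<sigma> = (\<Sum>t\<in>{1..N} \<times> {..<m} \<times> {..<m}. symbol_scale sL (case t of (l, i, j) \<Rightarrow> Bm \<sigma> l $$ (i, j)) (unit_symbol t))"
proof (intro ext)
  fix w x y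
  have "\<sigma> w x y = mk (Bm \<sigma>) w x y" by (simp add: mk_Bm[OF assms])
  also have "\<dots> = (\<Sum>l\<in>{1..N}. \<Sum>i<m. \<Sum>j<m. sL (Bm \<sigma> l $$ (i, j)) (unit_symbol (l, i, j) w x y))"
    by (auto simp: mk_def unit_symbol_def Lv.scale_sum_left mult_ac)
  also have "\<dots> = (\<Sum>t\<in>{1..N} \<times> {..<m} \<times> {..<m}. symbol_scale sL (case t of (l, i, j) \<Rightarrow> Bm \<sigma> l $$ (i, j)) (unit_symbol t)) w x y"
    by (simp add: sum_fun_apply fun_scale_def sum.cartesian_product case_prod_unfold)
  finally show "\<sigma> w x y = \<dots>" .
qed

lemma functional_expand:
  assumes f: "f \<in> lin_maps (symbol_scale sL) VS (*) UNIV" and \<sigma>: "\<sigma> \<in> VS"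
  shows "f \<sigma> = (\<Sum>l\<in>{1..N}. \<Sum>i<m. \<Sum>j<m. f (unit_symbol (l, i, j)) * Bm \<sigma> l $$ (i, j))"
proof -
  have "f \<sigma> = (\<Sum>t\<in>{1..N} \<times> {..<m} \<times> {..<m}. (case t of (l, i, j) \<Rightarrow> Bm \<sigma> l $$ (i, j)) * f (unit_symbol t))"
    by (subst symbol_expand[OF \<sigma>])
      (rule lin_maps_sum[OF vs_symbols sub_symbols vector_space_complex f unit_symbol_in])
  then show ?thesis by (simp add: sum.cartesian_product case_prod_unfold mult.commute)
qed

lemma poly_on_Bm_entry:
  assumes "l \<in> {1..N}" "i < m" "j < m"
  shows "(\<lambda>\<sigma>. Bm \<sigma> l $$ (i, j)) \<in> poly_on (symbol_scale sL) VS"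
proof -
  interpret S: vector_space "symbol_scale sL" by (rule vs_symbols)
  let ?f = "\<lambda>\<sigma>. if \<sigma> \<in> VS then lc (\<sigma> (q l) (e i) (e j)) else 0"
  have L: "\<sigma> (q l) (e i) (e j) \<in> L" if "\<sigma> \<in> VS" for \<sigma>
    using that q_in[OF assms(1)] by (simp add: VS_iff Hom_iff)
  have "\<sigma> + \<sigma>' \<in> VS" "symbol_scale sL c \<sigma> \<in> VS" if "\<sigma> \<in> VS" "\<sigma>' \<in> VS" for \<sigma> \<sigma>' c
    using that sub_symbols by (auto simp: S.subspace_def)
  then have "?f \<in> lin_maps (symbol_scale sL) VS (*) UNIV"
    using L by (auto simp: lin_maps_def lc_add fun_scale_def lc_scale)
  then have "?f \<in> poly_fun (symbol_scale sL) VS" by (rule poly_fun.functional)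
  then show ?thesis
    unfolding poly_on_def mem_Collect_eq by (rule bexI[rotated]) (use assms in \<open>auto simp: Bm_def bmat_def\<close>)
qed

sublocale C: matrix_coords "symbol_scale sL" VS m N Bm mk
proof (rule matrix_coords.intro)
  show "vector_space (symbol_scale sL)" "Modules.module.subspace (symbol_scale sL) VS"
    by (rule vs_symbols sub_symbols)+
  show "\<exists>c. \<forall>v\<in>VS. f v = (\<Sum>l = 1..N. \<Sum>i<m. \<Sum>j<m. c l i j * Bm v l $$ (i, j))"
    if "f \<in> lin_maps (symbol_scale sL) VS (*) UNIV" for f
    by (rule exI[of _ "\<lambda>l i j. f (unit_symbol (l, i, j))"]) (use functional_expand[OF that] in simp)
  have "card BE > 0" using BE_nonempty E.finite_Basis by (simp add: card_gt_0_iff)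
  then show "1 \<le> m" by (simp add: m_def)
  show "Bm v l \<in> carrier_mat m m" for v l by (simp add: Bm_def)
  show "(\<lambda>v. Bm v l $$ (j, k)) \<in> poly_on (symbol_scale sL) VS"
    if "l \<in> {1..N}" "j < m" "k < m" for l j k using that by (rule poly_on_Bm_entry)
  show "mk B \<in> VS" for B by (rule mk_in)
  show "Bm (mk B) l = B l" if "\<And>l. l \<in> {1..N} \<Longrightarrow> B l \<in> carrier_mat m m" "l \<in> {1..N}" for B l
    using that by (intro Bm_mk) auto
qed (rule N_ge)

end

section \<open>Operators, Procesi letters and the group action in matrices\<close>

context line_symbols
begin

definition mat_of :: "('e \<Rightarrow> 'e) \<Rightarrow> complex mat"
  where "mat_of A = mat m m (\<lambda>(r, c). xc (A (e c)) r)"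

definition op_of :: "complex mat \<Rightarrow> 'e \<Rightarrow> 'e"
  where "op_of M x = (\<Sum>r<m. sE ((M *\<^sub>v xvec x) $ r) (e r))"

lemma mat_of_carrier [simp]: "mat_of A \<in> carrier_mat m m"
  by (simp add: mat_of_def)

lemma xvec_add: "xvec (x + y) = xvec x + xvec y"
  and xvec_scale: "xvec (sE c x) = c \<cdot>\<^sub>v xvec x"
  by (auto simp: xvec_def xc_add xc_scale)

lemma xvec_e: "c < m \<Longrightarrow> xvec (e c) = unit_vec m c"
  by (auto simp: xvec_def xc_e unit_vec_def)

lemma xvec_op_of:
  assumes "M \<in> carrier_mat m m"
  shows "xvec (op_of M x) = M *\<^sub>v xvec x"
proof (rule eq_vecI)
  fix r assume "r < dim_vec (M *\<^sub>v xvec x)"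
  then have r: "r < m" using assms by simp
  have "xc (op_of M x) r = (\<Sum>r'<m. if r' = r then (M *\<^sub>v xvec x) $ r' else 0)"
    unfolding op_of_def xc_sum xc_scale using r by (intro sum.cong refl) (auto simp: xc_e)
  then show "xvec (op_of M x) $ r = (M *\<^sub>v xvec x) $ r" using r by (simp add: xvec_def)
qed (use assms in \<open>simp add: xvec_def\<close>)

lemma op_of_linear:
  assumes "M \<in> carrier_mat m m"
  shows "Vector_Spaces.linear sE sE (op_of M)"
  by unfold_locales
    (rule xvec_inj; simp add: xvec_op_of[OF assms] xvec_add xvec_scale mult_add_distrib_mat_vec[OF assms]
      mult_mat_vec[OF assms])+

lemma op_of_mult:
  assumes "M \<in> carrier_mat m m" "M' \<in> carrier_mat m m"
  shows "op_of M (op_of M' x) = op_of (M * M') x"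
  using assms by (intro xvec_inj) (simp add: xvec_op_of mult_carrier_mat[of _ m m _ m] assoc_mult_mat_vec[of _ m m _ m])

lemma op_of_one: "op_of (1\<^sub>m m) x = x"
  by (intro xvec_inj) (simp add: xvec_op_of)

lemma mat_of_op_of:
  assumes M: "M \<in> carrier_mat m m"
  shows "mat_of (op_of M) = M"
proof (rule eq_matI)
  fix r c assume "r < dim_row M" "c < dim_col M"
  then have rc: "r < m" "c < m" using M by auto
  have "xc (op_of M (e c)) r = (M *\<^sub>v xvec (e c)) $ r"
    using arg_cong[OF xvec_op_of[OF M, of "e c"], of "\<lambda>v. v $ r"] rc by (simp add: xvec_def)
  then show "mat_of (op_of M) $$ (r, c) = M $$ (r, c)"
    using rc M by (simp add: mat_of_def xvec_e)
qed (use M in \<open>auto simp: mat_of_def\<close>)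

lemma op_of_mat_of:
  assumes "Vector_Spaces.linear sE sE A"
  shows "op_of (mat_of A) = A"
proof (intro ext xvec_inj eq_vecI)
  interpret A: Vector_Spaces.linear sE sE A by fact
  fix x r assume "r < dim_vec (xvec (A x))"
  then have r: "r < m" by (simp add: xvec_def)
  have "A x = (\<Sum>c<m. sE (xc x c) (A (e c)))"
    using arg_cong[OF x_expand[of x], of A] by (simp only: A.sum A.scale)
  then have "xc (A x) r = (\<Sum>c<m. xc x c * xc (A (e c)) r)" by (simp add: xc_sum xc_scale)
  also have "\<dots> = (mat_of A *\<^sub>v xvec x) $ r"
    using r by (auto simp: mat_of_def xvec_def scalar_prod_def atLeast0LessThan mult.commute intro!: sum.cong)
  finally show "xvec (op_of (mat_of A) x) $ r = xvec (A x) $ r"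
    unfolding xvec_op_of[OF mat_of_carrier] using r by (simp add: xvec_def)
qed (simp add: xvec_def)

lemma op_of_inj:
  assumes "M \<in> carrier_mat m m" "M' \<in> carrier_mat m m" "op_of M = op_of M'"
  shows "M = M'"
  by (metis assms mat_of_op_of)

lemma op_trace_op_of:
  assumes "M \<in> carrier_mat m m"
  shows "op_trace sE BE (op_of M) = mtr M"
proof -
  have "op_trace sE BE (op_of M) = (\<Sum>j<m. xc (op_of M (e j)) j)"
    by (simp add: op_trace_def sum_BE xc_def)
  also have "\<dots> = (\<Sum>j<m. mat_of (op_of M) $$ (j, j))" by (simp add: mat_of_def)
  finally show ?thesis using assms by (simp add: mat_of_op_of mtr_def)
qed

lemma bmat_pullback:
  assumes b: "b \<in> Hom_E_Et sE sL L"
  shows "bmat (\<lambda>x y. b (A x) (A y)) = (mat_of A)\<^sup>T * bmat b * mat_of A"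
proof (rule eq_matI)
  fix i j assume "i < dim_row ((mat_of A)\<^sup>T * bmat b * mat_of A)" "j < dim_col ((mat_of A)\<^sup>T * bmat b * mat_of A)"
  then have ij: "i < m" "j < m" by (auto simp: mat_of_def)
  have col: "xvec (A (e c)) = col (mat_of A) c" if "c < m" for c
    using that by (intro eq_vecI) (auto simp: xvec_def mat_of_def)
  show "bmat (\<lambda>x y. b (A x) (A y)) $$ (i, j) = ((mat_of A)\<^sup>T * bmat b * mat_of A) $$ (i, j)"
    unfolding congruence_entry[OF mat_of_carrier bmat_carrier ij]
    using ij form_lc[OF b, of "A (e i)" "A (e j)"] by (simp add: bmat_def col)
qed (auto simp: bmat_def mat_of_def)

lemma mk_cong: "(\<And>l. l \<in> {1..N} \<Longrightarrow> B l = B' l) \<Longrightarrow> mk B = mk B'"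
  by (intro ext) (simp add: mk_def)

lemma symbol_act_congr:
  assumes A: "Vector_Spaces.linear sE sE (inv_into UNIV A)" and \<sigma>: "\<sigma> \<in> VS"
  shows "symbol_act A \<sigma> = C.congr (mat_of (inv_into UNIV A)) \<sigma>"
proof -
  let ?A = "inv_into UNIV A"
  have act: "symbol_act A \<sigma> = (\<lambda>w x y. \<sigma> w (?A x) (?A y))"
    by (simp add: symbol_act_def dual_op_def fun_eq_iff)
  interpret A: Vector_Spaces.linear sE sE ?A by fact
  have V: "symbol_act A \<sigma> \<in> VS"
    using \<sigma> unfolding act by (auto simp: VS_iff Hom_iff A.add A.scale fun_scale_def fun_eq_iff)
  have "Bm (symbol_act A \<sigma>) l = (mat_of ?A)\<^sup>T * Bm \<sigma> l * mat_of ?A" if "l \<in> {1..N}" for l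
    unfolding Bm_def act using \<sigma> q_in[OF that] by (intro bmat_pullback) (simp add: VS_iff)
  then have "mk (Bm (symbol_act A \<sigma>)) = C.congr (mat_of ?A) \<sigma>"
    unfolding C.congr_def by (rule mk_cong)
  then show ?thesis using mk_Bm[OF V] by simp
qed

lemma GL_congr:
  assumes "A \<in> carrier (GL sE)"
  obtains M where "M \<in> carrier_mat m m" "det M \<noteq> 0" "\<And>\<sigma>. \<sigma> \<in> VS \<Longrightarrow> symbol_act A \<sigma> = C.congr M \<sigma>"
proof -
  have A: "Vector_Spaces.linear sE sE A" "bij A" using assms by (auto simp: GL_def)
  let ?A = "inv_into UNIV A"
  interpret A: Vector_Spaces.linear sE sE A by fact
  have AA: "A (?A x) = x" "?A (A x) = x" for x using A(2) by (simp_all add: bij_is_surj surj_f_inv_f bij_is_inj)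
  have lin: "Vector_Spaces.linear sE sE ?A"
    by unfold_locales (metis AA A.add, metis AA A.scale)
  have "op_of (mat_of A * mat_of ?A) = op_of (1\<^sub>m m)"
    by (intro ext) (simp add: op_of_one op_of_mat_of[OF A(1)] op_of_mat_of[OF lin] AA flip: op_of_mult)
  then have "mat_of A * mat_of ?A = 1\<^sub>m m"
    by (rule op_of_inj[rotated 2]) (auto intro: mult_carrier_mat[of _ m m _ m])
  then have "det (mat_of ?A) \<noteq> 0" by (rule det_nonzero_if_inverse[OF mat_of_carrier mat_of_carrier])
  then show thesis using that[OF mat_of_carrier _ symbol_act_congr[OF lin]] by blast
qed

lemma congr_GL:
  assumes M: "M \<in> carrier_mat m m" "det M \<noteq> 0"
  obtains A where "A \<in> carrier (GL sE)" "\<And>\<sigma>. \<sigma> \<in> VS \<Longrightarrow> symbol_act A \<sigma> = C.congr M \<sigma>"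
proof -
  note Mi = mat_inv[OF M(1)]
  let ?A = "op_of (mat_inv M)"
  have AA: "?A (op_of M x) = x" "op_of M (?A x) = x" for x
    using Mi M by (simp_all add: op_of_mult op_of_one)
  have bij: "bij ?A" by (rule bijI') (metis AA, metis AA)
  have inv: "inv_into UNIV ?A = op_of M"
    by (rule inv_equality) (simp_all add: AA)
  have "?A \<in> carrier (GL sE)" using bij op_of_linear[OF Mi(1)] by (simp add: GL_def)
  moreover have "symbol_act ?A \<sigma> = C.congr M \<sigma>" if "\<sigma> \<in> VS" for \<sigma>
    using symbol_act_congr[of ?A \<sigma>] that op_of_linear[OF M(1)] by (simp add: inv mat_of_op_of[OF M(1)])
  ultimately show thesis using that by blast
qed

text \<open>With b(x, y) = x^T B y the equation g(Z x) = b x reads Z^T G = B. Injectivity of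
  \<open>g\<close> makes \<open>inv_into\<close> return this Z x.\<close>

lemma form_quotient_op_of:
  assumes g: "g \<in> Hom_E_Et sE sL L" "det (bmat g) \<noteq> 0" and b: "b \<in> Hom_E_Et sE sL L"
  shows "form_quotient g b = op_of ((bmat b * mat_inv (bmat g))\<^sup>T)"
proof -
  let ?G = "bmat g" and ?B = "bmat b"
  let ?Z = "(?B * mat_inv ?G)\<^sup>T"
  note Gi = mat_inv[OF bmat_carrier[of g]]
  have Z: "?Z \<in> carrier_mat m m" using Gi(1) by (simp add: mult_carrier_mat[of _ m m _ m])
  have ZG: "?Z\<^sup>T * ?G = ?B"
    using Gi(1) Gi(3)[OF g(2)] by (simp add: assoc_mult_mat[of _ m m _ m _ m] right_mult_one_mat[of _ m m])
  have tr: "(A *\<^sub>v x) \<bullet> y = x \<bullet> (A\<^sup>T *\<^sub>v y)"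
    if "A \<in> carrier_mat m m" "x \<in> carrier_vec m" "y \<in> carrier_vec m" for A :: "complex mat" and x y
    using transpose_vec_mult_scalar[of "A\<^sup>T" m m y x] that by simp
  have "g (op_of ?Z x) = b x" for x
  proof (rule ext, rule form_eqI[OF g(1) b])
    fix y
    have "lc (g (op_of ?Z x) y) = xvec x \<bullet> (?Z\<^sup>T *\<^sub>v (?G *\<^sub>v xvec y))"
      unfolding form_lc[OF g(1)] xvec_op_of[OF Z] by (rule tr[OF Z]) (auto intro: mult_mat_vec_carrier[of _ m m])
    also have "?Z\<^sup>T *\<^sub>v (?G *\<^sub>v xvec y) = ?B *\<^sub>v xvec y"
      using assoc_mult_mat_vec[of "?Z\<^sup>T" m m ?G m "xvec y"] Z ZG by simp
    finally show "lc (g (op_of ?Z x) y) = lc (b x y)" unfolding form_lc[OF b] .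
  qed
  moreover have "inj g"
  proof (rule injI)
    fix x x' assume eq: "g x = g x'"
    have "(?G\<^sup>T *\<^sub>v xvec x) $ j = lc (g x (e j))" if "j < m" for x j
    proof -
      have "lc (g x (e j)) = (?G\<^sup>T *\<^sub>v xvec x) \<bullet> unit_vec m j"
        unfolding form_lc[OF g(1)] xvec_e[OF that]
        using tr[of "?G\<^sup>T" "xvec x" "unit_vec m j"] by simp
      then show ?thesis using that mult_mat_vec_carrier[of "?G\<^sup>T" m m "xvec x"] by simp
    qed
    then have "?G\<^sup>T *\<^sub>v xvec x = ?G\<^sup>T *\<^sub>v xvec x'"
      using eq by (intro eq_vecI) (auto simp: bmat_def)
    then have "mat_inv (?G\<^sup>T) *\<^sub>v (?G\<^sup>T *\<^sub>v xvec x) = mat_inv (?G\<^sup>T) *\<^sub>v (?G\<^sup>T *\<^sub>v xvec x')" by simp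
    moreover have "mat_inv (?G\<^sup>T) *\<^sub>v (?G\<^sup>T *\<^sub>v xvec z) = xvec z" for z
    proof -
      have GT: "?G\<^sup>T \<in> carrier_mat m m" "det (?G\<^sup>T) \<noteq> 0" using g(2) det_transpose[OF bmat_carrier[of g]] by auto
      show ?thesis
        unfolding assoc_mult_mat_vec[OF mat_inv(1)[OF GT(1)] GT(1) xvec_carrier, symmetric] mat_inv(3)[OF GT] by simp
    qed
    ultimately have "xvec x = xvec x'" by metis
    then show "x = x'" by (rule xvec_inj)
  qed
  ultimately have "inv_into UNIV g (b x) = op_of ?Z x" for x
    using inv_f_eq[of g "op_of ?Z x" "b x"] by blast
  then show ?thesis
    unfolding form_quotient_def comp_def by (rule ext)
qed

text \<open>The defining equation reads Z^T G = G W. Nondegeneracy of \<open>G\<close> in the second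
  argument leaves only one solution, as \<open>THE\<close> requires.\<close>

lemma form_dual_op_of:
  assumes g: "g \<in> Hom_E_Et sE sL L" "det (bmat g) \<noteq> 0" and Z: "Z \<in> carrier_mat m m"
  shows "form_dual g (op_of Z) = op_of (mat_inv (bmat g) * Z\<^sup>T * bmat g)"
proof -
  let ?G = "bmat g"
  let ?W = "mat_inv ?G * Z\<^sup>T * ?G"
  note Gi = mat_inv[OF bmat_carrier[of g]]
  have W: "?W \<in> carrier_mat m m" using Gi(1) Z by (simp add: mult_carrier_mat[of _ m m _ m])
  have GW: "?G * ?W = Z\<^sup>T * ?G"
    using mat_inv_cancel(1)[OF bmat_carrier g(2), of "Z\<^sup>T * ?G"] Gi(1) Z
    by (simp add: square_mult[where n = m])
  have dual: "g (op_of Z x) y = g x (op_of ?W y)" for x y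
  proof (rule form_eqI[OF g(1) g(1)])
    have "lc (g (op_of Z x) y) = xvec x \<bullet> (Z\<^sup>T *\<^sub>v (?G *\<^sub>v xvec y))"
      unfolding form_lc[OF g(1)] xvec_op_of[OF Z]
      using transpose_vec_mult_scalar[of "Z\<^sup>T" m m "?G *\<^sub>v xvec y" "xvec x"] Z
        transpose_vec_mult_scalar[of "Z\<^sup>T" m m "xvec x"] mult_mat_vec_carrier[OF bmat_carrier xvec_carrier, of g y]
      by (metis comm_scalar_prod mult_mat_vec_carrier transpose_carrier_mat transpose_transpose xvec_carrier)
    also have "Z\<^sup>T *\<^sub>v (?G *\<^sub>v xvec y) = ?G *\<^sub>v (?W *\<^sub>v xvec y)"
      using assoc_mult_mat_vec[of "Z\<^sup>T" m m ?G m "xvec y"] assoc_mult_mat_vec[of ?G m m ?W m "xvec y"] Z W GW by simp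
    finally show "lc (g (op_of Z x) y) = lc (g x (op_of ?W y))"
      unfolding form_lc[OF g(1)] xvec_op_of[OF W] .
  qed
  have uniq: "B = op_of ?W" if B: "\<forall>x y. g (op_of Z x) y = g x (B y)" for B
  proof (rule ext, rule xvec_inj)
    fix y
    have "(?G *\<^sub>v xvec z) $ j = lc (g (e j) z)" if "j < m" for z j
      unfolding form_lc[OF g(1)] xvec_e[OF that] using that mult_mat_vec_carrier[of ?G m m "xvec z"] by simp
    moreover have "g x (B y) = g x (op_of ?W y)" for x using B dual by metis
    ultimately have "?G *\<^sub>v xvec (B y) = ?G *\<^sub>v xvec (op_of ?W y)"
      by (intro eq_vecI) (auto simp: bmat_def)
    then have "mat_inv ?G *\<^sub>v (?G *\<^sub>v xvec (B y)) = mat_inv ?G *\<^sub>v (?G *\<^sub>v xvec (op_of ?W y))" by simp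
    moreover have "mat_inv ?G *\<^sub>v (?G *\<^sub>v xvec z) = xvec z" for z
      using Gi(1) Gi(3)[OF g(2)] assoc_mult_mat_vec[of "mat_inv ?G" m m ?G m "xvec z"] by simp
    ultimately show "xvec (B y) = xvec (op_of ?W y)" by simp
  qed
  show ?thesis
    unfolding form_dual_def using dual uniq by (intro the_equality) auto
qed

lemma form_sym_Hom: "b \<in> Hom_E_Et sE sL L \<Longrightarrow> form_sym sL b \<in> Hom_E_Et sE sL L"
  and form_skew_Hom: "b \<in> Hom_E_Et sE sL L \<Longrightarrow> form_skew sL b \<in> Hom_E_Et sE sL L"
proof -
  note L = Lv.subspace_add[OF subL] Lv.subspace_diff[OF subL] Lv.subspace_scale[OF subL]
  show "b \<in> Hom_E_Et sE sL L \<Longrightarrow> form_sym sL b \<in> Hom_E_Et sE sL L"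
    "b \<in> Hom_E_Et sE sL L \<Longrightarrow> form_skew sL b \<in> Hom_E_Et sE sL L"
    by (simp_all add: Hom_iff form_sym_def form_skew_def form_transpose_def fun_scale_def L
        Lv.scale_right_distrib Lv.scale_right_diff_distrib mult.commute)
qed

lemma bmat_form_sym: "b \<in> Hom_E_Et sE sL L \<Longrightarrow> bmat (form_sym sL b) = (1/2) \<cdot>\<^sub>m (bmat b + (bmat b)\<^sup>T)"
  and bmat_form_skew: "b \<in> Hom_E_Et sE sL L \<Longrightarrow> bmat (form_skew sL b) = (1/2) \<cdot>\<^sub>m (bmat b + (-1) \<cdot>\<^sub>m (bmat b)\<^sup>T)"
proof -
  note L = Lv.subspace_add[OF subL] Lv.subspace_diff[OF subL] Lv.subspace_scale[OF subL]
  have diff: "lc (u - v) = lc u - lc v" if "u \<in> L" "v \<in> L" for u v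
    using lc_add[OF that(1) L(3)[OF that(2), of "-1"]] lc_scale[OF that(2), of "-1"] by simp
  show "b \<in> Hom_E_Et sE sL L \<Longrightarrow> bmat (form_sym sL b) = (1/2) \<cdot>\<^sub>m (bmat b + (bmat b)\<^sup>T)"
    "b \<in> Hom_E_Et sE sL L \<Longrightarrow> bmat (form_skew sL b) = (1/2) \<cdot>\<^sub>m (bmat b + (-1) \<cdot>\<^sub>m (bmat b)\<^sup>T)"
    by (auto intro!: eq_matI simp: Hom_iff bmat_def form_sym_def form_skew_def form_transpose_def fun_scale_def
        L lc_add lc_scale diff)
qed

lemma procesi_letter_op_of:
  assumes \<sigma>: "\<sigma> \<in> VS" and G: "det (C.Gm \<sigma>) \<noteq> 0" and x: "fst x \<in> {1..N}"
  shows "procesi_letter sL q \<sigma> x = op_of (C.letter \<sigma> x)"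
proof -
  obtain l d where [simp]: "x = (l, d)" by (cases x)
  have H: "\<sigma> (q i) \<in> Hom_E_Et sE sL L" if "i \<in> {1..N}" for i
    using \<sigma> q_in[OF that] by (simp add: VS_iff)
  have H1: "\<sigma> (q 1) \<in> Hom_E_Et sE sL L" using N_ge by (intro H) simp
  define g where "g = form_sym sL (\<sigma> (q 1))"
  have g: "g \<in> Hom_E_Et sE sL L" unfolding g_def by (rule form_sym_Hom[OF H1])
  have Gm: "bmat g = C.Gm \<sigma>" unfolding g_def bmat_form_sym[OF H1] by (simp add: C.Gm_def Bm_def)
  have Km: "bmat (form_skew sL (\<sigma> (q 1))) = C.Km \<sigma>" unfolding bmat_form_skew[OF H1] by (simp add: C.Km_def Bm_def)
  define D where "D = (if l = 1 then C.Km \<sigma> else Bm \<sigma> l)"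
  have D: "D \<in> carrier_mat m m" using C.Bm_carrier[of \<sigma> l] by (simp add: D_def)
  note Gi = mat_inv[OF C.Gm_carrier[of \<sigma>]]
  have GiT: "(mat_inv (C.Gm \<sigma>))\<^sup>T = mat_inv (C.Gm \<sigma>)"
    by (rule transpose_symmetric_inv[OF C.Gm_carrier C.Gm_sym G])
  have "procesi_op sL q \<sigma> l = op_of ((D * mat_inv (C.Gm \<sigma>))\<^sup>T)"
  proof (cases "l = 1")
    case True
    then show ?thesis
      using form_quotient_op_of[OF g _ form_skew_Hom[OF H1]] G
      by (simp add: procesi_op_def op_S_def D_def Gm Km[unfolded One_nat_def] flip: g_def[unfolded One_nat_def])
  next
    case False
    then show ?thesis
      using form_quotient_op_of[OF g _ H[of l]] G x
      by (simp add: procesi_op_def D_def Gm flip: g_def[unfolded One_nat_def] Bm_def)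
  qed
  also have "(D * mat_inv (C.Gm \<sigma>))\<^sup>T = mat_inv (C.Gm \<sigma>) * D\<^sup>T"
    using D Gi(1) GiT by (simp add: transpose_mult[of _ m m _ m])
  finally have op: "procesi_op sL q \<sigma> l = op_of (mat_inv (C.Gm \<sigma>) * D\<^sup>T)" .
  show ?thesis
  proof (cases d)
    case False
    then show ?thesis using op by (simp add: procesi_letter_def C.letter_def D_def Let_def)
  next
    case True
    have c: "mat_inv (C.Gm \<sigma>) * D\<^sup>T \<in> carrier_mat m m" using Gi(1) D by (simp add: mult_carrier_mat[of _ m m _ m])
    have "mat_inv (C.Gm \<sigma>) * (mat_inv (C.Gm \<sigma>) * D\<^sup>T)\<^sup>T * C.Gm \<sigma> = mat_inv (C.Gm \<sigma>) * D"
      using Gi(1) Gi(3)[OF G] D GiT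
      by (simp add: transpose_mult[of _ m m _ m] square_mult[where n = m]
          right_mult_one_mat[of _ m m])
    then have "form_dual g (procesi_op sL q \<sigma> l) = op_of (mat_inv (C.Gm \<sigma>) * D)"
      unfolding op using form_dual_op_of[OF g _ c] G by (simp add: Gm)
    then show ?thesis using True by (simp add: procesi_letter_def C.letter_def D_def Let_def flip: g_def[unfolded One_nat_def])
  qed
qed

lemma procesi_invariant_eq:
  assumes \<sigma>: "\<sigma> \<in> VS" and G: "det (C.Gm \<sigma>) \<noteq> 0" and I: "fst ` set I \<subseteq> {1..N}"
  shows "procesi_invariant sE BE sL q I \<sigma> = mtr (C.word \<sigma> I)"
proof -
  have "foldr (\<circ>) (map (procesi_letter sL q \<sigma>) I) id = op_of (C.word \<sigma> I)"
    using I
  proof (induction I)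
    case Nil
    show ?case by (auto simp: op_of_one)
  next
    case (Cons x I)
    then show ?case
      using procesi_letter_op_of[OF \<sigma> G, of x] by (auto simp: op_of_mult)
  qed
  then show ?thesis by (simp add: procesi_invariant_def op_trace_op_of)
qed

end

section \<open>The field of invariants\<close>

text \<open>Since \<open>- A\<close> is again linear and bijective, the representatives of all
  cosets are exactly the elements of the general linear group, so invariance can be tested on the
  group itself.\<close>

lemma GL_coset:
  assumes "vector_space sE"
  shows "(\<exists>C\<in>carrier (GL sE Mod Z2). A \<in> C) \<longleftrightarrow> A \<in> carrier (GL sE)"
proof
  interpret vector_space sE by fact
  assume "\<exists>C\<in>carrier (GL sE Mod Z2). A \<in> C"
  then obtain B where B: "Vector_Spaces.linear sE sE B" "bij B" "A = B \<or> A = uminus \<circ> B"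
    by (auto simp: FactGroup_def RCOSETS_def r_coset_def GL_def Z2_def)
  interpret B: Vector_Spaces.linear sE sE B by fact
  have "Vector_Spaces.linear sE sE (uminus \<circ> B)"
    by unfold_locales (simp_all add: B.add B.scale)
  moreover have "bij (uminus \<circ> B)" by (rule bij_comp[OF B(2) bij_uminus])
  ultimately show "A \<in> carrier (GL sE)" using B by (auto simp: GL_def)
next
  assume A: "A \<in> carrier (GL sE)"
  then have "Z2 #>\<^bsub>GL sE\<^esub> A \<in> carrier (GL sE Mod Z2)" by (auto simp: FactGroup_def RCOSETS_def)
  moreover have "A \<in> Z2 #>\<^bsub>GL sE\<^esub> A" by (auto simp: r_coset_def GL_def Z2_def)
  ultimately show "\<exists>C\<in>carrier (GL sE Mod Z2). A \<in> C" by blast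
qed

lemma invariant_field_iff:
  assumes "vector_space sE"
  shows "X \<in> invariant_field sE sT sL L k \<longleftrightarrow> X \<in> carrier (symbol_rat_field sE sT sL L k) \<and>
    (\<forall>A\<in>carrier (GL sE). \<forall>f\<in>X. (\<lambda>\<sigma>. f (symbol_act A \<sigma>)) \<in> X)"
  unfolding invariant_field_def using GL_coset[OF assms] by blast

lemma rat_field_germE:
  assumes "X \<in> carrier (rat_field s V)"
  obtains p q w where "X = germ s V (\<lambda>v. p v / q v)" "p \<in> poly_fun s V" "q \<in> poly_fun s V" "w \<in> V" "q w \<noteq> 0"
  using assms unfolding rat_field_def by auto

text \<open>A nonzero germ has a numerator that is generically nonzero, so the pointwise inverse,
  whatever it is on the exceptional set, represents the inverse.\<close>

lemma rat_field_inv_germ: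
  assumes vs: "vector_space s" and sub: "Modules.module.subspace s V"
    and f: "germ s V f \<in> carrier (rat_field s V)" "germ s V f \<noteq> \<zero>\<^bsub>rat_field s V\<^esub>"
  shows "inv\<^bsub>rat_field s V\<^esub> (germ s V f) = germ s V (\<lambda>v. inverse (f v))"
    and "germ s V (\<lambda>v. inverse (f v)) \<in> carrier (rat_field s V)"
proof -
  let ?R = "rat_field s V"
  interpret R: field ?R by (rule field_rat_field[OF vs sub])
  note eq = germ_eq_iff[OF vs sub]
  obtain p q w where pq: "germ s V f = germ s V (\<lambda>v. p v / q v)" "p \<in> poly_fun s V" "q \<in> poly_fun s V"
      "w \<in> V" "q w \<noteq> 0"
    using rat_field_germE[OF f(1)] .
  then have fpq: "generically s V (\<lambda>v. f v = p v / q v)" by (simp add: eq)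
  have "\<exists>u\<in>V. p u \<noteq> 0"
  proof (rule ccontr)
    assume "\<not> ?thesis"
    then have "generically s V (\<lambda>v. f v = 0)" by (intro generically_mono[OF fpq]) auto
    then show False using f(2) by (simp add: rat_field_def eq)
  qed
  then obtain u where u: "u \<in> V" "p u \<noteq> 0" by blast
  have nz: "generically s V (\<lambda>v. p v \<noteq> 0)" "generically s V (\<lambda>v. q v \<noteq> 0)"
    using pq u unfolding generically_def by blast+
  then have "generically s V (\<lambda>v. f v = p v / q v \<and> p v \<noteq> 0 \<and> q v \<noteq> 0)"
    by (intro generically_conj[OF vs sub] fpq)
  then have one: "generically s V (\<lambda>v. f v * inverse (f v) = 1)"
    by (rule generically_mono) auto
  show c: "germ s V (\<lambda>v. inverse (f v)) \<in> carrier ?R"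
    by (rule carrier_rat_fieldI[OF vs sub pq(3,2) u]) (rule generically_mono[OF fpq], simp)
  have "germ s V f \<otimes>\<^bsub>?R\<^esub> germ s V (\<lambda>v. inverse (f v)) = \<one>\<^bsub>?R\<^esub>"
    unfolding rat_field_mult_germ[OF vs sub] using one by (simp add: rat_field_def eq)
  then show "inv\<^bsub>?R\<^esub> (germ s V f) = germ s V (\<lambda>v. inverse (f v))"
    by (rule R.comm_inv_char[OF f(1) c])
qed

context line_symbols
begin

abbreviation RF where "RF \<equiv> symbol_rat_field sE sT sL L k"
abbreviation PF where "PF \<equiv> procesi_field sE BE sT sL L k N q"
abbreviation genericallyS where "genericallyS \<equiv> generically (symbol_scale sL) VS"
abbreviation gm where "gm \<equiv> symbol_germ sE sT sL L k"

definition generators ::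
    "((('t list \<Rightarrow> complex) \<Rightarrow> 'e \<Rightarrow> 'e \<Rightarrow> 'l) \<Rightarrow> complex) set set"
  where "generators = range (\<lambda>c. gm (\<lambda>_. c)) \<union> (\<lambda>I. gm (procesi_invariant sE BE sL q I)) ` procesi_words N m"

lemma PF_eq: "PF = generate_field RF generators"
  by (simp add: procesi_field_def generators_def m_def E.dim_UNIV)

lemma gm_eq_iff: "gm f = gm g \<longleftrightarrow> genericallyS (\<lambda>v. f v = g v)"
  by (rule germ_eq_iff[OF vs_symbols sub_symbols])

lemma procesi_words_letters: "I \<in> procesi_words N m \<Longrightarrow> fst ` set I \<subseteq> {1..N}"
  by (simp add: procesi_words_def)

text \<open>The operators are specified only for invertible \<open>g\<close>, but nondegenerate
  symbols are generic and a germ ignores the rest.\<close>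

lemma gm_procesi_invariant:
  assumes "I \<in> procesi_words N m"
  shows "gm (procesi_invariant sE BE sL q I) = gm (\<lambda>\<sigma>. mtr (C.word \<sigma> I))"
  unfolding gm_eq_iff
  by (rule generically_mono[OF C.nondegenerate_generic])
    (rule procesi_invariant_eq[OF _ _ procesi_words_letters[OF assms]])

lemma gm_const_carrier: "gm (\<lambda>_. c) \<in> carrier RF"
proof -
  obtain u where "u \<in> VS" using C.nondegenerate_exists by blast
  then show ?thesis
    by (rule regular_at_carrier[OF vs_symbols sub_symbols fun_ring_const[OF fun_ring_regular_at]])
qed

lemma generators_carrier: "generators \<subseteq> carrier RF"
proof -
  obtain u where u: "u \<in> VS" "det (C.Gm u) \<noteq> 0" using C.nondegenerate_exists by blast
  have "gm (procesi_invariant sE BE sL q I) \<in> carrier RF" if I: "I \<in> procesi_words N m" for I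
    unfolding gm_procesi_invariant[OF I]
    by (rule regular_at_carrier[OF vs_symbols sub_symbols mat_in_mtr[OF fun_ring_regular_at
      C.regular_word[OF u procesi_words_letters[OF I]]] u(1)])
  then show ?thesis by (auto simp: generators_def gm_const_carrier)
qed

lemma PF_carrier: "PF \<subseteq> carrier RF"
proof -
  interpret R: field RF by (rule field_rat_field[OF vs_symbols sub_symbols])
  show ?thesis unfolding PF_eq using R.generate_field_in_carrier[OF generators_carrier] by blast
qed

lemma gm_const_PF: "gm (\<lambda>_. c) \<in> PF"
  unfolding PF_eq by (rule generate_field.incl) (simp add: generators_def)

lemma gm_inverse_PF:
  assumes "gm f \<in> PF"
  shows "gm (\<lambda>v. inverse (f v)) \<in> PF"
proof (cases "gm f = \<zero>\<^bsub>RF\<^esub>")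
  case True
  then have "genericallyS (\<lambda>v. f v = 0)" by (simp add: rat_field_def gm_eq_iff)
  then have "genericallyS (\<lambda>v. inverse (f v) = 0)"
    by (rule generically_mono) simp
  then have "gm (\<lambda>v. inverse (f v)) = gm (\<lambda>_. 0)" by (simp add: gm_eq_iff)
  then show ?thesis using gm_const_PF by simp
next
  case False
  then show ?thesis
    using rat_field_inv_germ(1)[OF vs_symbols sub_symbols _ False] assms PF_carrier
      generate_field.m_inv[of "gm f" RF generators] by (auto simp: PF_eq)
qed

lemma procesi_core_PF: "procesi_core (symbol_scale sL) VS m N Bm mk {f. gm f \<in> PF}"
proof (intro procesi_core.intro procesi_core_axioms.intro C.matrix_coords_axioms; unfold mem_Collect_eq)
  show "gm (\<lambda>v. f v + g v) \<in> PF" if "gm f \<in> PF" "gm g \<in> PF" for f g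
    using generate_field.eng_add[of "gm f" RF generators "gm g"] that
    by (simp add: PF_eq rat_field_add_germ[OF vs_symbols sub_symbols])
  show "gm (\<lambda>v. f v * g v) \<in> PF" if "gm f \<in> PF" "gm g \<in> PF" for f g
    using generate_field.eng_mult[of "gm f" RF generators "gm g"] that
    by (simp add: PF_eq rat_field_mult_germ[OF vs_symbols sub_symbols])
  show "gm g \<in> PF" if "gm f \<in> PF" "genericallyS (\<lambda>v. f v = g v)" for f g
    using that(1) iffD2[OF gm_eq_iff that(2)] by simp
  show "gm (\<lambda>v. mtr (C.word v I)) \<in> PF" if "I \<in> procesi_words N m" for I
    unfolding gm_procesi_invariant[OF that, symmetric] PF_eq
    using that by (intro generate_field.incl) (simp add: generators_def)
qed (auto intro: gm_const_PF gm_inverse_PF)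

text \<open>Every invertible matrix comes from a group element (\<open>congr_GL\<close>), so
  invariance of the germ supplies the hypothesis of \<open>congr_invariance\<close>, and the core
  theorem applies.\<close>

lemma invariant_subset: "invariant_field sE sT sL L k \<subseteq> PF"
proof
  interpret P: procesi_core "symbol_scale sL" VS m N Bm mk "{f. gm f \<in> PF}" by (rule procesi_core_PF)
  fix X assume X: "X \<in> invariant_field sE sT sL L k"
  note X' = X[unfolded invariant_field_iff[OF E.vector_space_axioms]]
  obtain p r w where pq: "X = gm (\<lambda>v. p v / r v)" "p \<in> poly_fun (symbol_scale sL) VS"
      "r \<in> poly_fun (symbol_scale sL) VS" "w \<in> VS" "r w \<noteq> 0"
    using X' by (auto elim: rat_field_germE)
  have "p (C.congr M v) * r v = p v * r (C.congr M v)"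
    if M: "M \<in> carrier_mat m m" "det M \<noteq> 0" and v: "v \<in> VS" for M v
  proof (rule C.congr_invariance[OF M pq(2-5) _ v])
    obtain A where A: "A \<in> carrier (GL sE)" "\<And>\<sigma>. \<sigma> \<in> VS \<Longrightarrow> symbol_act A \<sigma> = C.congr M \<sigma>"
      by (rule congr_GL[OF M]) (rule that)
    have "(\<lambda>v. p v / r v) \<in> X" unfolding pq(1) by (rule germ_self[OF vs_symbols sub_symbols])
    then have "(\<lambda>\<sigma>. p (symbol_act A \<sigma>) / r (symbol_act A \<sigma>)) \<in> X" using X' A(1) by auto
    then have "genericallyS (\<lambda>v. p v / r v = p (symbol_act A v) / r (symbol_act A v))"
      unfolding pq(1) by (simp add: germ_def)
    then show "genericallyS (\<lambda>v. p v / r v = p (C.congr M v) / r (C.congr M v))"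
      by (rule generically_mono) (simp add: A(2))
  qed
  then have "(\<lambda>v. p v / r v) \<in> {f. gm f \<in> PF}"
    by (intro P.rational_invariant_in_K[OF pq(2,3,5,4)])
  then show "X \<in> PF" by (simp add: pq(1))
qed

text \<open>Invariance of a single representative, with an exceptional set that may depend on
  \<open>M\<close>. In this form it passes through pointwise field operations.\<close>

definition invariant_fun :: "((('t list \<Rightarrow> complex) \<Rightarrow> 'e \<Rightarrow> 'e \<Rightarrow> 'l) \<Rightarrow> complex) \<Rightarrow> bool"
  where "invariant_fun f \<longleftrightarrow> (\<forall>M\<in>carrier_mat m m. det M \<noteq> 0 \<longrightarrow>
    genericallyS (\<lambda>v. f (C.congr M v) = f v))"

lemma invariant_fun_combine:
  assumes "invariant_fun f" "invariant_fun g"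
  shows "invariant_fun (\<lambda>v. h (f v) (g v))"
  unfolding invariant_fun_def
proof (intro ballI impI)
  fix M :: "complex mat" assume M: "M \<in> carrier_mat m m" "det M \<noteq> 0"
  have "genericallyS (\<lambda>v. f (C.congr M v) = f v \<and> g (C.congr M v) = g v)"
    using assms M by (intro generically_conj[OF vs_symbols sub_symbols]) (auto simp: invariant_fun_def)
  then show "genericallyS (\<lambda>v. h (f (C.congr M v)) (g (C.congr M v)) = h (f v) (g v))"
    by (rule generically_mono) simp
qed

lemma invariant_fun_const: "invariant_fun (\<lambda>_. c)"
  unfolding invariant_fun_def using generically_all[OF sub_symbols vs_symbols] by simp

text \<open>Induction over the generation of the field; the generators are constants and traces of
  words, and congruence conjugates a word.\<close>

lemma PF_invariant_germ:
  assumes "X \<in> PF"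
  shows "\<exists>f. X = gm f \<and> invariant_fun f"
  using assms unfolding PF_eq
proof (induction X rule: generate_field.induct)
  interpret R: field RF by (rule field_rat_field[OF vs_symbols sub_symbols])
  {
    case one
    then show ?case
      by (intro exI[of _ "\<lambda>_. 1"]) (simp add: rat_field_def invariant_fun_const)
  next
    case (incl h)
    then consider c where "h = gm (\<lambda>_. c)" | I where "I \<in> procesi_words N m" "h = gm (\<lambda>\<sigma>. mtr (C.word \<sigma> I))"
      using gm_procesi_invariant by (auto simp: generators_def)
    then show ?case
    proof cases
      case (2 I)
      have "genericallyS (\<lambda>v. mtr (C.word (C.congr M v) I) = mtr (C.word v I))"
        if M: "M \<in> carrier_mat m m" "det M \<noteq> 0" for M
        by (rule generically_mono[OF C.nondegenerate_generic])
          (rule C.mtr_word_congr[OF M _ procesi_words_letters[OF 2(1)]])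
      then show ?thesis using 2(2) unfolding invariant_fun_def by blast
    qed (blast intro: invariant_fun_const)
  next
    case (a_inv h)
    then obtain f where f: "h = gm f" "invariant_fun f" by blast
    have h: "h \<in> carrier RF" using a_inv(1) PF_carrier PF_eq by blast
    have "gm (\<lambda>v. - f v) \<in> carrier RF"
      using R.m_closed[OF gm_const_carrier[of "-1"] h] unfolding f(1) rat_field_mult_germ[OF vs_symbols sub_symbols] by simp
    moreover have "gm (\<lambda>v. - f v) \<oplus>\<^bsub>RF\<^esub> h = \<zero>\<^bsub>RF\<^esub>"
      unfolding f(1) rat_field_add_germ[OF vs_symbols sub_symbols] by (simp add: rat_field_def)
    ultimately have "\<ominus>\<^bsub>RF\<^esub> h = gm (\<lambda>v. - f v)"
      using h by (intro R.minus_equality) auto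
    then show ?case using invariant_fun_combine[OF f(2,2), of "\<lambda>x _. - x"] by blast
  next
    case (m_inv h)
    then obtain f where f: "h = gm f" "invariant_fun f" by blast
    have h: "h \<in> carrier RF" using m_inv(1) PF_carrier PF_eq by blast
    have "inv\<^bsub>RF\<^esub> h = gm (\<lambda>v. inverse (f v))"
      using rat_field_inv_germ(1)[OF vs_symbols sub_symbols] h m_inv(2) unfolding f(1) by blast
    then show ?case using invariant_fun_combine[OF f(2,2), of "\<lambda>x _. inverse x"] by blast
  next
    case (eng_add h1 h2)
    then obtain f g where "h1 = gm f" "invariant_fun f" "h2 = gm g" "invariant_fun g" by blast
    then show ?case
      using invariant_fun_combine[of f g "(+)"] rat_field_add_germ[OF vs_symbols sub_symbols] by blast
  next
    case (eng_mult h1 h2)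
    then obtain f g where "h1 = gm f" "invariant_fun f" "h2 = gm g" "invariant_fun g" by blast
    then show ?case
      using invariant_fun_combine[of f g "(*)"] rat_field_mult_germ[OF vs_symbols sub_symbols] by blast
  }
qed

lemma subset_invariant: "PF \<subseteq> invariant_field sE sT sL L k"
proof
  fix X assume X: "X \<in> PF"
  obtain f where f: "X = gm f" "invariant_fun f"
    using PF_invariant_germ[OF X] by blast
  have "(\<lambda>\<sigma>. f' (symbol_act A \<sigma>)) \<in> X" if A: "A \<in> carrier (GL sE)" and f': "f' \<in> X" for A f'
  proof -
    obtain M where M: "M \<in> carrier_mat m m" "det M \<noteq> 0" "\<And>\<sigma>. \<sigma> \<in> VS \<Longrightarrow> symbol_act A \<sigma> = C.congr M \<sigma>"
      by (rule GL_congr[OF A]) (rule that)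
    \<comment> \<open>The invariant field asks about every representative \<open>f'\<close> of the
      germ; its generic agreement with \<open>f\<close> is carried along the congruence.\<close>
    have "genericallyS (\<lambda>v. f v = f' v)" using f' by (simp add: f(1) germ_def)
    from C.generically_congr[OF this M(1,2)] f(2) M(1,2)
    have "genericallyS (\<lambda>v. f (C.congr M v) = f' (C.congr M v) \<and> f (C.congr M v) = f v)"
      by (intro generically_conj[OF vs_symbols sub_symbols]) (auto simp: invariant_fun_def)
    then have "genericallyS (\<lambda>v. f v = f' (symbol_act A v))"
      by (rule generically_mono) (metis M(3))
    then show ?thesis by (simp add: f(1) germ_def)
  qed
  then show "X \<in> invariant_field sE sT sL L k"
    unfolding invariant_field_iff[OF E.vector_space_axioms] using X PF_carrier by blast
qed

theorem invariant_field_eq: "invariant_field sE sT sL L k = PF"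
  using invariant_subset subset_invariant by blast

end

section \<open>The zero symbol space and the two choices of the dual\<close>

lemma invariant_field_eq_trivial:
  fixes sE :: "complex \<Rightarrow> 'e::ab_group_add \<Rightarrow> 'e" and sT :: "complex \<Rightarrow> 't::ab_group_add \<Rightarrow> 't"
    and sL :: "complex \<Rightarrow> 'l::ab_group_add \<Rightarrow> 'l"
  assumes vE: "vector_space sE"
    and vs: "vector_space (symbol_scale sL :: _ \<Rightarrow> (('t list \<Rightarrow> complex) \<Rightarrow> 'e \<Rightarrow> 'e \<Rightarrow> 'l) \<Rightarrow> _)"
    and sub: "Modules.module.subspace (symbol_scale sL) (symbols sE sT sL L k)"
    and triv: "symbols sE sT sL L k \<subseteq> {0}"
  shows "invariant_field sE sT sL L k = procesi_field sE BE sT sL L k N q"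
proof -
  let ?g = "symbol_germ sE sT sL L k" and ?V = "symbols sE sT sL L k" and ?R = "symbol_rat_field sE sT sL L k"
  interpret S: vector_space "symbol_scale sL :: _ \<Rightarrow> (('t list \<Rightarrow> complex) \<Rightarrow> 'e \<Rightarrow> 'e \<Rightarrow> 'l) \<Rightarrow> _"
    by fact
  interpret R: field ?R by (rule field_rat_field[OF vs sub])
  have V: "?V = {0}" using triv S.subspace_0[OF sub] by auto
  \<comment> \<open>On the zero space a property is generic iff it holds at \<open>0\<close>. All
    germs are then germs of constants, which are among the generators, so both sides are the whole
    field.\<close>
  have gen: "generically (symbol_scale sL) ?V P \<longleftrightarrow> P 0" for P
  proof
    show "generically (symbol_scale sL) ?V P \<Longrightarrow> P 0" by (auto simp: generically_def V)
    show "P 0 \<Longrightarrow> generically (symbol_scale sL) ?V P" by (rule generically_all[OF sub vs]) (simp add: V)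
  qed
  have germ_iff: "f' \<in> ?g f \<longleftrightarrow> f 0 = f' 0" for f f' by (simp add: germ_def gen)
  have const: "?g f = ?g (\<lambda>_. f 0)" for f by (simp add: germ_eq_iff[OF vs sub] gen)
  have carrier: "?g f \<in> carrier ?R" for f
    unfolding const[of f]
    by (rule regular_at_carrier[OF vs sub fun_ring_const[OF fun_ring_regular_at], of 0]) (simp add: V)
  have act: "symbol_act A 0 = (0 :: ('t list \<Rightarrow> complex) \<Rightarrow> 'e \<Rightarrow> 'e \<Rightarrow> 'l)" for A
    by (simp add: symbol_act_def dual_op_def fun_eq_iff)
  have "X \<in> procesi_field sE BE sT sL L k N q" if X: "X \<in> carrier ?R" for X
  proof -
    obtain f where "X = ?g f" using X unfolding rat_field_def by auto
    then have "X \<in> range (\<lambda>c. ?g (\<lambda>_. c))" using const[of f] by blast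
    then show ?thesis unfolding procesi_field_def by (intro generate_field.incl) blast
  qed
  moreover have "procesi_field sE BE sT sL L k N q \<subseteq> carrier ?R"
    unfolding procesi_field_def by (rule subsetI, erule R.generate_field_in_carrier[rotated]) (use carrier in auto)
  moreover have "X \<in> invariant_field sE sT sL L k" if X: "X \<in> carrier ?R" for X
  proof -
    obtain f where f: "X = ?g f" using X unfolding rat_field_def by auto
    show ?thesis
      unfolding invariant_field_iff[OF vE] using X by (auto simp: f germ_iff act)
  qed
  moreover have "invariant_field sE sT sL L k \<subseteq> carrier ?R" by (auto simp: invariant_field_def)
  ultimately show ?thesis by blast
qed

lemma invariant_field_eq_procesi_field:
  fixes sE :: "complex \<Rightarrow> 'e::ab_group_add \<Rightarrow> 'e" and sT :: "complex \<Rightarrow> 't::ab_group_add \<Rightarrow> 't"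
    and sL :: "complex \<Rightarrow> 'l::ab_group_add \<Rightarrow> 'l" and q :: "nat \<Rightarrow> 't list \<Rightarrow> complex"
  assumes E: "finite_dimensional_vector_space sE BE" and T: "vector_space sT"
    and vL: "vector_space sL" and subL: "Modules.module.subspace sL L"
    and line: "\<And>l u. l \<in> L \<Longrightarrow> l \<noteq> 0 \<Longrightarrow> u \<in> L \<Longrightarrow> \<exists>c. u = sL c l"
    and q: "\<forall>i\<in>{1..N}. q i \<in> sym_forms sT k" "inj_on q {1..N}"
      "\<not> Modules.module.dependent (fun_scale (*)) (q ` {1..N})"
      "sym_forms sT k \<subseteq> Modules.module.span (fun_scale (*)) (q ` {1..N})"
  shows "invariant_field sE sT sL L k = procesi_field sE BE sT sL L k N q"
proof (cases "BE = {} \<or> N = 0 \<or> L \<subseteq> {0}")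
  \<comment> \<open>The symbol space is zero here: E is zero, or there is no nonzero symmetric form,
    or no nonzero value. \<open>line_symbols\<close> asks for a basis vector, a form and a generator
    of \<open>L\<close>, so these cases are separated.\<close>
  case True
  interpret E: finite_dimensional_vector_space sE BE by fact
  interpret L: vector_space sL by fact
  have "symbols sE sT sL L k \<subseteq> {0}"
  proof
    fix \<sigma> assume \<sigma>: "\<sigma> \<in> symbols sE sT sL L k"
    have "\<sigma> w x y = 0" for w x y
    proof (cases "w \<in> sym_forms sT k")
      case w: True
      have H: "\<sigma> w x y \<in> L" "\<sigma> w (sE c x) y = sL c (\<sigma> w x y)"
        "\<sigma> (fun_scale (*) c w) x y = sL c (\<sigma> w x y)" for c x y
        using \<sigma> w by (auto simp: symbols_def Hom_E_Et_def Et_def lin_maps_def fun_scale_def)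
      show ?thesis
        using True
      proof (elim disjE)
        assume "BE = {}"
        then have "x = 0" using E.span_Basis by auto
        then show ?thesis using H(2)[of 0 0 y] by simp
      next
        assume "N = 0"
        interpret Q: vector_space "fun_scale ((*) :: complex \<Rightarrow> complex \<Rightarrow> complex) :: complex \<Rightarrow> ('t list \<Rightarrow> complex) \<Rightarrow> _"
          by (rule vector_space_fun_scale[OF vector_space_complex])
        have "w = 0" using q(4) w \<open>N = 0\<close> by auto
        then show ?thesis using H(3)[of 0 x y] by (simp add: fun_scale_def zero_fun_def)
      next
        assume "L \<subseteq> {0}"
        then show ?thesis using H(1)[of x y] by blast
      qed
    qed (use \<sigma> in \<open>simp add: symbols_def lin_maps_def\<close>)
    then show "\<sigma> \<in> {0}" by (simp add: fun_eq_iff)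
  qed
  then show ?thesis
    by (intro invariant_field_eq_trivial subspace_symbols E.vector_space_axioms T vL subL vector_space_fun_scale)
next
  case False
  then obtain l where l: "l \<in> L" "l \<noteq> 0" by blast
  interpret line_symbols sE BE sL sT L l k N q
    by (intro line_symbols.intro line_symbols_axioms.intro E T vL)
      (use False l line q subL in auto)
  show ?thesis by (rule invariant_field_eq)
qed

theorem theorem4:
  fixes sE :: "complex \<Rightarrow> 'e::ab_group_add \<Rightarrow> 'e" and BE :: "'e set"
    and sT :: "complex \<Rightarrow> 't::ab_group_add \<Rightarrow> 't" and BT :: "'t set"
    and k n N :: nat
    and q :: "nat \<Rightarrow> 't list \<Rightarrow> complex"
  assumes "finite_dimensional_vector_space sE BE"
    and "finite_dimensional_vector_space sT BT"
    and "n = vector_space.dim sT UNIV"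
    and "k \<ge> 1"
    and "N = (n + k - 1) choose k"
    and "\<forall>i\<in>{1..N}. q i \<in> sym_forms sT k"
    and "inj_on q {1..N}"
    and "\<not> module.dependent (fun_scale (*)) (q ` {1..N})"
  shows "invariant_field sE sT (*) (UNIV :: complex set) k =
           procesi_field sE BE sT (*) (UNIV :: complex set) k N q \<and>
         invariant_field sE sT (fun_scale (*)) (alt_forms sT n) k =
           procesi_field sE BE sT (fun_scale (*)) (alt_forms sT n) k N q"
proof
  interpret T: finite_dimensional_vector_space sT BT by fact
  interpret C: vector_space "(*) :: complex \<Rightarrow> complex \<Rightarrow> complex" by (rule vector_space_complex)
  note span = sym_forms_spanned[OF assms(2) assms(5)[unfolded assms(3)] assms(6-8)]
  note main = invariant_field_eq_procesi_field[OF assms(1) T.vector_space_axioms _ _ _ assms(6-8) span]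
  show "invariant_field sE sT (*) (UNIV :: complex set) k =
      procesi_field sE BE sT (*) (UNIV :: complex set) k N q"
  proof (rule main[OF C.vector_space_axioms C.subspace_UNIV])
    show "\<exists>c. u = c * l" if "l \<noteq> 0" for l u :: complex
      using that by (intro exI[of _ "u / l"]) simp
  qed
  show "invariant_field sE sT (fun_scale (*)) (alt_forms sT n) k =
      procesi_field sE BE sT (fun_scale (*)) (alt_forms sT n) k N q"
    by (rule main[OF vector_space_fun_scale[OF C.vector_space_axioms]
        subspace_alt_forms[OF T.vector_space_axioms] alt_forms_line[OF assms(2,3)]])
qed

end
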